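(* Let $\gamma_+:(\mathbb R,0)\to\mathbb R^2$ be a cooriented frontal germ with Legendre data $(\ell,\theta)$, i.e. $\gamma_+'(t)=\ell(t)\mathbf e(t)$ with $\mathbf e(t)=(\cos\theta(t),\sin\theta(t))$, and let $\gamma_-$ be an angularly regular cooriented frontal germ parametrised by tangent angle $u$ near $\theta(0)$, with $\gamma_-'(\theta(t))=-\rho_-(\theta(t))\mathbf e(t)$ (derivative with respect to $u$). Put $\Delta_\gamma(t)=\gamma_+(t)-\gamma_-(\theta(t))$, $\rho_{-,0}=\rho_-(\theta(0))$, and assume $\Delta_\gamma(0)\neq0$ and $\det(\Delta_\gamma(0),\mathbf e(0))\neq0$. Let $\mathrm E_{1/2}(t)=\frac12(\gamma_+(t)+\gamma_-(\theta(t)))$ be the Wigner caustic and $S(t)=\gamma_-(\theta(t))+\Lambda(t)\Delta_\gamma(t)$, with $\Lambda=\dfrac{\rho_-(\theta)\theta'}{\ell+\rho_-(\theta)\theta'}$, the finite centre symmetry set. Assume that $\gamma_+$ is a $5/3$-cusp at $0$. (i) If $\rho_{-,0}\ne0$, the Wigner caustic is a $5/2$-cusp at $0$. The centre symmetry set extends smoothly across $t=0$, passes through $\gamma_+(0)$ there, and is regular there. More precisely, $\Lambda$ extends smoothly with $$\Lambda(0)=1,\qquad \Lambda'(0)=-\frac{\ell''(0)}{2\rho_{-,0}\theta''(0)}\ne0 .$$ (ii) If $\rho_{-,0}=0$, the Wigner caustic is a $5/3$-cusp at $0$.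
   Context: All data are $C^\infty$. A smooth germ $\gamma:(\mathbb R,0)\to\mathbb R^2$ is a cooriented frontal if it has a smooth unit normal field $\mathbf n$ with $\gamma'\cdot\mathbf n=0$; with the unit tangent field $\mathbf e$ chosen so that $(\mathbf e,\mathbf n)$ is positively oriented, locally $\gamma'=\ell\mathbf e$, $\mathbf e=(\cos\theta,\sin\theta)$ with smooth $\ell,\theta$ (Legendre data). It is angularly regular if $\theta'\ne0$. The germ $\gamma_-$ is parametrised by its tangent angle, with its tangent lift $\mathbf e_-$ chosen so that $\mathbf e_-(\theta(t))=-\mathbf e(t)$; equivalently $\gamma_-'(u)=-\rho_-(u)(\cos u,\sin u)$ for $u$ near $\theta(0)$, where $\rho_-$ is smooth (its extended signed radius of curvature, possibly vanishing). The parallel pairs are $(\gamma_+(t),\gamma_-(\theta(t)))$. The centre symmetry set is the envelope of the chord lines $\gamma_-(\theta(t))+\lambda\Delta_\gamma(t)$, given by $S$ where the denominator of $\Lambda$ is nonzero and by smooth extension elsewhere when possible. A $5/2$-cusp (resp. $5/3$-cusp) is a germ that becomes $t\mapsto(t^2,t^5)$ (resp. $t\mapsto(t^3,t^5)$) after smooth diffeomorphism germs in source and target. *)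

theory Defs
  imports "HOL-Analysis.Analysis"
begin

text \<open>On an open set \<open>U\<close>, \<open>Ck_on k f U\<close> says that \<open>f\<close> is \<open>k\<close> times continuously differentiable;
  the recursion passes to every directional derivative.\<close>

primrec Ck_on :: "nat \<Rightarrow> ('a::euclidean_space \<Rightarrow> 'b::real_normed_vector) \<Rightarrow> 'a set \<Rightarrow> bool" where
  "Ck_on 0 f U \<longleftrightarrow> continuous_on U f"
| "Ck_on (Suc k) f U \<longleftrightarrow>
     f differentiable_on U \<and> (\<forall>v. Ck_on k (\<lambda>x. frechet_derivative f (at x) v) U)"

text \<open>Germs are represented by total functions. The neighbourhood in \<open>smooth_at\<close> is independent
  of the order of differentiability.\<close>

definition smooth_at :: "('a::euclidean_space \<Rightarrow> 'b::real_normed_vector) \<Rightarrow> 'a \<Rightarrow> bool" where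
  "smooth_at f p \<longleftrightarrow> (\<exists>U. open U \<and> p \<in> U \<and> (\<forall>k. Ck_on k f U))"

definition diffeo_germ :: "('a::euclidean_space \<Rightarrow> 'a) \<Rightarrow> 'a \<Rightarrow> 'a \<Rightarrow> bool" where
  "diffeo_germ f p q \<longleftrightarrow> f p = q \<and> smooth_at f p \<and>
     (\<exists>g. g q = p \<and> smooth_at g q \<and>
        (\<forall>\<^sub>F x in nhds p. g (f x) = x) \<and> (\<forall>\<^sub>F y in nhds q. f (g y) = y))"

text \<open>A \<open>q/p\<close>-cusp is \<open>cusp_at p q\<close>: the smaller exponent comes first.\<close>

definition cusp_at :: "nat \<Rightarrow> nat \<Rightarrow> (real \<Rightarrow> real^2) \<Rightarrow> real \<Rightarrow> bool" where
  "cusp_at p q \<gamma> t\<^sub>0 \<longleftrightarrow>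
     (\<exists>\<phi> \<Phi>. diffeo_germ \<phi> 0 t\<^sub>0 \<and> diffeo_germ \<Phi> (\<gamma> t\<^sub>0) 0 \<and>
        (\<forall>\<^sub>F s in nhds 0. \<Phi> (\<gamma> (\<phi> s)) = vector [s ^ p, s ^ q]))"

definition tangent_vec :: "real \<Rightarrow> real^2" where
  "tangent_vec a = vector [cos a, sin a]"

text \<open>\<open>(tangent_vec a, normal_vec a)\<close> is a positively oriented orthonormal frame.\<close>

definition normal_vec :: "real \<Rightarrow> real^2" where
  "normal_vec a = vector [- sin a, cos a]"

definition cooriented_frontal_at :: "(real \<Rightarrow> real^2) \<Rightarrow> (real \<Rightarrow> real^2) \<Rightarrow> real \<Rightarrow> bool" where
  "cooriented_frontal_at \<gamma> n t\<^sub>0 \<longleftrightarrow> smooth_at \<gamma> t\<^sub>0 \<and> smooth_at n t\<^sub>0 \<and>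
     (\<forall>\<^sub>F t in nhds t\<^sub>0. norm (n t) = 1 \<and> vector_derivative \<gamma> (at t) \<bullet> n t = 0)"

definition legendre_data_at ::
  "(real \<Rightarrow> real^2) \<Rightarrow> (real \<Rightarrow> real^2) \<Rightarrow> (real \<Rightarrow> real) \<Rightarrow> (real \<Rightarrow> real) \<Rightarrow> real \<Rightarrow> bool" where
  "legendre_data_at \<gamma> n l \<theta> t\<^sub>0 \<longleftrightarrow> smooth_at l t\<^sub>0 \<and> smooth_at \<theta> t\<^sub>0 \<and>
     (\<forall>\<^sub>F t in nhds t\<^sub>0. n t = normal_vec (\<theta> t) \<and>
        (\<gamma> has_vector_derivative l t *\<^sub>R tangent_vec (\<theta> t)) (at t))"

definition angularly_regular_at :: "(real \<Rightarrow> real^2) \<Rightarrow> (real \<Rightarrow> real^2) \<Rightarrow> real \<Rightarrow> bool" where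
  "angularly_regular_at \<gamma> n t\<^sub>0 \<longleftrightarrow>
     (\<exists>l \<theta>. legendre_data_at \<gamma> n l \<theta> t\<^sub>0 \<and> deriv \<theta> t\<^sub>0 \<noteq> 0)"

text \<open>The chord, the Wigner caustic and the centre symmetry set of the parallel pairs
  \<open>(\<gamma>p t, \<gamma>m (\<theta> t))\<close>; \<open>\<rho>\<close> is the extended signed radius of curvature of \<open>\<gamma>m\<close>. The values
  of \<open>css_ratio\<close> and \<open>css\<close> are meaningful only on \<open>css_domain\<close>.\<close>

definition chord :: "(real \<Rightarrow> real^2) \<Rightarrow> (real \<Rightarrow> real^2) \<Rightarrow> (real \<Rightarrow> real) \<Rightarrow> real \<Rightarrow> real^2" where
  "chord \<gamma>p \<gamma>m \<theta> t = \<gamma>p t - \<gamma>m (\<theta> t)"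

definition wigner_caustic ::
  "(real \<Rightarrow> real^2) \<Rightarrow> (real \<Rightarrow> real^2) \<Rightarrow> (real \<Rightarrow> real) \<Rightarrow> real \<Rightarrow> real^2" where
  "wigner_caustic \<gamma>p \<gamma>m \<theta> t = (1/2) *\<^sub>R (\<gamma>p t + \<gamma>m (\<theta> t))"

definition css_domain ::
  "(real \<Rightarrow> real) \<Rightarrow> (real \<Rightarrow> real) \<Rightarrow> (real \<Rightarrow> real) \<Rightarrow> real set" where
  "css_domain l \<theta> \<rho> = {t. l t + \<rho> (\<theta> t) * deriv \<theta> t \<noteq> 0}"

definition css_ratio ::
  "(real \<Rightarrow> real) \<Rightarrow> (real \<Rightarrow> real) \<Rightarrow> (real \<Rightarrow> real) \<Rightarrow> real \<Rightarrow> real" where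
  "css_ratio l \<theta> \<rho> t = \<rho> (\<theta> t) * deriv \<theta> t / (l t + \<rho> (\<theta> t) * deriv \<theta> t)"

definition css ::
  "(real \<Rightarrow> real^2) \<Rightarrow> (real \<Rightarrow> real^2) \<Rightarrow> (real \<Rightarrow> real) \<Rightarrow> (real \<Rightarrow> real) \<Rightarrow> (real \<Rightarrow> real) \<Rightarrow>
    real \<Rightarrow> real^2" where
  "css \<gamma>p \<gamma>m l \<theta> \<rho> t = \<gamma>m (\<theta> t) + css_ratio l \<theta> \<rho> t *\<^sub>R chord \<gamma>p \<gamma>m \<theta> t"

text \<open>\<open>F\<close> is the smooth extension across \<open>t\<^sub>0\<close> of the function \<open>f\<close> with domain \<open>D\<close>. Since \<open>D\<close>
  contains a punctured neighbourhood of \<open>t\<^sub>0\<close>, the germ of \<open>F\<close> is determined by \<open>f\<close> and \<open>D\<close>.\<close>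

definition smooth_extension_at ::
  "(real \<Rightarrow> 'b::real_normed_vector) \<Rightarrow> (real \<Rightarrow> 'b) \<Rightarrow> real set \<Rightarrow> real \<Rightarrow> bool" where
  "smooth_extension_at F f D t\<^sub>0 \<longleftrightarrow> smooth_at F t\<^sub>0 \<and> (\<forall>\<^sub>F t in at t\<^sub>0. t \<in> D) \<and>
     (\<forall>\<^sub>F t in nhds t\<^sub>0. t \<in> D \<longrightarrow> F t = f t)"

end

theory Submission
  imports Defs
begin

text \<open>With \<open>\<eta> = \<theta> - \<theta>(0)\<close>, a \<open>5/3\<close>-cusp satisfies \<open>l = L t\<^sup>2 + \<dots>\<close> and
  \<open>\<eta> = k t\<^sup>2 + \<dots>\<close> with \<open>L, k \<noteq> 0\<close>. The Wigner caustic has derivative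
  \<open>m (cos \<theta>, sin \<theta>)\<close> with \<open>m = (l - \<rho>(\<theta>) \<theta>') / 2\<close>, so in the frame at \<open>\<theta>(0)\<close> its components
  \<open>X, Y\<close> have derivatives \<open>m cos \<eta>\<close> and \<open>m sin \<eta>\<close>. If \<open>\<rho>(\<theta>(0)) = 0\<close>, then
  \<open>X \<sim> t\<^sup>3\<close> and \<open>Y \<sim> t ^ 5\<close>. Otherwise \<open>X \<sim> t\<^sup>2\<close>, and \<open>Y + X\<^sup>2 / \<rho>(\<theta>(0)) \<sim> t ^ 5\<close>
  because the contributions \<open>-\<rho>(\<theta>(0)) \<eta> / 2\<close> and \<open>-\<rho>(\<theta>(0)) \<eta>\<^sup>2 / 4\<close> of
  \<open>\<gamma>m\<close> to \<open>X\<close> and \<open>Y\<close> cancel.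

  Curves with these leading terms are brought to the monomial normal form by writing a smooth function
  as \<open>f(s) = \<Sum>i<p. s ^ i f\<^sub>i(s ^ p)\<close> with smooth \<open>f\<^sub>i\<close>: Borel's lemma matches the
  Taylor series, and a flat remainder stays smooth after substituting a \<open>p\<close>-th root.\<close>

section \<open>Smooth maps and germs\<close>

text \<open>A cusp is given by two unknown diffeomorphism germs, so the argument must translate
  between that notion and leading coefficients in both directions. From a cusp to numbers: with
  inverse germs \<tau> and \<Psi> the curve is \<Psi>(\<tau>^3, \<tau>^5). Its velocity combines the
  two partial derivatives of \<Psi> with weights of order t^2 and t^4, and these partials change
  only at order t^3. The tangential part gives \<open>L\<close>; the vanishing of the normal part
  balances the second weight against the rotation of the tangent and gives \<open>k\<close>. From
  numbers to a cusp: all terms beyond the leading ones must be removed. A term s^n with n in the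
  semigroup generated by p and q can be absorbed by a change of target coordinates. Every n > 5 lies
  in the semigroup of 2 and 5, whereas 7 is missing from that of 3 and 5, so the 5/3 case needs an
  extra mixing of coordinates.\<close>

named_theorems smooth_intros

section \<open>Calculus of the classes \<open>Ck_on\<close> on open sets\<close>

lemma Ck_on_cong:
  assumes "open U" "\<And>x. x \<in> U \<Longrightarrow> f x = g x" "Ck_on k f U"
  shows "Ck_on k g U"
  using assms(2,3)
proof (induction k arbitrary: f g)
  case 0
  from continuous_on_eq[of U f g] 0 show ?case
    unfolding Ck_on.simps by blast
next
  case (Suc k)
  have *: "(g has_derivative frechet_derivative f (at x)) (at x)" if "x \<in> U" for x
  proof -
    have "f differentiable at x"
      using Suc.prems(2) that \<open>open U\<close> by (simp add: differentiable_on_eq_differentiable_at)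
    then have "(f has_derivative frechet_derivative f (at x)) (at x)"
      using frechet_derivative_works by blast
    then show ?thesis
      by (rule has_derivative_transform_within_open[OF _ \<open>open U\<close> that]) (rule Suc.prems(1))
  qed
  then have "g differentiable_on U"
    using \<open>open U\<close> by (auto simp: differentiable_on_eq_differentiable_at differentiable_def)
  moreover have "Ck_on k (\<lambda>x. frechet_derivative g (at x) v) U" for v
  proof (rule Suc.IH)
    show "Ck_on k (\<lambda>x. frechet_derivative f (at x) v) U"
      using Suc.prems(2) by simp
    show "frechet_derivative f (at x) v = frechet_derivative g (at x) v" if "x \<in> U" for x
      using frechet_derivative_at[OF *[OF that]] by simp
  qed
  ultimately show ?case by simp
qed

lemma Ck_on_Suc_has_derivative:
  assumes "open U" "Ck_on (Suc k) f U" "x \<in> U"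
  shows "(f has_derivative frechet_derivative f (at x)) (at x)"
proof -
  have "f differentiable at x"
    using assms by (simp add: differentiable_on_eq_differentiable_at)
  then show ?thesis
    using frechet_derivative_works by blast
qed

text \<open>Lets a derivative computed by hand stand in for \<open>frechet_derivative\<close>; on an
  open set uniqueness makes the two agree.\<close>

lemma Ck_on_SucI:
  assumes "open U" "\<And>x. x \<in> U \<Longrightarrow> (f has_derivative f' x) (at x)"
    and "\<And>v. Ck_on k (\<lambda>x. f' x v) U"
  shows "Ck_on (Suc k) f U"
proof -
  have "f differentiable_on U"
    using assms(1,2) by (auto simp: differentiable_on_eq_differentiable_at differentiable_def)
  moreover have "Ck_on k (\<lambda>x. frechet_derivative f (at x) v) U" for v
    by (rule Ck_on_cong[OF assms(1) _ assms(3)]) (simp add: frechet_derivative_at[OF assms(2)])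
  ultimately show ?thesis by simp
qed

lemma Ck_on_Suc_D: "Ck_on (Suc k) f U \<Longrightarrow> Ck_on k f U"
proof (induction k arbitrary: f)
  case 0
  then show ?case by (auto intro: differentiable_imp_continuous_on)
qed auto

lemma Ck_on_subset:
  assumes "Ck_on k f U" "V \<subseteq> U"
  shows "Ck_on k f V"
  using assms
  by (induction k arbitrary: f) (auto intro: continuous_on_subset differentiable_on_subset)

lemma Ck_on_continuous_on: "Ck_on k f U \<Longrightarrow> continuous_on U f"
  by (cases k) (auto intro: differentiable_imp_continuous_on)

lemma Ck_on_local:
  assumes "open U" "\<And>x. x \<in> U \<Longrightarrow> \<exists>V. open V \<and> x \<in> V \<and> Ck_on k f V"
  shows "Ck_on k f U"
  using assms(2)
proof (induction k arbitrary: f)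
  case 0
  show ?case
    unfolding Ck_on.simps
  proof (rule continuous_at_imp_continuous_on, rule ballI)
    fix x assume "x \<in> U"
    from 0[OF this] show "isCont f x"
      using continuous_on_eq_continuous_at by auto
  qed
next
  case (Suc k)
  have "f differentiable (at x)" if x: "x \<in> U" for x
  proof -
    from Suc.prems[OF x] obtain V where "open V" "x \<in> V" "Ck_on (Suc k) f V" by blast
    from Ck_on_Suc_has_derivative[OF this(1,3,2)] show ?thesis
      by (auto simp: differentiable_def)
  qed
  then have "f differentiable_on U"
    using \<open>open U\<close> by (auto simp: differentiable_on_eq_differentiable_at)
  moreover have "Ck_on k (\<lambda>x. frechet_derivative f (at x) v) U" for v
    by (rule Suc.IH) (use Suc.prems in force)
  ultimately show ?case by simp
qed

lemma Ck_on_const: "Ck_on k (\<lambda>x. c) U"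
  by (induction k arbitrary: c) auto

lemma Ck_on_linear:
  assumes "bounded_linear L" "open U"
  shows "Ck_on k L U"
proof (cases k)
  case 0
  then show ?thesis
    using assms by (simp add: linear_continuous_on)
next
  case (Suc j)
  then show ?thesis
    using Ck_on_SucI[OF assms(2) bounded_linear_imp_has_derivative[OF assms(1)] Ck_on_const]
    by simp
qed

lemma Ck_on_add:
  assumes "open U" "Ck_on k f U" "Ck_on k g U"
  shows "Ck_on k (\<lambda>x. f x + g x) U"
  using assms(2,3)
proof (induction k arbitrary: f g)
  case 0
  then show ?case by (auto intro: continuous_intros)
next
  case (Suc k)
  show ?case
    by (rule Ck_on_SucI[OF assms(1)], rule has_derivative_add,
        rule Ck_on_Suc_has_derivative[OF assms(1) Suc.prems(1)], assumption,
        rule Ck_on_Suc_has_derivative[OF assms(1) Suc.prems(2)], assumption,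
        rule Suc.IH) (use Suc.prems in auto)
qed

lemma Ck_on_sum:
  assumes "open U" "\<And>i. i \<in> I \<Longrightarrow> Ck_on k (f i) U"
  shows "Ck_on k (\<lambda>x. \<Sum>i\<in>I. f i x) U"
  using assms(2)
  by (induction I rule: infinite_finite_induct) (auto intro: Ck_on_add Ck_on_const assms(1))

lemma Ck_on_scaleR:
  fixes f :: "'a::euclidean_space \<Rightarrow> real"
  assumes "open U" "Ck_on k f U" "Ck_on k g U"
  shows "Ck_on k (\<lambda>x. f x *\<^sub>R g x) U"
  using assms(2,3)
proof (induction k arbitrary: f g)
  case 0
  then show ?case by (auto intro: continuous_intros)
next
  case (Suc k)
  show ?case
    by (rule Ck_on_SucI[OF assms(1)], rule has_derivative_scaleR,
        rule Ck_on_Suc_has_derivative[OF assms(1) Suc.prems(1)], assumption,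
        rule Ck_on_Suc_has_derivative[OF assms(1) Suc.prems(2)], assumption,
        rule Ck_on_add[OF assms(1)]; rule Suc.IH)
       (use Suc.prems Ck_on_Suc_D in auto)
qed

lemma Ck_on_blinear_compose:
  assumes "bounded_linear L" "open U" "Ck_on k f U"
  shows "Ck_on k (\<lambda>x. L (f x)) U"
  using assms(3)
proof (induction k arbitrary: f)
  case 0
  then show ?case
    using bounded_linear.continuous_on[OF assms(1)] by auto
next
  case (Suc k)
  show ?case
    by (rule Ck_on_SucI[OF assms(2)], rule bounded_linear.has_derivative[OF assms(1)],
        rule Ck_on_Suc_has_derivative[OF assms(2) Suc.prems], assumption, rule Suc.IH)
       (use Suc.prems in auto)
qed

text \<open>The chain rule evaluates the derivative of g at f x in the moving direction Df x v,
  whereas \<open>Ck_on\<close> controls fixed directions only. Expanding in \<open>Basis\<close>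
  yields a finite sum of products: a coefficient of Df x v times a fixed-direction derivative of g
  composed with f, to which the induction hypothesis applies.\<close>

lemma Ck_on_compose:
  fixes f :: "'a::euclidean_space \<Rightarrow> 'b::euclidean_space" and g :: "'b \<Rightarrow> 'c::real_normed_vector"
  assumes "open U" "open V" "f ` U \<subseteq> V" "Ck_on k f U" "Ck_on k g V"
  shows "Ck_on k (\<lambda>x. g (f x)) U"
  using assms(3,4,5)
proof (induction k arbitrary: g)
  case 0
  then show ?case by (auto intro: continuous_on_compose2)
next
  case (Suc k)
  define Df where "Df x = frechet_derivative f (at x)" for x
  define Dg where "Dg x = frechet_derivative g (at x)" for x
  have Df: "(f has_derivative Df x) (at x)" if "x \<in> U" for x
    unfolding Df_def by (rule Ck_on_Suc_has_derivative[OF assms(1) Suc.prems(2) that])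
  have Dg: "(g has_derivative Dg (f x)) (at (f x))" if "x \<in> U" for x
    unfolding Dg_def by (rule Ck_on_Suc_has_derivative[OF assms(2) Suc.prems(3)]) (use that assms(3) in auto)
  have D: "((\<lambda>x. g (f x)) has_derivative (\<lambda>v. \<Sum>b\<in>Basis. (Df x v \<bullet> b) *\<^sub>R Dg (f x) b)) (at x)"
    if x: "x \<in> U" for x
  proof -
    have lin: "linear (Dg (f x))"
      using Dg[OF x] has_derivative_linear by blast
    have "Dg (f x) w = (\<Sum>b\<in>Basis. (w \<bullet> b) *\<^sub>R Dg (f x) b)" for w
    proof -
      have "Dg (f x) w = Dg (f x) (\<Sum>b\<in>Basis. (w \<bullet> b) *\<^sub>R b)"
        by (simp only: euclidean_representation)
      also have "\<dots> = (\<Sum>b\<in>Basis. (w \<bullet> b) *\<^sub>R Dg (f x) b)"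
        by (simp only: linear_sum[OF lin] linear_cmul[OF lin])
      finally show ?thesis .
    qed
    from this[symmetric]
    have "(\<lambda>v. \<Sum>b\<in>Basis. (Df x v \<bullet> b) *\<^sub>R Dg (f x) b) = (\<lambda>v. Dg (f x) (Df x v))"
      by (rule ext)
    then show ?thesis
      using has_derivative_compose[OF Df[OF x] Dg[OF x]] by (simp only:)
  qed
  show ?case
  proof (rule Ck_on_SucI[OF assms(1) D], assumption)
    fix v
    have 1: "Ck_on k (\<lambda>x. Df x v \<bullet> b) U" for b
      by (rule Ck_on_blinear_compose[OF bounded_linear_inner_left assms(1)])
         (use Suc.prems(2) in \<open>simp add: Df_def\<close>)
    have 2: "Ck_on k (\<lambda>x. Dg (f x) b) U" for b
      by (rule Suc.IH[OF Suc.prems(1) Ck_on_Suc_D[OF Suc.prems(2)]])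
         (use Suc.prems(3) in \<open>simp add: Dg_def\<close>)
    show "Ck_on k (\<lambda>x. \<Sum>b\<in>Basis. (Df x v \<bullet> b) *\<^sub>R Dg (f x) b) U"
      by (intro Ck_on_sum Ck_on_scaleR assms(1) 1 2)
  qed
qed

text \<open>A tower lists a function and all its derivatives explicitly. Smoothness proofs below
  exhibit such a sequence instead of computing iterated derivatives.\<close>

lemma Ck_on_of_tower:
  fixes G :: "nat \<Rightarrow> real \<Rightarrow> real"
  assumes "open U" "\<And>k x. x \<in> U \<Longrightarrow> (G k has_real_derivative G (Suc k) x) (at x)"
  shows "Ck_on k (G n) U"
proof (induction k arbitrary: n)
  case 0
  have "isCont (G n) x" if "x \<in> U" for x
    using assms(2)[OF that] DERIV_isCont by blast
  then show ?case by (auto intro: continuous_at_imp_continuous_on)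
next
  case (Suc k)
  show ?case
  proof (rule Ck_on_SucI[OF assms(1)])
    show "(G n has_derivative (\<lambda>v. G (Suc n) x *\<^sub>R v)) (at x)" if "x \<in> U" for x
      using assms(2)[OF that] by (simp add: has_field_derivative_def)
    show "Ck_on k (\<lambda>x. G (Suc n) x *\<^sub>R v) U" for v :: real
      by (rule Ck_on_scaleR[OF assms(1) Suc Ck_on_const])
  qed
qed

section \<open>Closure properties of smooth germs\<close>

lemma smooth_atI: "open U \<Longrightarrow> p \<in> U \<Longrightarrow> (\<And>k. Ck_on k f U) \<Longrightarrow> smooth_at f p"
  by (auto simp: smooth_at_def)

lemma smooth_at_of_tower:
  fixes G :: "nat \<Rightarrow> real \<Rightarrow> real"
  assumes "open U" "p \<in> U" "\<And>k x. x \<in> U \<Longrightarrow> (G k has_real_derivative G (Suc k) x) (at x)"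
  shows "smooth_at (G n) p"
  using assms Ck_on_of_tower by (intro smooth_atI[of U]) auto

lemma smooth_at_cong:
  assumes "smooth_at f p" "\<forall>\<^sub>F x in nhds p. f x = g x"
  shows "smooth_at g p"
proof -
  obtain U where U: "open U" "p \<in> U" "\<And>k. Ck_on k f U"
    using assms(1) by (auto simp: smooth_at_def)
  obtain V where V: "open V" "p \<in> V" "\<And>x. x \<in> V \<Longrightarrow> f x = g x"
    using assms(2) by (auto simp: eventually_nhds)
  show ?thesis
  proof (rule smooth_atI)
    show "open (U \<inter> V)" using U V by auto
    then show "Ck_on k g (U \<inter> V)" for k
      by (rule Ck_on_cong[OF _ _ Ck_on_subset[OF U(3)]]) (use V in auto)
  qed (use U V in auto)
qed

lemma eventually_smooth_at:
  assumes "smooth_at f p"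
  shows "\<forall>\<^sub>F x in nhds p. smooth_at f x"
  using assms unfolding smooth_at_def eventually_nhds by blast

lemma smooth_at_has_derivative:
  assumes "smooth_at f p"
  shows "(f has_derivative frechet_derivative f (at p)) (at p)"
  using assms Ck_on_Suc_has_derivative unfolding smooth_at_def by blast

lemma smooth_at_isCont: "smooth_at f p \<Longrightarrow> isCont f p"
  using has_derivative_continuous smooth_at_has_derivative by blast

lemma smooth_at_frechet:
  assumes "smooth_at f p"
  shows "smooth_at (\<lambda>x. frechet_derivative f (at x) v) p"
  using assms unfolding smooth_at_def by (metis Ck_on.simps(2))

lemma smooth_at_const [smooth_intros]: "smooth_at (\<lambda>x. c) p"
  by (rule smooth_atI[of UNIV]) (auto simp: Ck_on_const)

lemma smooth_at_linear: "bounded_linear L \<Longrightarrow> smooth_at L p"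
  by (rule smooth_atI[of UNIV]) (auto simp: Ck_on_linear)

lemma smooth_at_ident [smooth_intros]: "smooth_at (\<lambda>x. x) p"
  by (rule smooth_at_linear) (rule bounded_linear_ident)

lemma smooth_at_binary:
  assumes "smooth_at f p" "smooth_at g p"
    and "\<And>U k. open U \<Longrightarrow> Ck_on k f U \<Longrightarrow> Ck_on k g U \<Longrightarrow> Ck_on k h U"
  shows "smooth_at h p"
proof -
  obtain U where U: "open U" "p \<in> U" "\<And>k. Ck_on k f U"
    using assms(1) by (auto simp: smooth_at_def)
  obtain V where V: "open V" "p \<in> V" "\<And>k. Ck_on k g V"
    using assms(2) by (auto simp: smooth_at_def)
  have "open (U \<inter> V)" using U V by auto
  then show ?thesis
    by (rule smooth_atI[OF _ _ assms(3)])
       (use U V in \<open>auto intro: Ck_on_subset\<close>)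
qed

lemma smooth_at_add [smooth_intros]:
  assumes "smooth_at f p" "smooth_at g p"
  shows "smooth_at (\<lambda>x. f x + g x) p"
  by (rule smooth_at_binary[OF assms Ck_on_add])

lemma smooth_at_scaleR [smooth_intros]:
  assumes "smooth_at f p" "smooth_at g p"
  shows "smooth_at (\<lambda>x. f x *\<^sub>R g x) p"
  by (rule smooth_at_binary[OF assms Ck_on_scaleR])

lemma smooth_at_mult [smooth_intros]:
  fixes f g :: "'a::euclidean_space \<Rightarrow> real"
  shows "smooth_at f p \<Longrightarrow> smooth_at g p \<Longrightarrow> smooth_at (\<lambda>x. f x * g x) p"
  using smooth_at_scaleR[of f p g] by simp

lemma smooth_at_blinear_compose:
  assumes "bounded_linear L" "smooth_at f p"
  shows "smooth_at (\<lambda>x. L (f x)) p"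
  using assms Ck_on_blinear_compose unfolding smooth_at_def by blast

lemma smooth_at_uminus [smooth_intros]: "smooth_at f p \<Longrightarrow> smooth_at (\<lambda>x. - f x) p"
  by (rule smooth_at_blinear_compose[OF bounded_linear_minus[OF bounded_linear_ident]])

lemma smooth_at_diff [smooth_intros]: "smooth_at f p \<Longrightarrow> smooth_at g p \<Longrightarrow> smooth_at (\<lambda>x. f x - g x) p"
  using smooth_at_add[of f p "\<lambda>x. - g x"] by (simp add: smooth_intros)

lemma smooth_at_inner_const [smooth_intros]: "smooth_at f p \<Longrightarrow> smooth_at (\<lambda>x. f x \<bullet> v) p"
  by (rule smooth_at_blinear_compose[OF bounded_linear_inner_left])

lemma smooth_at_power [smooth_intros]:
  fixes f :: "'a::euclidean_space \<Rightarrow> real"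
  shows "smooth_at f p \<Longrightarrow> smooth_at (\<lambda>x. f x ^ n) p"
  by (induction n) (simp_all add: smooth_intros)

lemma smooth_at_sum [smooth_intros]:
  "(\<And>i. i \<in> I \<Longrightarrow> smooth_at (f i) p) \<Longrightarrow> smooth_at (\<lambda>x. \<Sum>i\<in>I. f i x) p"
  by (induction I rule: infinite_finite_induct) (simp_all add: smooth_intros)

lemma smooth_at_compose:
  fixes f :: "'a::euclidean_space \<Rightarrow> 'b::euclidean_space" and g :: "'b \<Rightarrow> 'c::real_normed_vector"
  assumes "smooth_at g (f p)" "smooth_at f p"
  shows "smooth_at (\<lambda>x. g (f x)) p"
proof -
  obtain U where U: "open U" "p \<in> U" "\<And>k. Ck_on k f U"
    using assms(2) by (auto simp: smooth_at_def)
  obtain V where V: "open V" "f p \<in> V" "\<And>k. Ck_on k g V"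
    using assms(1) by (auto simp: smooth_at_def)
  have op: "open (f -` V \<inter> U)"
    using continuous_open_preimage[OF Ck_on_continuous_on[OF U(3)[of 0]] U(1) V(1)]
    by (simp add: Int_commute)
  show ?thesis
    by (rule smooth_atI[OF op _ Ck_on_compose[OF op V(1) _ Ck_on_subset[OF U(3)] V(3)]])
       (use U V in auto)
qed

lemma smooth_at_vector [smooth_intros]:
  fixes f g :: "'a::euclidean_space \<Rightarrow> real"
  assumes "smooth_at f p" "smooth_at g p"
  shows "smooth_at (\<lambda>x. vector [f x, g x] :: real^2) p"
proof -
  have "(vector [f x, g x] :: real^2) = f x *\<^sub>R axis 1 1 + g x *\<^sub>R axis 2 1" for x
    by (auto simp: vec_eq_iff forall_2 axis_def)
  then show ?thesis
    by (simp only:) (intro smooth_intros assms)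
qed

lemma smooth_at_nth [smooth_intros]:
  fixes f :: "'a::euclidean_space \<Rightarrow> real^'n"
  shows "smooth_at f p \<Longrightarrow> smooth_at (\<lambda>x. f x $ i) p"
  by (rule smooth_at_blinear_compose[OF bounded_linear_vec_nth])

lemma smooth_at_has_real_derivative:
  fixes f :: "real \<Rightarrow> real"
  assumes "smooth_at f p"
  shows "(f has_real_derivative deriv f p) (at p)"
  using smooth_at_has_derivative[OF assms] DERIV_deriv_iff_real_differentiable differentiableI
  by blast

lemma eventually_has_real_derivative:
  fixes f :: "real \<Rightarrow> real"
  assumes "smooth_at f p"
  shows "\<forall>\<^sub>F x in nhds p. (f has_real_derivative deriv f x) (at x)"
  using eventually_smooth_at[OF assms] by eventually_elim (rule smooth_at_has_real_derivative)

lemma smooth_at_deriv [smooth_intros]: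
  fixes f :: "real \<Rightarrow> real"
  assumes "smooth_at f p"
  shows "smooth_at (deriv f) p"
proof (rule smooth_at_cong[OF smooth_at_frechet[OF assms, of 1]])
  show "\<forall>\<^sub>F x in nhds p. frechet_derivative f (at x) 1 = deriv f x"
    using eventually_has_real_derivative[OF assms]
  proof eventually_elim
    case (elim x)
    then have "frechet_derivative f (at x) = (*) (deriv f x)"
      using frechet_derivative_at by (metis has_field_derivative_def)
    then show ?case by simp
  qed
qed

lemma smooth_at_deriv_funpow [smooth_intros]:
  fixes f :: "real \<Rightarrow> real"
  shows "smooth_at f p \<Longrightarrow> smooth_at ((deriv ^^ n) f) p"
  by (induction n) (simp_all add: smooth_intros)

lemma smooth_at_sin_cos: "smooth_at sin (a::real)" "smooth_at cos (a::real)"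
proof -
  define G where "G k x = (if even k then (-1) ^ (k div 2) * sin x else (-1) ^ (k div 2) * cos x)"
    for k :: nat and x :: real
  have "(G k has_real_derivative G (Suc k) x) (at x)" for k x
    unfolding G_def by (cases "even k") (auto intro!: derivative_eq_intros)
  then have "smooth_at (G 0) a" "smooth_at (G 1) a"
    using smooth_at_of_tower[of UNIV a G] by auto
  then show "smooth_at sin a" "smooth_at cos a"
    by (simp_all add: G_def[abs_def])
qed

lemma Ck_on_powr: "Ck_on k (\<lambda>x::real. c * x powr a) {0<..}"
proof -
  define G where "G k x = (\<Prod>i<k. a - real i) * c * x powr (a - real k)" for k x
  have "(G k has_real_derivative G (Suc k) x) (at x)" if "x \<in> {0<..}" for k x
    unfolding G_def using that
    by (auto intro!: derivative_eq_intros simp: algebra_simps)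
  then have "Ck_on k (G 0) {0<..}"
    by (intro Ck_on_of_tower) auto
  then show ?thesis by (simp add: G_def[abs_def])
qed

lemma smooth_at_powr [smooth_intros]:
  fixes f :: "'a::euclidean_space \<Rightarrow> real"
  assumes "smooth_at f p" "f p > 0"
  shows "smooth_at (\<lambda>x. f x powr a) p"
proof (rule smooth_at_compose[OF _ assms(1)])
  show "smooth_at (\<lambda>y. y powr a) (f p)"
    by (rule smooth_atI[of "{0<..}"]) (use assms(2) Ck_on_powr[of _ 1 a] in auto)
qed

lemma smooth_at_inverse [smooth_intros]:
  fixes f :: "'a::euclidean_space \<Rightarrow> real"
  assumes "smooth_at f p" "f p \<noteq> 0"
  shows "smooth_at (\<lambda>x. inverse (f x)) p"
proof (rule smooth_at_cong)
  \<comment> \<open>The reciprocal is written as f (f^2)^(-1), so that \<open>powr\<close> has a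
    positive base even where f is negative. Where f vanishes both sides are 0, so the identity holds
    everywhere.\<close>
  have 1: "smooth_at (\<lambda>x. f x * ((f x)\<^sup>2 powr (-1))) p"
    by (intro smooth_at_mult smooth_at_powr smooth_at_power assms) (use assms in auto)
  then show "smooth_at (\<lambda>x. f x * ((f x)\<^sup>2 powr (-1))) p" .
  show "\<forall>\<^sub>F x in nhds p. f x * ((f x)\<^sup>2 powr (-1)) = inverse (f x)"
    by (rule always_eventually) (simp add: powr_minus power2_eq_square field_simps)
qed

lemma smooth_at_divide [smooth_intros]:
  fixes f g :: "'a::euclidean_space \<Rightarrow> real"
  assumes "smooth_at f p" "smooth_at g p" "g p \<noteq> 0"
  shows "smooth_at (\<lambda>x. f x / g x) p"
  using smooth_at_mult[OF assms(1) smooth_at_inverse[OF assms(2,3)]] by (simp add: divide_inverse)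

lemma smooth_at_sqrt [smooth_intros]:
  fixes f :: "'a::euclidean_space \<Rightarrow> real"
  assumes "smooth_at f p" "f p > 0"
  shows "smooth_at (\<lambda>x. sqrt (f x)) p"
proof (rule smooth_at_cong[OF smooth_at_powr[OF assms]])
  have "\<forall>\<^sub>F x in nhds p. f x > 0"
    using order_tendstoD(1)[OF _ assms(2)] smooth_at_isCont[OF assms(1)]
    by (simp add: continuous_within tendsto_at_iff_tendsto_nhds)
  then show "\<forall>\<^sub>F x in nhds p. f x powr (1/2) = sqrt (f x)"
    by eventually_elim (simp add: powr_half_sqrt)
qed

lemma Ck_on_of_smooth_at:
  assumes "open U" "\<And>x. x \<in> U \<Longrightarrow> smooth_at f x"
  shows "Ck_on k f U"
  by (rule Ck_on_local[OF assms(1)]) (use assms(2) in \<open>auto simp: smooth_at_def\<close>)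

text \<open>The inverse function theorem supplies a differentiable inverse g. Its derivative is 1 /
  \<phi>'(g), so g of class C^k has a derivative of class C^k and is itself of class C^(k+1); this
  bootstrap gives smoothness on one fixed neighbourhood.\<close>

lemma inverse_germ_real:
  fixes \<phi> :: "real \<Rightarrow> real"
  assumes "smooth_at \<phi> p" "deriv \<phi> p \<noteq> 0"
  shows "diffeo_germ \<phi> p (\<phi> p)"
proof -
  have "\<forall>\<^sub>F x in nhds p. deriv \<phi> x \<noteq> 0"
    using smooth_at_isCont[OF smooth_at_deriv[OF assms(1)]] assms(2)
    by (simp add: continuous_within tendsto_at_iff_tendsto_nhds tendsto_imp_eventually_ne)
  with eventually_smooth_at[OF assms(1)]
  have "\<forall>\<^sub>F x in nhds p. smooth_at \<phi> x \<and> deriv \<phi> x \<noteq> 0"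
    by eventually_elim simp
  then obtain U where U: "open U" "p \<in> U" "\<And>x. x \<in> U \<Longrightarrow> smooth_at \<phi> x" "\<And>x. x \<in> U \<Longrightarrow> deriv \<phi> x \<noteq> 0"
    by (auto simp: eventually_nhds)
  define f' where "f' x = blinfun_mult_right (deriv \<phi> x)" for x
  have f': "blinfun_apply (f' x) = (*) (deriv \<phi> x)" for x
    by (simp add: f'_def fun_eq_iff)
  have cont: "continuous_on U (deriv \<phi>)"
    by (rule Ck_on_continuous_on[OF Ck_on_of_smooth_at[OF U(1), of _ 0]]) (intro smooth_intros U)
  have 1: "continuous_on U f'"
    unfolding f'_def
    by (rule bounded_linear.continuous_on[OF bounded_linear_blinfun_mult_right cont])
  have 2: "(\<phi> has_derivative blinfun_apply (f' x)) (at x)" if "x \<in> U" for x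
    using smooth_at_has_real_derivative[OF U(3)[OF that]] by (simp add: has_field_derivative_def f')
  have 3: "blinfun_mult_right (inverse (deriv \<phi> p)) o\<^sub>L f' p = id_blinfun"
    by (rule blinfun_eqI) (use U in \<open>simp add: f'\<close>)
  obtain U' V g g' where g: "open U'" "U' \<subseteq> U" "p \<in> U'" "open V" "\<phi> p \<in> V"
    "homeomorphism U' V \<phi> g" "\<And>y. y \<in> V \<Longrightarrow> (g has_derivative (g' y)) (at y)"
    "\<And>y. y \<in> V \<Longrightarrow> g' y = inv (blinfun_apply (f' (g y)))"
    "\<And>y. y \<in> V \<Longrightarrow> bij (blinfun_apply (f' (g y)))"
    using inverse_function_theorem[OF U(1) 2 1 U(2) 3] by metis
  have gU: "g y \<in> U" if "y \<in> V" for y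
    using g(2,6) that by (auto simp: homeomorphism_def)
  have dg: "(g has_derivative (\<lambda>v. inverse (deriv \<phi> (g y)) *\<^sub>R v)) (at y)" if "y \<in> V" for y
  proof -
    have "deriv \<phi> (g y) \<noteq> 0" using U(4) gU that by blast
    then have "g' y = (\<lambda>v. inverse (deriv \<phi> (g y)) *\<^sub>R v)"
      unfolding g(8)[OF that] f' by (intro inv_equality) auto
    then show ?thesis using g(7)[OF that] by (simp only:)
  qed
  have Ck: "Ck_on k g V" for k
  proof (induction k)
    case 0
    then show ?case using g(6) by (simp add: homeomorphism_def)
  next
    case (Suc k)
    have "Ck_on k (\<lambda>x. inverse (deriv \<phi> x)) U"
      by (rule Ck_on_of_smooth_at[OF U(1)]) (intro smooth_intros U, assumption+)
    then have "Ck_on k (\<lambda>y. inverse (deriv \<phi> (g y))) V"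
      by (intro Ck_on_compose[OF g(4) U(1) _ Suc]) (use gU in auto)
    then show ?case
      by (intro Ck_on_SucI[OF g(4) dg] Ck_on_scaleR Ck_on_const g(4))
  qed
  have "g (\<phi> p) = p" using g(3,6) by (auto simp: homeomorphism_def)
  moreover have "smooth_at g (\<phi> p)"
    using smooth_atI g(4,5) Ck by blast
  moreover have "\<forall>\<^sub>F x in nhds p. g (\<phi> x) = x"
    using g(1,3,6) by (auto simp: eventually_nhds homeomorphism_def)
  moreover have "\<forall>\<^sub>F y in nhds (\<phi> p). \<phi> (g y) = y"
    using g(4,5,6) by (auto simp: eventually_nhds homeomorphism_def)
  ultimately show ?thesis
    unfolding diffeo_germ_def using assms(1) by blast
qed

section \<open>Taylor expansions and division\<close>

text \<open>The quotient is the integral of f'(t u) over u in [0, 1]. Differentiating under the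
  integral, its k-th derivative is the integral of u^k times the (k+1)-st derivative of f at t u,
  which is a tower.\<close>

lemma hadamard:
  fixes f :: "real \<Rightarrow> real"
  assumes "smooth_at f 0"
  obtains g where "smooth_at g 0" "\<forall>\<^sub>F t in nhds 0. f t = f 0 + t * g t"
proof -
  obtain \<epsilon> where \<epsilon>: "\<epsilon> > 0" "\<And>x. x \<in> ball 0 \<epsilon> \<Longrightarrow> smooth_at f x"
    using eventually_smooth_at[OF assms] by (auto simp: eventually_nhds_metric dist_commute)
  define F where "F k = (deriv ^^ k) f" for k
  have F: "(F k has_real_derivative F (Suc k) x) (at x)" if "x \<in> ball 0 \<epsilon>" for k x
    using smooth_at_has_real_derivative[OF smooth_at_deriv_funpow[OF \<epsilon>(2)[OF that]], of k]
    by (simp add: F_def)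
  have ball: "t * u \<in> ball 0 \<epsilon>" if "t \<in> ball 0 \<epsilon>" "u \<in> cbox 0 1" for t u :: real
  proof -
    have "\<bar>t\<bar> * \<bar>u\<bar> \<le> \<bar>t\<bar> * 1"
      using that by (intro mult_left_mono) auto
    then show ?thesis using that by (simp add: abs_mult)
  qed
  have F_chain: "((\<lambda>x. F k (x * u)) has_real_derivative F (Suc k) (x * u) * u) (at x within A)"
    if "x \<in> ball 0 \<epsilon>" "u \<in> cbox 0 1" for k x u A
    by (rule DERIV_subset[OF DERIV_chain2[where g="\<lambda>x. x * u", OF F[OF ball[OF that]]]])
       (auto intro!: derivative_eq_intros)
  have contF: "continuous_on (ball 0 \<epsilon>) (F k)" for k
    using F DERIV_isCont by (blast intro: continuous_at_imp_continuous_on)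
  define g where "g k t = integral (cbox 0 1) (\<lambda>u. u ^ k * F (Suc k) (t * u))" for k and t :: real
  have cont2: "continuous_on (ball 0 \<epsilon> \<times> cbox 0 1) (\<lambda>(t, u). u ^ k * F m (t * u))" for k m
    unfolding case_prod_beta
    by (intro continuous_intros continuous_on_compose2[OF contF]) (use ball in auto)
  have contu: "continuous_on (cbox 0 1) (\<lambda>u. u ^ k * F m (t * u))" if "t \<in> ball 0 \<epsilon>" for k m t
    by (intro continuous_intros continuous_on_compose2[OF contF]) (use ball that in auto)
  have g_deriv: "(g k has_real_derivative g (Suc k) t) (at t)" if "t \<in> ball 0 \<epsilon>" for k t
  proof -
    have "((\<lambda>t. integral (cbox 0 1) (\<lambda>u. u ^ k * F (Suc k) (t * u))) has_real_derivative
            integral (cbox 0 1) (\<lambda>u. u ^ Suc k * F (Suc (Suc k)) (t * u))) (at t within ball 0 \<epsilon>)"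
    proof (rule leibniz_rule_field_derivative)
      show "((\<lambda>x. u ^ k * F (Suc k) (x * u)) has_real_derivative u ^ Suc k * F (Suc (Suc k)) (x * u))
          (at x within ball 0 \<epsilon>)" if "x \<in> ball 0 \<epsilon>" "u \<in> cbox 0 1" for x u
        using DERIV_cmult[OF F_chain[OF that, of "Suc k"], of "u ^ k"] by (simp add: mult_ac)
    next
      show "(\<lambda>u. u ^ k * F (Suc k) (x * u)) integrable_on cbox 0 1" if "x \<in> ball 0 \<epsilon>" for x
        by (rule integrable_continuous[OF contu[OF that]])
    qed (rule cont2 that convex_ball)+
    then show ?thesis
      using that by (simp add: g_def[abs_def] at_within_open[OF _ open_ball])
  qed
  have "smooth_at (g 0) 0"
    by (rule smooth_at_of_tower[where G=g and U="ball 0 \<epsilon>", OF open_ball _ g_deriv]) (use \<epsilon> in auto)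
  moreover have "f t = f 0 + t * g 0 t" if t: "t \<in> ball 0 \<epsilon>" for t
  proof -
    have "((\<lambda>u. t * F 1 (t * u)) has_integral (F 0 (t * 1) - F 0 (t * 0))) {0..1}"
    proof (rule fundamental_theorem_of_calculus)
      fix u :: real assume "u \<in> {0..1}"
      then have "t * u \<in> ball 0 \<epsilon>" using ball[OF t] by auto
      from DERIV_chain2[where g="\<lambda>u. t * u", OF F[OF this, of 0]]
      have "((\<lambda>u. F 0 (t * u)) has_real_derivative F 1 (t * u) * t) (at u)"
        by (auto intro: derivative_eq_intros)
      then show "((\<lambda>u. F 0 (t * u)) has_vector_derivative t * F 1 (t * u)) (at u within {0..1})"
        unfolding has_real_derivative_iff_has_vector_derivative[symmetric] mult.commute[of t "F 1 _"]
        by (rule has_field_derivative_at_within)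
    qed simp
    from integral_unique[OF this]
    have "F 0 t - F 0 0 = integral {0..1} (\<lambda>u. t * F 1 (t * u))"
      by (simp only: mult_1_right mult_zero_right)
    also have "\<dots> = t * g 0 t"
      by (simp add: g_def)
    finally show ?thesis by (simp add: F_def)
  qed
  then have "\<forall>\<^sub>F t in nhds 0. f t = f 0 + t * g 0 t"
    using \<epsilon>(1) open_ball centre_in_ball eventually_nhds by blast
  ultimately show ?thesis using that by blast
qed

lemma tendsto_nhds_isCont: "isCont f p \<Longrightarrow> (f \<longlongrightarrow> f p) (nhds p)"
  by (simp add: continuous_within tendsto_at_iff_tendsto_nhds)

lemma eventually_at_of_nhds: "\<forall>\<^sub>F t in nhds p. P t \<Longrightarrow> \<forall>\<^sub>F t in at p. P t"
  by (auto simp: eventually_at_filter elim: eventually_mono)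

lemma tendsto_divide_power:
  fixes f g :: "real \<Rightarrow> real"
  assumes "\<forall>\<^sub>F t in nhds 0. f t = t ^ k * g t" "isCont g 0" "g 0 = c"
  shows "((\<lambda>t. f t / t ^ k) \<longlongrightarrow> c) (at 0)"
proof -
  have "(g \<longlongrightarrow> c) (at 0)"
    using assms(2,3) by (simp add: isCont_def)
  moreover have "\<forall>\<^sub>F t in at 0. g t = f t / t ^ k"
    using assms(1)[THEN eventually_at_of_nhds] eventually_neq_at_within[of "0::real"]
    by eventually_elim simp
  ultimately show ?thesis
    by (rule Lim_transform_eventually)
qed

text \<open>Orders of vanishing are recorded throughout as limits of f t / t^k. Existence of the
  limit forces the value at 0 to vanish at each of the k stages, so Hadamard's quotient can be taken
  k times.\<close>

lemma smooth_factor_power: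
  fixes f :: "real \<Rightarrow> real"
  assumes "smooth_at f 0" "((\<lambda>t. f t / t ^ k) \<longlongrightarrow> c) (at 0)"
  obtains g where "smooth_at g 0" "g 0 = c" "\<forall>\<^sub>F t in nhds 0. f t = t ^ k * g t"
  using assms
proof (induction k arbitrary: f thesis)
  case 0
  have "(f \<longlongrightarrow> f 0) (at 0)"
    using smooth_at_isCont[OF 0(2)] by (simp add: isCont_def)
  then have "f 0 = c"
    using 0(3) LIM_unique[of f _ 0 c] by simp
  then show ?case
    using 0 by simp
next
  case (Suc k)
  have "((\<lambda>t. f t / t ^ Suc k * t ^ Suc k) \<longlongrightarrow> c * 0 ^ Suc k) (at 0)"
    by (intro tendsto_intros Suc.prems)
  moreover have "\<forall>\<^sub>F t in at 0. f t / t ^ Suc k * t ^ Suc k = f t"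
    using eventually_neq_at_within[of "0::real"] by eventually_elim simp
  ultimately have "(f \<longlongrightarrow> 0) (at 0)"
    using Lim_transform_eventually by force
  moreover have "(f \<longlongrightarrow> f 0) (at 0)"
    using smooth_at_isCont[OF Suc.prems(2)] by (simp add: isCont_def)
  ultimately have f0: "f 0 = 0"
    using LIM_unique by blast
  obtain g where g: "smooth_at g 0" "\<forall>\<^sub>F t in nhds 0. f t = f 0 + t * g t"
    using hadamard[OF Suc.prems(2)] by blast
  have "\<forall>\<^sub>F t in at 0. f t / t ^ Suc k = g t / t ^ k"
    using g(2)[THEN eventually_at_of_nhds] eventually_neq_at_within[of "0::real"]
    by eventually_elim (simp add: f0)
  then have "((\<lambda>t. g t / t ^ k) \<longlongrightarrow> c) (at 0)"
    by (rule Lim_transform_eventually[OF Suc.prems(3)])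
  then obtain h where h: "smooth_at h 0" "h 0 = c" "\<forall>\<^sub>F t in nhds 0. g t = t ^ k * h t"
    using Suc.IH[OF _ g(1)] by blast
  have "\<forall>\<^sub>F t in nhds 0. f t = t ^ Suc k * h t"
    using g(2) h(3) by eventually_elim (simp add: f0)
  then show ?case
    using Suc.prems(1) h by blast
qed

text \<open>L'Hospital's rule plays the part of integration: a leading term of the derivative
  determines that of the primitive vanishing at 0.\<close>

lemma tendsto_divide_power_antideriv:
  fixes f f' :: "real \<Rightarrow> real"
  assumes "\<forall>\<^sub>F t in nhds 0. (f has_real_derivative f' t) (at t)" "f 0 = 0"
    and "((\<lambda>t. f' t / t ^ k) \<longlongrightarrow> c) (at 0)"
  shows "((\<lambda>t. f t / t ^ Suc k) \<longlongrightarrow> c / real (Suc k)) (at 0)"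
proof (rule lhopital)
  show "(f \<longlongrightarrow> 0) (at 0)"
    using DERIV_isCont[OF eventually_nhds_x_imp_x[OF assms(1)]] assms(2) by (simp add: isCont_def)
  show "((\<lambda>t. t ^ Suc k) \<longlongrightarrow> 0) (at (0::real))"
    by (auto intro!: tendsto_eq_intros)
  show "\<forall>\<^sub>F t in at (0::real). t ^ Suc k \<noteq> 0" "\<forall>\<^sub>F t in at (0::real). real (Suc k) * t ^ k \<noteq> 0"
    by (rule eventually_mono[OF eventually_neq_at_within[of 0]], simp)+
  show "\<forall>\<^sub>F t in at 0. (f has_real_derivative f' t) (at t)"
    using assms(1) by (rule eventually_at_of_nhds)
  show "\<forall>\<^sub>F t in at (0::real). ((\<lambda>t. t ^ Suc k) has_real_derivative real (Suc k) * t ^ k) (at t)"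
    by (rule always_eventually) (use DERIV_pow[of "Suc k"] in simp)
  have "((\<lambda>t. f' t / t ^ k / real (Suc k)) \<longlongrightarrow> c / real (Suc k)) (at 0)"
    by (intro tendsto_intros assms(3)) auto
  then show "((\<lambda>t. f' t / (real (Suc k) * t ^ k)) \<longlongrightarrow> c / real (Suc k)) (at 0)"
    by (simp add: field_simps)
qed

text \<open>Asymptotics cannot be differentiated in general. Smoothness allows f to be factored as
  t^(k+1) g first, and the product rule does the rest.\<close>

lemma tendsto_divide_power_deriv:
  fixes f :: "real \<Rightarrow> real"
  assumes "smooth_at f 0" "((\<lambda>t. f t / t ^ Suc k) \<longlongrightarrow> c) (at 0)"
  shows "((\<lambda>t. deriv f t / t ^ k) \<longlongrightarrow> real (Suc k) * c) (at 0)"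
proof -
  obtain g where g: "smooth_at g 0" "g 0 = c" "\<forall>\<^sub>F t in nhds 0. f t = t ^ Suc k * g t"
    using smooth_factor_power[OF assms] by blast
  show ?thesis
  proof (rule tendsto_divide_power)
    have "\<forall>\<^sub>F t in nhds 0. \<forall>\<^sub>F x in nhds t. f x = x ^ Suc k * g x"
      using g(3) by (simp add: eventually_eventually)
    with eventually_has_real_derivative[OF g(1)]
    show "\<forall>\<^sub>F t in nhds 0. deriv f t = t ^ k * (real (Suc k) * g t + t * deriv g t)"
    proof eventually_elim
      case (elim t)
      have "((\<lambda>x. x ^ Suc k) has_real_derivative real (Suc k) * t ^ k) (at t)"
        using DERIV_pow[of "Suc k" t UNIV] by simp
      from DERIV_mult[OF this elim(1)]
      have "((\<lambda>x. x ^ Suc k * g x) has_real_derivative t ^ k * (real (Suc k) * g t + t * deriv g t)) (at t)"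
        by (simp add: algebra_simps)
      then have "(f has_real_derivative t ^ k * (real (Suc k) * g t + t * deriv g t)) (at t)"
        using DERIV_cong_ev[OF refl elim(2) refl] by blast
      then show ?case by (rule DERIV_imp_deriv)
    qed
    show "isCont (\<lambda>t. real (Suc k) * g t + t * deriv g t) 0"
      by (intro smooth_at_isCont smooth_intros g)
  qed (simp add: g)
qed

section \<open>Borel's lemma and functions of a power\<close>

text \<open>Non-vanishing of all derivatives of order \<open>\<ge> n\<close> at 0 is what survives the step
  \<open>H \<mapsto> (x \<mapsto> H (2 x) - 2 ^ n H x)\<close>, which kills exactly the derivative of order \<open>n\<close>.\<close>

lemma bounded_tower:
  "\<exists>H :: nat \<Rightarrow> real \<Rightarrow> real. (\<forall>k x. (H k has_real_derivative H (Suc k) x) (at x)) \<and>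
     (\<forall>k. \<exists>C. \<forall>x. \<bar>H k x\<bar> \<le> C) \<and> (\<forall>k<n. H k 0 = 0) \<and> (\<forall>k\<ge>n. H k 0 \<noteq> 0)"
proof (induction n)
  case 0
  \<comment> \<open>Sine and cosine alone have vanishing derivatives at 0; for their sum every
    derivative at 0 is 1 or -1.\<close>
  define H :: "nat \<Rightarrow> real \<Rightarrow> real" where
    "H k x = (-1) ^ (k div 2) * (if even k then sin x + cos x else cos x - sin x)" for k x
  have "(H k has_real_derivative H (Suc k) x) (at x)" for k x
    unfolding H_def by (cases "even k") (auto intro!: derivative_eq_intros simp: algebra_simps)
  moreover have "\<bar>H k x\<bar> \<le> 2" for k x
  proof -
    have "\<bar>sin x + cos x\<bar> \<le> 2" "\<bar>cos x - sin x\<bar> \<le> 2"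
      using abs_sin_le_one[of x] abs_cos_le_one[of x] by linarith+
    then show ?thesis by (simp add: H_def abs_mult)
  qed
  then have "\<exists>C. \<forall>x. \<bar>H k x\<bar> \<le> C" for k by blast
  moreover have "H k 0 \<noteq> 0" for k by (simp add: H_def)
  ultimately show ?case by blast
next
  case (Suc n)
  then obtain H :: "nat \<Rightarrow> real \<Rightarrow> real" where H:
    "\<And>k x. (H k has_real_derivative H (Suc k) x) (at x)"
    "\<And>k. \<exists>C. \<forall>x. \<bar>H k x\<bar> \<le> C" "\<And>k. k < n \<Longrightarrow> H k 0 = 0" "\<And>k. k \<ge> n \<Longrightarrow> H k 0 \<noteq> 0"
    by blast
  define J where "J k x = 2 ^ k * H k (2 * x) - 2 ^ n * H k x" for k x
  have "(J k has_real_derivative J (Suc k) x) (at x)" for k x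
    unfolding J_def by (auto intro!: derivative_eq_intros DERIV_chain2[OF H(1)] H(1))
  moreover have "\<exists>C. \<forall>x. \<bar>J k x\<bar> \<le> C" for k
  proof -
    obtain C where C: "\<And>x. \<bar>H k x\<bar> \<le> C" using H(2) by blast
    have "\<bar>J k x\<bar> \<le> 2 ^ k * C + 2 ^ n * C" for x
    proof -
      have "\<bar>J k x\<bar> \<le> \<bar>2 ^ k * H k (2 * x)\<bar> + \<bar>2 ^ n * H k x\<bar>"
        unfolding J_def by (rule abs_triangle_ineq4)
      also have "\<dots> \<le> 2 ^ k * C + 2 ^ n * C"
        unfolding abs_mult by (intro add_mono mult_mono C) auto
      finally show ?thesis .
    qed
    then show ?thesis by blast
  qed
  moreover have J0: "J k 0 = (2 ^ k - 2 ^ n) * H k 0" for k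
    by (simp add: J_def algebra_simps)
  have "J k 0 = 0" if "k < Suc n" for k
    using H(3)[of k] that by (cases "k = n") (auto simp: J0)
  moreover have "J k 0 \<noteq> 0" if "k \<ge> Suc n" for k
  proof -
    have "(2::real) ^ n < 2 ^ k" using that by (intro power_strict_increasing) auto
    then show ?thesis using J0 H(4)[of k] that by simp
  qed
  ultimately show ?case by blast
qed

text \<open>Passing from H x to \<mu>^(-n) H (\<mu> x) multiplies the k-th derivative by
  \<mu>^(k-n). The n-th derivative at 0 is unaffected, while all lower ones are divided by at least
  \<mu>, which is chosen so large that they fall below 2^(-n).\<close>

lemma small_tower:
  "\<exists>G :: nat \<Rightarrow> real \<Rightarrow> real. (\<forall>k x. (G k has_real_derivative G (Suc k) x) (at x)) \<and>
     (\<forall>k<n. G k 0 = 0) \<and> G n 0 = d \<and> (\<forall>k<n. \<forall>x. \<bar>G k x\<bar> \<le> (1/2) ^ n)"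
proof -
  obtain H :: "nat \<Rightarrow> real \<Rightarrow> real" where H:
    "\<And>k x. (H k has_real_derivative H (Suc k) x) (at x)"
    "\<And>k. \<exists>C. \<forall>x. \<bar>H k x\<bar> \<le> C" "\<And>k. k < n \<Longrightarrow> H k 0 = 0" "H n 0 \<noteq> 0"
    using bounded_tower[of n] by blast
  obtain C where C: "\<And>k x. \<bar>H k x\<bar> \<le> C k" using H(2) by metis
  define B where "B = (\<Sum>k<n. C k)"
  have C0: "0 \<le> C k" for k using C[of k 0] by linarith
  have B: "\<bar>H k x\<bar> \<le> B" if "k < n" for k x
  proof -
    have "C k \<le> B" unfolding B_def by (rule member_le_sum) (use that C0 in auto)
    then show ?thesis using C[of k x] by linarith
  qed
  have B0: "0 \<le> B" unfolding B_def by (intro sum_nonneg C0)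
  define e where "e = d / H n 0"
  define \<mu> where "\<mu> = 1 + 2 ^ n * (\<bar>e\<bar> * B)"
  have \<mu>: "\<mu> \<ge> 1" using B0 by (simp add: \<mu>_def)
  then have \<mu>0: "\<mu> > 0" by linarith
  define G where "G k x = e * \<mu> ^ k / \<mu> ^ n * H k (\<mu> * x)" for k x
  have "(G k has_real_derivative G (Suc k) x) (at x)" for k x
    unfolding G_def using \<mu>0 by (auto intro!: derivative_eq_intros DERIV_chain2[OF H(1)])
  moreover have "G k 0 = 0" if "k < n" for k using H(3)[OF that] by (simp add: G_def)
  moreover have "G n 0 = d" using H(4) \<mu>0 by (simp add: G_def e_def)
  moreover have "\<bar>G k x\<bar> \<le> (1/2) ^ n" if "k < n" for k x
  proof -
    have "\<mu> ^ Suc k \<le> \<mu> ^ n"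
      using that \<mu> by (intro power_increasing) auto
    then have *: "\<mu> ^ k / \<mu> ^ n \<le> 1 / \<mu>"
      using \<mu>0 by (simp add: field_simps)
    have "\<bar>G k x\<bar> = (\<mu> ^ k / \<mu> ^ n) * (\<bar>e\<bar> * \<bar>H k (\<mu> * x)\<bar>)"
      using \<mu>0 by (simp add: G_def abs_mult)
    also have "\<dots> \<le> (1 / \<mu>) * (\<bar>e\<bar> * B)"
      using \<mu>0 * B[OF that] by (intro mult_mono) auto
    also have "\<dots> \<le> (1/2) ^ n"
      using \<mu>0 B0 by (simp add: \<mu>_def field_simps power_one_over add_pos_nonneg)
    finally show ?thesis .
  qed
  ultimately show ?thesis by blast
qed

text \<open>The n-th summand corrects the n-th derivative at 0 without disturbing the lower ones.
  Its derivatives of order k < n are bounded by 2^(-n) on the whole line, so the series of k-th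
  derivatives converges uniformly from the index k + 1 on. These globally bounded summands replace
  the usual bump functions.\<close>

lemma borel_tower:
  "\<exists>F :: nat \<Rightarrow> real \<Rightarrow> real. (\<forall>k x. (F k has_real_derivative F (Suc k) x) (at x)) \<and> (\<forall>k. F k 0 = a k)"
proof -
  obtain P :: "nat \<Rightarrow> real \<Rightarrow> nat \<Rightarrow> real \<Rightarrow> real" where P:
    "\<And>n d k x. (P n d k has_real_derivative P n d (Suc k) x) (at x)"
    "\<And>n d k. k < n \<Longrightarrow> P n d k 0 = 0" "\<And>n d. P n d n 0 = d"
    "\<And>n d k x. k < n \<Longrightarrow> \<bar>P n d k x\<bar> \<le> (1/2) ^ n"
    using small_tower by metis
  \<comment> \<open>A summand has uncontrolled derivatives at 0 above its own index. The next
    correction must therefore be measured against the partial sum already built, which makes the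
    choice recursive.\<close>
  define S where "S = rec_nat (\<lambda>k x. 0) (\<lambda>n s k x. s k x + P n (a n - s n 0) k x)"
  have S0: "S 0 k x = 0" for k x by (simp add: S_def)
  define G where "G n = P n (a n - S n n 0)" for n
  have SS: "S (Suc n) k x = S n k x + G n k x" for n k x by (simp add: S_def G_def)
  have S: "S n k x = (\<Sum>i<n. G i k x)" for n k x
    by (induction n) (simp_all add: S0 SS)
  define F where "F k x = (\<Sum>n. G n k x)" for k x
  have lim: "uniform_limit UNIV (\<lambda>n x. \<Sum>i<n. G i k x) (F k) sequentially" for k
    unfolding F_def
  proof (rule Weierstrass_m_test_ev[where M = "\<lambda>n. (1/2) ^ n"])
    show "\<forall>\<^sub>F n in sequentially. \<forall>x\<in>UNIV. norm (G n k x) \<le> (1/2) ^ n"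
      using eventually_gt_at_top[of k] by eventually_elim (simp add: G_def P(4))
  qed (simp add: summable_geometric)
  have G0: "G n k 0 = 0" if "n \<notin> {..k}" for n k
    using that by (simp add: G_def P(2))
  have "(F k has_real_derivative F (Suc k) x) (at x)" for k x
  proof -
    have "summable (\<lambda>n. G n k 0)"
      by (rule summable_finite[of "{..k}"]) (use G0 in auto)
    then have "\<exists>g. \<forall>x\<in>UNIV. (\<lambda>n. G n k x) sums g x \<and> (g has_real_derivative F (Suc k) x) (at x)"
      by (intro has_field_derivative_series[OF convex_UNIV _ lim]) (auto simp: G_def P(1))
    then obtain g where g: "\<And>x. (\<lambda>n. G n k x) sums g x" "\<And>x. (g has_real_derivative F (Suc k) x) (at x)"
      by blast
    have "g = F k" using sums_unique[OF g(1)] by (auto simp: F_def)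
    then show ?thesis using g(2) by simp
  qed
  moreover have "F k 0 = a k" for k
  proof -
    have "F k 0 = (\<Sum>n\<in>{..k}. G n k 0)"
      unfolding F_def by (rule suminf_finite) (use G0 in auto)
    also have "\<dots> = S (Suc k) k 0" by (simp add: S lessThan_Suc_atMost)
    also have "\<dots> = a k" unfolding SS by (simp add: G_def P(3))
    finally show ?thesis .
  qed
  ultimately show ?thesis by blast
qed

text \<open>The Taylor series in the form of estimates. Unlike derivatives at 0, these survive the
  substitution of s^p and a regrouping of the terms without any higher chain rule.\<close>

definition has_expansion :: "(real \<Rightarrow> real) \<Rightarrow> (nat \<Rightarrow> real) \<Rightarrow> bool" where
  "has_expansion f a \<longleftrightarrow> (\<forall>n. \<exists>C. \<forall>\<^sub>F t in nhds 0. \<bar>f t - (\<Sum>k<n. a k * t ^ k)\<bar> \<le> C * \<bar>t\<bar> ^ n)"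

lemma has_expansion_tower:
  fixes G :: "nat \<Rightarrow> real \<Rightarrow> real"
  assumes "\<epsilon> > 0" "\<And>k x. x \<in> ball 0 \<epsilon> \<Longrightarrow> (G k has_real_derivative G (Suc k) x) (at x)"
  shows "has_expansion (G 0) (\<lambda>k. G k 0 / fact k)"
  unfolding has_expansion_def
proof
  fix n
  define C where "C = \<bar>G n 0\<bar> + 1"
  have "((\<lambda>x. \<bar>G n x\<bar>) \<longlongrightarrow> \<bar>G n 0\<bar>) (nhds 0)"
    using tendsto_nhds_isCont[OF DERIV_isCont[OF assms(2)[of 0 n]]] assms(1)
    by (intro tendsto_intros) auto
  then have "\<forall>\<^sub>F x in nhds 0. \<bar>G n x\<bar> < C"
    by (rule order_tendstoD) (simp add: C_def)
  then obtain \<delta> where \<delta>: "\<delta> > 0" "\<And>x. \<bar>x\<bar> < \<delta> \<Longrightarrow> \<bar>G n x\<bar> < C"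
    by (auto simp: eventually_nhds_metric)
  have "\<bar>G 0 x - (\<Sum>k<n. G k 0 / fact k * x ^ k)\<bar> \<le> C * \<bar>x\<bar> ^ n" if x: "\<bar>x\<bar> < min \<epsilon> \<delta>" for x
  proof -
    have "\<forall>m t. m < n \<and> \<bar>t\<bar> \<le> \<bar>x\<bar> \<longrightarrow> (G m has_real_derivative G (Suc m) t) (at t)"
      using assms(2) x by auto
    from Maclaurin_bi_le[OF refl this] obtain t where t: "\<bar>t\<bar> \<le> \<bar>x\<bar>"
      "G 0 x = (\<Sum>m<n. G m 0 / fact m * x ^ m) + G n t / fact n * x ^ n" by blast
    have "\<bar>G n t / fact n\<bar> \<le> \<bar>G n t\<bar> / 1"
      unfolding abs_divide by (intro divide_left_mono) (auto simp: fact_ge_1)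
    also have "\<dots> \<le> C" using \<delta>(2)[of t] t(1) x by simp
    finally have "\<bar>G n t / fact n * x ^ n\<bar> \<le> C * \<bar>x\<bar> ^ n"
      unfolding abs_mult power_abs by (rule mult_right_mono) simp
    then show ?thesis using t(2) by simp
  qed
  moreover have "\<forall>\<^sub>F x in nhds 0. \<bar>x\<bar> < min \<epsilon> \<delta>"
    unfolding eventually_nhds_metric using assms(1) \<delta>(1)
    by (intro exI[of _ "min \<epsilon> \<delta>"]) auto
  ultimately show "\<exists>C. \<forall>\<^sub>F x in nhds 0. \<bar>G 0 x - (\<Sum>k<n. G k 0 / fact k * x ^ k)\<bar> \<le> C * \<bar>x\<bar> ^ n"
    by (intro exI[of _ C]) (auto elim: eventually_mono)
qed

lemma smooth_at_ball:
  fixes f :: "real \<Rightarrow> real"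
  assumes "smooth_at f 0"
  obtains \<epsilon> where "\<epsilon> > 0" "\<And>x. x \<in> ball 0 \<epsilon> \<Longrightarrow> smooth_at f x"
proof -
  obtain \<epsilon> where "\<epsilon> > 0" "\<And>x. dist x 0 < \<epsilon> \<Longrightarrow> smooth_at f x"
    using eventually_smooth_at[OF assms] unfolding eventually_nhds_metric by blast
  then show ?thesis using that[of \<epsilon>] by simp
qed

lemma smooth_has_expansion:
  assumes "smooth_at f 0"
  obtains a where "has_expansion f a"
proof -
  obtain \<epsilon> where \<epsilon>: "\<epsilon> > 0" "\<And>x. x \<in> ball 0 \<epsilon> \<Longrightarrow> smooth_at f x"
    using smooth_at_ball[OF assms] by metis
  have "((deriv ^^ k) f has_real_derivative (deriv ^^ Suc k) f x) (at x)" if "x \<in> ball 0 \<epsilon>" for k x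
    using smooth_at_has_real_derivative[OF smooth_at_deriv_funpow[OF \<epsilon>(2)[OF that]], of k] by simp
  from has_expansion_tower[where G="\<lambda>k. (deriv ^^ k) f", OF \<epsilon>(1) this] show ?thesis
    using that by simp
qed

lemma borel_lemma:
  obtains f where "smooth_at f 0" "has_expansion f a"
proof -
  obtain F :: "nat \<Rightarrow> real \<Rightarrow> real" where F:
    "\<And>k x. (F k has_real_derivative F (Suc k) x) (at x)" "\<And>k. F k 0 = fact k * a k"
    using borel_tower[of "\<lambda>k. fact k * a k"] by blast
  have "has_expansion (F 0) (\<lambda>k. F k 0 / fact k)"
    using has_expansion_tower[of 1 F] F(1) by simp
  moreover have "(\<lambda>k. F k 0 / fact k) = a"
    using F(2) by auto
  moreover have "smooth_at (F 0) 0"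
    by (rule smooth_at_of_tower[of UNIV]) (use F(1) in auto)
  ultimately show ?thesis using that by simp
qed

section \<open>Flat functions and the substitution of roots\<close>

definition flat :: "(real \<Rightarrow> real) \<Rightarrow> bool" where
  "flat h \<longleftrightarrow> smooth_at h 0 \<and> (\<forall>n. ((\<lambda>t. h t / t ^ n) \<longlongrightarrow> 0) (at 0))"

lemma flat_0: "flat h \<Longrightarrow> h 0 = 0"
proof -
  assume "flat h"
  then have "isCont h 0" "((\<lambda>t. h t / t ^ 0) \<longlongrightarrow> 0) (at 0)"
    unfolding flat_def using smooth_at_isCont by blast+
  then show "h 0 = 0"
    using LIM_unique[of h "h 0" 0 0] by (simp add: isCont_def)
qed

lemma flat_divide_power:
  assumes "flat h"
  shows "flat (\<lambda>t. h t / t ^ m)"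
proof -
  obtain g where g: "smooth_at g 0" "g 0 = 0" "\<forall>\<^sub>F t in nhds 0. h t = t ^ m * g t"
    using smooth_factor_power assms unfolding flat_def by blast
  have "smooth_at (\<lambda>t. h t / t ^ m) 0"
  proof (rule smooth_at_cong[OF g(1)])
    \<comment> \<open>At t = 0 the quotient is 0, by division by zero or because \<open>h\<close>
      vanishes there, and this agrees with g 0.\<close>
    show "\<forall>\<^sub>F t in nhds 0. g t = h t / t ^ m"
      using g(3) by eventually_elim (use g(2) flat_0[OF assms] in auto)
  qed
  moreover have "((\<lambda>t. h t / t ^ m / t ^ n) \<longlongrightarrow> 0) (at 0)" for n
    using assms by (simp add: flat_def power_add[symmetric])
  ultimately show ?thesis by (simp add: flat_def)
qed

lemma flat_deriv: "flat h \<Longrightarrow> flat (deriv h)"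
  unfolding flat_def using smooth_at_deriv tendsto_divide_power_deriv by fastforce

lemma flat_cmult: "flat h \<Longrightarrow> flat (\<lambda>t. c * h t)"
  unfolding flat_def using tendsto_mult_left[of "\<lambda>t. h t / t ^ _" 0 "at 0" c]
  by (auto intro!: smooth_intros)

lemma flat_add: "flat g \<Longrightarrow> flat h \<Longrightarrow> flat (\<lambda>t. g t + h t)"
  unfolding flat_def using tendsto_add[of _ 0 "at 0" _ 0]
  by (auto intro!: smooth_intros simp: add_divide_distrib)

lemma flat_reflect:
  assumes "flat h"
  shows "flat (\<lambda>t. h (- t))"
proof -
  have "smooth_at (\<lambda>t. h (- t)) 0"
    by (rule smooth_at_compose) (use assms in \<open>auto simp: flat_def intro!: smooth_intros\<close>)
  moreover have "((\<lambda>t. h (- t) / t ^ n) \<longlongrightarrow> 0) (at 0)" for n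
  proof -
    have "filterlim (\<lambda>t::real. - t) (at 0) (at 0)"
      unfolding filterlim_at using eventually_neq_at_within[of "0::real"]
      by (auto intro!: tendsto_eq_intros)
    moreover have "((\<lambda>t. h t / t ^ n) \<longlongrightarrow> 0) (at 0)" using assms by (simp add: flat_def)
    ultimately have "((\<lambda>t. h (- t) / (- t) ^ n) \<longlongrightarrow> 0) (at 0)"
      by (rule filterlim_compose[rotated])
    from tendsto_mult_right[OF this, of "(-1) ^ n"] show ?thesis
      by (cases "even n") simp_all
  qed
  ultimately show ?thesis by (simp add: flat_def)
qed

text \<open>With \<open>x = s ^ p\<close>, the derivative with respect to \<open>x\<close> is \<open>h \<mapsto> h' / (p s ^ (p - 1))\<close>, which
  keeps a function flat.\<close>

lemma smooth_at_flat_compose_root: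
  fixes \<sigma> :: "real \<Rightarrow> real"
  assumes "flat h" "p \<ge> 2" "\<sigma> 0 = 0" "\<And>x. \<bar>\<sigma> x\<bar> ^ p \<le> \<bar>x\<bar>"
    and \<sigma>: "\<And>x. x \<noteq> 0 \<Longrightarrow> \<sigma> x \<noteq> 0 \<and> (\<sigma> has_real_derivative 1 / (real p * \<sigma> x ^ (p - 1))) (at x)
              \<or> (\<forall>\<^sub>F y in nhds x. \<sigma> y = 0)"
  shows "smooth_at (\<lambda>x. h (\<sigma> x)) 0"
proof -
  obtain \<epsilon> where \<epsilon>: "\<epsilon> > 0" "\<And>x. x \<in> ball 0 \<epsilon> \<Longrightarrow> smooth_at h x"
    using smooth_at_ball assms(1) unfolding flat_def by blast
  \<comment> \<open>At s = 0 division by zero yields 0. This is the right value because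
    \<open>T\<close> preserves flatness, so the iterates composed with \<sigma> form a tower across
    0.\<close>
  define T where "T h s = deriv h s / (real p * s ^ (p - 1))" for h and s :: real
  define H where "H k = (T ^^ k) h" for k
  have H0: "H 0 = h" and HSuc: "H (Suc k) = T (H k)" for k by (simp_all add: H_def)
  have flat_T: "flat (T g)" if "flat g" for g
    using flat_divide_power[OF flat_cmult[OF flat_deriv[OF that]], of "1 / real p" "p - 1"]
    by (simp add: T_def[abs_def])
  have flat_H: "flat (H k)" for k
    by (induction k) (auto simp: H0 HSuc assms(1) flat_T)
  have smooth_H: "smooth_at (H k) x" if "x \<in> ball 0 \<epsilon>" for k x
    using that
  proof (induction k arbitrary: x)
    case 0
    then show ?case using \<epsilon> by (simp add: H0)
  next
    case (Suc k)
    show ?case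
    proof (cases "x = 0")
      case True
      then show ?thesis using flat_H by (simp add: flat_def)
    next
      case False
      show ?thesis
        unfolding HSuc T_def[abs_def]
        by (intro smooth_intros Suc.IH Suc.prems) (use False assms(2) in auto)
    qed
  qed
  have \<sigma>0: "isCont \<sigma> 0"
  proof -
    have "((\<lambda>x. \<sigma> x ^ p) \<longlongrightarrow> 0) (at 0)"
    proof (rule Lim_null_comparison)
      show "\<forall>\<^sub>F x in at 0. norm (\<sigma> x ^ p) \<le> \<bar>x\<bar>"
        using assms(4) by (simp add: power_abs)
      show "((\<lambda>x. \<bar>x\<bar>) \<longlongrightarrow> 0) (at (0::real))"
        by (auto intro!: tendsto_eq_intros)
    qed
    then show ?thesis
      using assms(2,3) by (simp add: isCont_def power_tendsto_0_iff)
  qed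
  have in_ball: "\<sigma> x \<in> ball 0 \<epsilon>" if "x \<in> ball 0 (\<epsilon> ^ p)" for x
  proof -
    have "\<bar>\<sigma> x\<bar> ^ p < \<epsilon> ^ p" using assms(4)[of x] that by simp
    then show ?thesis
      using power_less_imp_less_base[of "\<bar>\<sigma> x\<bar>" p \<epsilon>] \<epsilon>(1) by simp
  qed
  have "((\<lambda>y. H k (\<sigma> y)) has_real_derivative H (Suc k) (\<sigma> x)) (at x)"
    if x: "x \<in> ball 0 (\<epsilon> ^ p)" for k x
  proof -
    have T0: "H (Suc k) 0 = 0" using flat_0[OF flat_H] .
    consider "x = 0" | "\<sigma> x \<noteq> 0" "(\<sigma> has_real_derivative 1 / (real p * \<sigma> x ^ (p - 1))) (at x)"
      | "\<forall>\<^sub>F y in nhds x. \<sigma> y = 0"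
      using \<sigma> by blast
    then show ?thesis
    proof cases
      \<comment> \<open>Since |\<sigma> y|^p is at most |y|, the difference quotient at 0 is
        dominated by \<open>H k (\<sigma> y) / \<sigma> y ^ p\<close>, which tends to 0 by
        flatness.\<close>
      case 1
      have cont: "isCont (\<lambda>s. H k s / s ^ p) 0"
        using flat_divide_power[OF flat_H] smooth_at_isCont unfolding flat_def by blast
      have "((\<lambda>y. H k (\<sigma> y) / \<sigma> y ^ p) \<longlongrightarrow> 0) (at 0)"
        using isCont_o2[OF \<sigma>0, of "\<lambda>s. H k s / s ^ p"] cont assms(3) flat_0[OF flat_H, of k]
        by (simp add: isCont_def)
      then have "((\<lambda>y. \<bar>H k (\<sigma> y) / \<sigma> y ^ p\<bar>) \<longlongrightarrow> 0) (at 0)"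
        by (rule tendsto_rabs_zero)
      moreover have "\<forall>\<^sub>F y in at 0. norm ((H k (\<sigma> y) - H k (\<sigma> 0)) / (y - 0)) \<le> \<bar>H k (\<sigma> y) / \<sigma> y ^ p\<bar>"
      proof (rule eventually_mono[OF eventually_neq_at_within[of 0]])
        fix y :: real assume y: "y \<noteq> 0"
        show "norm ((H k (\<sigma> y) - H k (\<sigma> 0)) / (y - 0)) \<le> \<bar>H k (\<sigma> y) / \<sigma> y ^ p\<bar>"
        proof (cases "\<sigma> y = 0")
          case True
          then show ?thesis by (simp add: assms(3))
        next
          case False
          then show ?thesis
            using assms(4)[of y] y flat_0[OF flat_H, of k]
            by (simp add: assms(3) abs_divide power_abs frac_le)
        qed
      qed
      ultimately have "((\<lambda>y. (H k (\<sigma> y) - H k (\<sigma> 0)) / (y - 0)) \<longlongrightarrow> 0) (at 0)"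
        by (rule Lim_null_comparison[rotated])
      then show ?thesis
        by (simp add: 1 T0 assms(3) has_field_derivative_iff)
    next
      case 2
      from DERIV_chain2[where g=\<sigma>, OF smooth_at_has_real_derivative[OF smooth_H[OF in_ball[OF x], of k]] 2(2)]
      show ?thesis by (simp add: HSuc T_def)
    next
      \<comment> \<open>This covers a truncated root such as \<open>sqrt (max x 0)\<close> on the
        negative axis, where the composition is locally 0.\<close>
      case 3
      have *: "\<forall>\<^sub>F y in nhds x. H k (\<sigma> y) = 0"
        using 3 by eventually_elim (simp add: flat_0[OF flat_H])
      have "\<sigma> x = 0" using eventually_nhds_x_imp_x[OF 3] .
      then show ?thesis
        using DERIV_cong_ev[OF refl * refl, THEN iffD2, of 0] T0 by simp
    qed
  qed
  then have "smooth_at ((\<lambda>k y. H k (\<sigma> y)) 0) 0"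
    by (intro smooth_at_of_tower[of "ball 0 (\<epsilon> ^ p)"]) (use \<epsilon>(1) in auto)
  then show ?thesis by (simp add: H0)
qed

text \<open>Borel's lemma hands the Taylor coefficients with index congruent to i modulo p to
  \<open>F i\<close>. The sum then has the same expansion as f, and what remains is flat because a
  smooth function is determined by its expansion only up to a flat one.\<close>

lemma expansion_modulo_power:
  fixes f :: "real \<Rightarrow> real"
  assumes "smooth_at f 0" "p > 0"
  obtains F r where "\<And>i. smooth_at (F i) 0" "flat r"
    "\<And>s. f s = (\<Sum>i<p. s ^ i * F i (s ^ p)) + r s"
proof -
  obtain a where a: "has_expansion f a"
    using smooth_has_expansion[OF assms(1)] .
  have "\<exists>g. smooth_at g 0 \<and> has_expansion g (\<lambda>j. a (j * p + i))" for i :: nat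
    by (rule borel_lemma) blast
  then have "\<exists>F. \<forall>i. smooth_at (F i) 0 \<and> has_expansion (F i) (\<lambda>j. a (j * p + i))"
    by (intro choice) blast
  then obtain F where F: "\<And>i::nat. smooth_at (F i) 0" "\<And>i. has_expansion (F i) (\<lambda>j. a (j * p + i))"
    by blast
  define r where "r s = f s - (\<Sum>i<p. s ^ i * F i (s ^ p))" for s
  have "smooth_at (\<lambda>s. F i (s ^ p)) 0" for i
  proof (rule smooth_at_compose[where g = "F i"])
    show "smooth_at (F i) (0 ^ p)" using F(1)[of i] assms(2) by (simp add: zero_power)
    show "smooth_at (\<lambda>s::real. s ^ p) 0" by (intro smooth_intros)
  qed
  then have smooth_r: "smooth_at r 0"
    unfolding r_def[abs_def] by (intro smooth_intros assms(1))
  have "((\<lambda>s. r s / s ^ n) \<longlongrightarrow> 0) (at 0)" for n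
  proof -
    \<comment> \<open>With N = n + 1 the truncation error, of order N p, is at least one order
      beyond s^n.\<close>
    define N where "N = Suc n"
    obtain C where C: "\<forall>\<^sub>F s in nhds 0. \<bar>f s - (\<Sum>k<N * p. a k * s ^ k)\<bar> \<le> C * \<bar>s\<bar> ^ (N * p)"
      using a unfolding has_expansion_def by blast
    have "\<exists>D. \<forall>\<^sub>F x in nhds 0. \<bar>F i x - (\<Sum>j<N. a (j * p + i) * x ^ j)\<bar> \<le> D * \<bar>x\<bar> ^ N" for i
      using F(2) unfolding has_expansion_def by blast
    then have "\<exists>D. \<forall>i. \<forall>\<^sub>F x in nhds 0. \<bar>F i x - (\<Sum>j<N. a (j * p + i) * x ^ j)\<bar> \<le> D i * \<bar>x\<bar> ^ N"
      by (intro choice) blast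
    then obtain D where D:
      "\<And>i. \<forall>\<^sub>F x in nhds 0. \<bar>F i x - (\<Sum>j<N. a (j * p + i) * x ^ j)\<bar> \<le> D i * \<bar>x\<bar> ^ N"
      by blast
    have pow: "filterlim (\<lambda>s::real. s ^ p) (nhds 0) (nhds 0)"
      using tendsto_nhds_isCont[where f = "\<lambda>s::real. s ^ p" and p = 0] assms(2) by (simp add: zero_power)
    have D': "\<forall>\<^sub>F s in nhds 0. \<bar>F i (s ^ p) - (\<Sum>j<N. a (j * p + i) * (s ^ p) ^ j)\<bar> \<le> D i * \<bar>s ^ p\<bar> ^ N" for i
      using eventually_compose_filterlim[OF D pow] .
    have D'': "\<forall>\<^sub>F s in nhds 0. \<forall>i\<in>{..<p}. \<bar>F i (s ^ p) - (\<Sum>j<N. a (j * p + i) * (s ^ p) ^ j)\<bar> \<le> D i * \<bar>s ^ p\<bar> ^ N"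
      by (rule eventually_ball_finite) (use D' in auto)
    have small: "\<forall>\<^sub>F s in nhds (0::real). \<bar>s\<bar> < 1"
      unfolding eventually_nhds_metric by (intro exI[of _ 1]) auto
    define B where "B = C + (\<Sum>i<p. D i)"
    have "\<forall>\<^sub>F s in nhds 0. \<bar>r s\<bar> \<le> B * \<bar>s\<bar> ^ (N * p)"
      using C D'' small
    proof eventually_elim
      case (elim s)
      have "(\<Sum>k<N * p. a k * s ^ k) = (\<Sum>j<N. \<Sum>i<p. a (j * p + i) * s ^ (j * p + i))"
        unfolding sum.nat_group[symmetric]
        by (rule sum.cong[OF refl]) (simp add: sum.atLeastLessThan_shift_0[of _ "_ * p"] lessThan_atLeast0)
      also have "\<dots> = (\<Sum>i<p. \<Sum>j<N. a (j * p + i) * s ^ (j * p + i))"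
        by (rule sum.swap)
      also have "\<dots> = (\<Sum>i<p. s ^ i * (\<Sum>j<N. a (j * p + i) * (s ^ p) ^ j))"
        unfolding sum_distrib_left
        by (intro sum.cong refl) (simp add: power_add power_mult[symmetric] mult_ac)
      finally have "r s = (f s - (\<Sum>k<N * p. a k * s ^ k)) -
          (\<Sum>i<p. s ^ i * (F i (s ^ p) - (\<Sum>j<N. a (j * p + i) * (s ^ p) ^ j)))"
        by (simp add: r_def sum_subtractf algebra_simps)
      also have "\<bar>\<dots>\<bar> \<le> C * \<bar>s\<bar> ^ (N * p) + (\<Sum>i<p. D i * \<bar>s\<bar> ^ (N * p))"
      proof (rule order_trans[OF abs_triangle_ineq4 add_mono[OF elim(1) order_trans[OF sum_abs sum_mono]]])
        fix i assume "i \<in> {..<p}"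
        have "\<bar>s\<bar> ^ i * \<bar>F i (s ^ p) - (\<Sum>j<N. a (j * p + i) * (s ^ p) ^ j)\<bar>
            \<le> 1 * (D i * \<bar>s ^ p\<bar> ^ N)"
          using elim \<open>i \<in> _\<close> by (intro mult_mono power_le_one) auto
        then show "\<bar>s ^ i * (F i (s ^ p) - (\<Sum>j<N. a (j * p + i) * (s ^ p) ^ j))\<bar> \<le> D i * \<bar>s\<bar> ^ (N * p)"
          by (simp add: abs_mult power_abs power_mult[symmetric] mult.commute)
      qed
      also have "\<dots> = B * \<bar>s\<bar> ^ (N * p)"
        by (simp add: B_def sum_distrib_right distrib_right)
      finally show ?case .
    qed
    note bound = this[THEN eventually_at_of_nhds]
    show ?thesis
    proof (rule Lim_null_comparison)
      show "\<forall>\<^sub>F s in at 0. norm (r s / s ^ n) \<le> \<bar>B\<bar> * \<bar>s\<bar>"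
        using bound eventually_neq_at_within[of "0::real"] small[THEN eventually_at_of_nhds]
      proof eventually_elim
        case (elim s)
        have "Suc n * 1 \<le> N * p"
          unfolding N_def using assms(2) by (intro mult_le_mono) auto
        then have "\<bar>s\<bar> ^ (N * p) \<le> \<bar>s\<bar> ^ Suc n"
          using elim by (intro power_decreasing) auto
        then have "\<bar>B\<bar> * \<bar>s\<bar> ^ (N * p) \<le> \<bar>B\<bar> * \<bar>s\<bar> ^ Suc n"
          by (rule mult_left_mono) simp
        moreover have "B * \<bar>s\<bar> ^ (N * p) \<le> \<bar>B\<bar> * \<bar>s\<bar> ^ (N * p)"
          by (rule mult_right_mono) auto
        ultimately have "\<bar>r s\<bar> \<le> \<bar>B\<bar> * \<bar>s\<bar> * \<bar>s\<bar> ^ n"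
          using elim(1) by (simp add: mult_ac)
        then show ?case
          using elim(2) by (simp add: power_abs pos_divide_le_eq)
      qed
      show "((\<lambda>s. \<bar>B\<bar> * \<bar>s\<bar>) \<longlongrightarrow> 0) (at 0)"
        by (auto intro!: tendsto_eq_intros)
    qed
  qed
  then have "flat r" using smooth_r by (simp add: flat_def)
  then show ?thesis
    using that[of F r] F(1) by (simp add: r_def)
qed

text \<open>The real cube root exists on the whole line, so the flat remainder is itself a smooth
  function of s^3 and joins the term without a factor s.\<close>

lemma smooth_decompose_3:
  fixes f :: "real \<Rightarrow> real"
  assumes "smooth_at f 0"
  obtains f0 f1 f2 where "smooth_at f0 0" "smooth_at f1 0" "smooth_at f2 0"
    "\<And>s. f s = f0 (s ^ 3) + s * f1 (s ^ 3) + s\<^sup>2 * f2 (s ^ 3)"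
proof -
  obtain F r where F: "\<And>i::nat. smooth_at (F i) 0" "flat r"
    "\<And>s. f s = (\<Sum>i<3. s ^ i * F i (s ^ 3)) + r s"
    by (rule expansion_modulo_power[OF assms, of 3]) (simp, blast)
  have "smooth_at (\<lambda>x. r (root 3 x)) 0"
  proof (rule smooth_at_flat_compose_root[OF F(2), of 3])
    fix x :: real
    show "\<bar>root 3 x\<bar> ^ 3 \<le> \<bar>x\<bar>"
      by (simp add: power_abs[symmetric] odd_real_root_pow)
    assume "x \<noteq> 0"
    then show "root 3 x \<noteq> 0 \<and> (root 3 has_real_derivative 1 / (real 3 * root 3 x ^ (3 - 1))) (at x)
        \<or> (\<forall>\<^sub>F y in nhds x. root 3 y = 0)"
      using DERIV_odd_real_root[of 3 x] by (simp add: inverse_eq_divide)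
  qed auto
  then have "smooth_at (\<lambda>x. F 0 x + r (root 3 x)) 0"
    by (intro smooth_intros F)
  moreover have "f s = (F 0 (s ^ 3) + r (root 3 (s ^ 3))) + s * F 1 (s ^ 3) + s\<^sup>2 * F 2 (s ^ 3)" for s
  proof -
    have "(\<Sum>i<3. g i) = g 0 + g 1 + g 2" for g :: "nat \<Rightarrow> real"
      by (simp add: numeral_3_eq_3 numeral_2_eq_2)
    then show ?thesis by (simp add: F(3) odd_real_root_power_cancel)
  qed
  ultimately show ?thesis
    using that F(1) by blast
qed

text \<open>The function q is r (sqrt x) for x \<ge> 0 and 0 for x < 0; flatness makes the two
  pieces fit smoothly at 0. Evenness of r turns sqrt (s^2) = |s| back into s.\<close>

lemma flat_even_decompose:
  assumes "flat r" "\<And>s. r (- s) = r s"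
  obtains q where "smooth_at q 0" "\<And>s. r s = q (s\<^sup>2)"
proof -
  have "smooth_at (\<lambda>x. r (sqrt (max x 0))) 0"
  proof (rule smooth_at_flat_compose_root[OF assms(1), of 2])
    fix x :: real
    show "\<bar>sqrt (max x 0)\<bar>\<^sup>2 \<le> \<bar>x\<bar>"
      by (simp add: max_def)
    assume "x \<noteq> 0"
    then consider "x > 0" | "x < 0" by linarith
    then show "sqrt (max x 0) \<noteq> 0 \<and> ((\<lambda>x. sqrt (max x 0)) has_real_derivative 1 / (real 2 * sqrt (max x 0) ^ (2 - 1))) (at x)
        \<or> (\<forall>\<^sub>F y in nhds x. sqrt (max y 0) = 0)"
    proof cases
      case 1
      have "\<forall>\<^sub>F y in nhds x. sqrt (max y 0) = sqrt y"
        using eventually_nhds_in_open[of "{0<..}" x] 1 by (auto elim!: eventually_mono simp: max_def)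
      from DERIV_cong_ev[OF refl this refl, THEN iffD2, OF DERIV_real_sqrt[OF 1]] show ?thesis
        using 1 by (simp add: max_def inverse_eq_divide field_simps)
    next
      case 2
      then show ?thesis
        using eventually_nhds_in_open[of "{..<0}" x] by (auto elim!: eventually_mono simp: max_def)
    qed
  qed auto
  moreover have "r s = r (sqrt (max (s\<^sup>2) 0))" for s
    using assms(2)[of s] by (simp add: max_def abs_if)
  ultimately show ?thesis using that by blast
qed

text \<open>A square root sees only |s|, so here the flat remainder has to be split further. Its
  even part, and its odd part divided by s, are both flat and even.\<close>

lemma smooth_decompose_2:
  fixes f :: "real \<Rightarrow> real"
  assumes "smooth_at f 0"
  obtains f0 f1 where "smooth_at f0 0" "smooth_at f1 0" "\<And>s. f s = f0 (s\<^sup>2) + s * f1 (s\<^sup>2)"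
proof -
  obtain F r where F: "\<And>i::nat. smooth_at (F i) 0" "flat r"
    "\<And>s. f s = (\<Sum>i<2. s ^ i * F i (s ^ 2)) + r s"
    by (rule expansion_modulo_power[OF assms, of 2]) (simp, blast)
  note flat_rules = flat_cmult flat_add F(2) flat_reflect
  have "flat (\<lambda>s. 1/2 * (r s + r (- s)))"
    by (intro flat_rules)
  then obtain q0 where q0: "smooth_at q0 0" "\<And>s. 1/2 * (r s + r (- s)) = q0 (s\<^sup>2)"
    by (rule flat_even_decompose) auto
  have "flat (\<lambda>s. (1/2 * (r s + (-1) * r (- s))) / s ^ 1)"
    by (intro flat_divide_power flat_rules)
  then obtain q1 where q1: "smooth_at q1 0" "\<And>s. (1/2 * (r s + (-1) * r (- s))) / s ^ 1 = q1 (s\<^sup>2)"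
    by (rule flat_even_decompose) (simp add: minus_divide_left, blast)
  have "r s = q0 (s\<^sup>2) + s * q1 (s\<^sup>2)" for s
    unfolding q0(2)[symmetric] q1(2)[symmetric] using flat_0[OF F(2)] by (cases "s = 0") (auto simp: field_simps)
  then have "f s = (F 0 (s\<^sup>2) + q0 (s\<^sup>2)) + s * (F 1 (s\<^sup>2) + q1 (s\<^sup>2))" for s
    by (simp add: F(3) numeral_2_eq_2 algebra_simps)
  moreover have "smooth_at (\<lambda>x. F 0 x + q0 x) 0" "smooth_at (\<lambda>x. F 1 x + q1 x) 0"
    by (intro smooth_intros F q0 q1)+
  ultimately show ?thesis using that by blast
qed

section \<open>Normal forms of cusps\<close>

lemma eventually_nhds_compose:
  assumes "isCont f p" "\<forall>\<^sub>F y in nhds (f p). P y"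
  shows "\<forall>\<^sub>F x in nhds p. P (f x)"
  using eventually_compose_filterlim[OF assms(2) tendsto_nhds_isCont[OF assms(1)]] .

lemma eventually_nhds_neq:
  fixes f :: "'a::t2_space \<Rightarrow> 'b::t1_space"
  assumes "isCont f p" "f p \<noteq> c"
  shows "\<forall>\<^sub>F x in nhds p. f x \<noteq> c"
  using tendsto_imp_eventually_ne[OF tendsto_nhds_isCont[OF assms(1)] assms(2)] .

lemma eventually_nhds_greater:
  fixes f :: "'a::t2_space \<Rightarrow> real"
  assumes "isCont f p" "f p > c"
  shows "\<forall>\<^sub>F x in nhds p. f x > c"
  using order_tendstoD(1)[OF tendsto_nhds_isCont[OF assms(1)] assms(2)] .

lemma diffeo_germI:
  assumes "f p = q" "smooth_at f p" "g q = p" "smooth_at g q"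
    and "\<forall>\<^sub>F x in nhds p. g (f x) = x" "\<forall>\<^sub>F y in nhds q. f (g y) = y"
  shows "diffeo_germ f p q"
  using assms unfolding diffeo_germ_def by blast

lemma diffeo_germE:
  assumes "diffeo_germ f p q"
  obtains g where "f p = q" "smooth_at f p" "g q = p" "smooth_at g q"
    "\<forall>\<^sub>F x in nhds p. g (f x) = x" "\<forall>\<^sub>F y in nhds q. f (g y) = y"
  using assms unfolding diffeo_germ_def by blast

lemma diffeo_germ_compose:
  assumes "diffeo_germ f p q" "diffeo_germ g q r"
  shows "diffeo_germ (\<lambda>x. g (f x)) p r"
proof -
  obtain f' where f: "f p = q" "smooth_at f p" "f' q = p" "smooth_at f' q"
    "\<forall>\<^sub>F x in nhds p. f' (f x) = x" "\<forall>\<^sub>F y in nhds q. f (f' y) = y"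
    using assms(1) by (rule diffeo_germE)
  obtain g' where g: "g q = r" "smooth_at g q" "g' r = q" "smooth_at g' r"
    "\<forall>\<^sub>F x in nhds q. g' (g x) = x" "\<forall>\<^sub>F y in nhds r. g (g' y) = y"
    using assms(2) by (rule diffeo_germE)
  show ?thesis
  proof (rule diffeo_germI[where g = "\<lambda>y. f' (g' y)"])
    show "smooth_at (\<lambda>x. g (f x)) p"
      by (rule smooth_at_compose) (use f g in auto)
    show "smooth_at (\<lambda>y. f' (g' y)) r"
      by (rule smooth_at_compose) (use f g in auto)
    have "\<forall>\<^sub>F x in nhds p. g' (g (f x)) = f x"
      by (rule eventually_nhds_compose[OF smooth_at_isCont[OF f(2)]]) (use f g in simp)
    with f(5) show "\<forall>\<^sub>F x in nhds p. f' (g' (g (f x))) = x"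
      by eventually_elim simp
    have "\<forall>\<^sub>F y in nhds r. f (f' (g' y)) = g' y"
      by (rule eventually_nhds_compose[OF smooth_at_isCont[OF g(4)]]) (use f g in simp)
    with g(6) show "\<forall>\<^sub>F y in nhds r. g (f (f' (g' y))) = y"
      by eventually_elim simp
  qed (use f g in auto)
qed

lemma cusp_at_target_diffeo:
  assumes "diffeo_germ \<Xi> (\<gamma> t\<^sub>0) (\<delta> t\<^sub>0)" "\<forall>\<^sub>F t in nhds t\<^sub>0. \<Xi> (\<gamma> t) = \<delta> t" "cusp_at p q \<delta> t\<^sub>0"
  shows "cusp_at p q \<gamma> t\<^sub>0"
proof -
  obtain \<phi> \<Phi> where *: "diffeo_germ \<phi> 0 t\<^sub>0" "diffeo_germ \<Phi> (\<delta> t\<^sub>0) 0"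
    "\<forall>\<^sub>F s in nhds 0. \<Phi> (\<delta> (\<phi> s)) = vector [s ^ p, s ^ q]"
    using assms(3) unfolding cusp_at_def by blast
  have "\<phi> 0 = t\<^sub>0" "isCont \<phi> 0"
    using *(1) smooth_at_isCont unfolding diffeo_germ_def by auto
  then have "\<forall>\<^sub>F s in nhds 0. \<Xi> (\<gamma> (\<phi> s)) = \<delta> (\<phi> s)"
    using eventually_nhds_compose[of 0 \<phi> "\<lambda>t. \<Xi> (\<gamma> t) = \<delta> t"] assms(2) by simp
  with *(3) have "\<forall>\<^sub>F s in nhds 0. \<Phi> (\<Xi> (\<gamma> (\<phi> s))) = vector [s ^ p, s ^ q]"
    by eventually_elim simp
  with diffeo_germ_compose[OF assms(1) *(2)] *(1) show ?thesis
    unfolding cusp_at_def by (intro exI[of _ \<phi>] exI[of _ "\<lambda>z. \<Phi> (\<Xi> z)"]) simp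
qed

lemma cusp_at_source_diffeo:
  assumes "diffeo_germ \<psi> s\<^sub>0 t\<^sub>0" "cusp_at p q (\<lambda>s. \<gamma> (\<psi> s)) s\<^sub>0"
  shows "cusp_at p q \<gamma> t\<^sub>0"
proof -
  obtain \<phi> \<Phi> where *: "diffeo_germ \<phi> 0 s\<^sub>0" "diffeo_germ \<Phi> (\<gamma> (\<psi> s\<^sub>0)) 0"
    "\<forall>\<^sub>F s in nhds 0. \<Phi> (\<gamma> (\<psi> (\<phi> s))) = vector [s ^ p, s ^ q]"
    using assms(2) unfolding cusp_at_def by blast
  have "\<psi> s\<^sub>0 = t\<^sub>0" using assms(1) by (simp add: diffeo_germ_def)
  then show ?thesis
    unfolding cusp_at_def using * diffeo_germ_compose[OF *(1) assms(1)]
    by (intro exI[of _ "\<lambda>s. \<psi> (\<phi> s)"] exI[of _ \<Phi>]) simp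
qed

lemma diffeo_germ_id: "diffeo_germ (\<lambda>x. x) p p"
  by (rule diffeo_germI[where g = "\<lambda>x. x"]) (auto intro: smooth_intros)

lemma cusp_at_cong:
  assumes "cusp_at p q \<delta> t\<^sub>0" "\<forall>\<^sub>F t in nhds t\<^sub>0. \<gamma> t = \<delta> t"
  shows "cusp_at p q \<gamma> t\<^sub>0"
  by (rule cusp_at_target_diffeo[where \<Xi> = "\<lambda>x. x", OF _ assms(2,1)])
     (simp add: eventually_nhds_x_imp_x[OF assms(2)] diffeo_germ_id)

section \<open>Removing higher-order terms by triangular coordinate changes\<close>

lemma vector_2_0 [simp]: "vector [0, 0] = (0 :: real^2)"
  by (simp add: vec_eq_iff forall_2)

lemma vector_2_nth [simp]: "vector [z $ 1, z $ 2] = (z :: real^2)"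
  by (simp add: vec_eq_iff forall_2)

lemma cusp_at_monomial:
  assumes "p > 0" "q > 0"
  shows "cusp_at p q (\<lambda>s. vector [s ^ p, s ^ q]) 0"
  unfolding cusp_at_def
  by (rule exI[of _ "\<lambda>x. x"], rule exI[of _ "\<lambda>x. x"])
     (use assms in \<open>simp add: zero_power diffeo_germ_id\<close>)

text \<open>\<open>A\<close> and \<open>B\<close> invert each other in the second variable, with the
  first as a parameter. The explicit inverse takes the place of a two-dimensional inverse function
  theorem.\<close>

lemma diffeo_germ_triangular:
  fixes A B :: "real^2 \<Rightarrow> real"
  assumes "A 0 = 0" "B 0 = 0" "smooth_at A 0" "smooth_at B 0"
    and "\<forall>\<^sub>F z in nhds 0. A (vector [z $ 1, B z]) = z $ 2"
    and "\<forall>\<^sub>F z in nhds 0. B (vector [z $ 1, A z]) = z $ 2"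
  shows "diffeo_germ (\<lambda>z. vector [z $ 1, A z]) (0 :: real^2) 0"
proof (rule diffeo_germI[where g = "\<lambda>z. vector [z $ 1, B z]"])
  show "\<forall>\<^sub>F z::real^2 in nhds 0. vector [(vector [z $ 1, A z] :: real^2) $ 1, B (vector [z $ 1, A z])] = z"
    using assms(6) by eventually_elim simp
  show "\<forall>\<^sub>F z::real^2 in nhds 0. vector [(vector [z $ 1, B z] :: real^2) $ 1, A (vector [z $ 1, B z])] = z"
    using assms(5) by eventually_elim simp
qed (use assms in \<open>auto intro!: smooth_intros\<close>)

lemma smooth_at_compose_nth:
  fixes f :: "real \<Rightarrow> real"
  assumes "smooth_at f 0"
  shows "smooth_at (\<lambda>z::real^'n. f (z $ i)) 0"
  using smooth_at_compose[of f "\<lambda>z. z $ i" 0] assms by (simp add: smooth_at_nth smooth_at_ident)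

lemma deriv_mult_ident_0:
  fixes w :: "real \<Rightarrow> real"
  assumes "smooth_at w 0"
  shows "deriv (\<lambda>t. t * w t) 0 = w 0"
  by (rule DERIV_imp_deriv)
     (auto intro!: derivative_eq_intros smooth_at_has_real_derivative[OF assms])

text \<open>The map \<sigma> is a p-th root of t^p u(t), and \<psi> is its inverse, so the last two
  conclusions together say that \<psi>^p u(\<psi>) = s^p. Keeping the factor \<open>w\<close> of
  \<psi> makes it possible to follow the other coordinate, where t^q becomes s^q w^q.\<close>

lemma reparametrize_to_power:
  fixes u :: "real \<Rightarrow> real"
  assumes "smooth_at u 0" "u 0 > 0" "p > 0"
  obtains \<psi> w where "diffeo_germ \<psi> 0 0" "smooth_at w 0" "w 0 = u 0 powr (- 1 / real p)"
    "\<forall>\<^sub>F s in nhds 0. \<psi> s = s * w s" "\<forall>\<^sub>F s in nhds 0. w s ^ p * u (\<psi> s) = 1"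
proof -
  define \<sigma> where "\<sigma> t = t * u t powr (1 / real p)" for t
  have smooth_pow: "smooth_at (\<lambda>t. u t powr a) 0" for a
    by (intro smooth_intros assms)
  have "smooth_at \<sigma> 0" unfolding \<sigma>_def[abs_def] by (intro smooth_intros smooth_pow)
  moreover have "deriv \<sigma> 0 \<noteq> 0"
    unfolding \<sigma>_def[abs_def] deriv_mult_ident_0[OF smooth_pow] using assms(2) by simp
  moreover have "\<sigma> 0 = 0" by (simp add: \<sigma>_def)
  ultimately have "diffeo_germ \<sigma> 0 0" using inverse_germ_real[of \<sigma> 0] by simp
  then obtain \<psi> where \<psi>: "\<psi> 0 = 0" "smooth_at \<psi> 0" "\<forall>\<^sub>F x in nhds 0. \<psi> (\<sigma> x) = x"
    "\<forall>\<^sub>F y in nhds 0. \<sigma> (\<psi> y) = y"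
    by (rule diffeo_germE)
  define w where "w s = u (\<psi> s) powr (- 1 / real p)" for s
  have pos: "\<forall>\<^sub>F s in nhds 0. u (\<psi> s) > 0"
    using eventually_nhds_greater[OF smooth_at_isCont[OF smooth_at_compose[of u \<psi> 0]], of 0]
      assms(1,2) \<psi>(1,2) by simp
  have "diffeo_germ \<psi> 0 0"
    by (rule diffeo_germI[OF \<psi>(1,2) \<open>\<sigma> 0 = 0\<close> \<open>smooth_at \<sigma> 0\<close> \<psi>(4,3)])
  moreover have "smooth_at w 0"
    unfolding w_def[abs_def]
    using smooth_at_compose[of "\<lambda>t. u t powr (- 1 / real p)" \<psi> 0] \<psi>(1,2) smooth_pow by simp
  moreover have "w 0 = u 0 powr (- 1 / real p)" by (simp add: w_def \<psi>(1))
  moreover have "\<forall>\<^sub>F s in nhds 0. \<psi> s = s * w s"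
    using \<psi>(4) pos
  proof eventually_elim
    case (elim s)
    then have "s * w s = \<psi> s * (u (\<psi> s) powr (1 / real p) * u (\<psi> s) powr (- 1 / real p))"
      by (simp add: \<sigma>_def w_def)
    also have "\<dots> = \<psi> s"
      using elim(2) by (simp add: powr_add[symmetric])
    finally show ?case by simp
  qed
  moreover have "\<forall>\<^sub>F s in nhds 0. w s ^ p * u (\<psi> s) = 1"
    using pos
  proof eventually_elim
    case (elim s)
    have "w s ^ p = u (\<psi> s) powr (- 1)"
      using elim assms(3) unfolding w_def by (subst powr_power) auto
    also have "\<dots> = 1 / u (\<psi> s)"
      using elim by (simp add: powr_minus inverse_eq_divide)
    finally show ?case using elim by simp
  qed
  ultimately show ?thesis using that by blast
qed

lemma diffeo_germ_reflect: "diffeo_germ (\<lambda>z. vector [- (z $ 1), z $ 2]) (0 :: real^2) 0"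
  by (rule diffeo_germI[where g = "\<lambda>z. vector [- (z $ 1), z $ 2]"]) (auto intro!: smooth_intros)

text \<open>Reflecting and reparametrizing the curve makes its first component exactly \<open>s ^ p\<close>.\<close>

lemma cusp_at_normalize_fst:
  fixes u v :: "real \<Rightarrow> real"
  assumes "smooth_at u 0" "u 0 \<noteq> 0" "smooth_at v 0" "v 0 \<noteq> 0" "p > 0" "q > 0"
    and *: "\<And>v. smooth_at v 0 \<Longrightarrow> v 0 \<noteq> 0 \<Longrightarrow> cusp_at p q (\<lambda>s. vector [s ^ p, s ^ q * v s]) 0"
  shows "cusp_at p q (\<lambda>t. vector [t ^ p * u t, t ^ q * v t]) 0"
proof -
  have pos: "cusp_at p q (\<lambda>t. vector [t ^ p * u t, t ^ q * v t]) 0"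
    if u: "smooth_at u 0" "u 0 > 0" for u :: "real \<Rightarrow> real"
  proof -
    obtain \<psi> w where \<psi>: "diffeo_germ \<psi> 0 0" "smooth_at w 0" "w 0 = u 0 powr (- 1 / real p)"
      "\<forall>\<^sub>F s in nhds 0. \<psi> s = s * w s" "\<forall>\<^sub>F s in nhds 0. w s ^ p * u (\<psi> s) = 1"
      by (rule reparametrize_to_power[OF u assms(5)])
    have \<psi>0: "\<psi> 0 = 0" "smooth_at \<psi> 0" using \<psi>(1) by (auto simp: diffeo_germ_def)
    show ?thesis
    proof (rule cusp_at_source_diffeo[OF \<psi>(1)], rule cusp_at_cong)
      show "cusp_at p q (\<lambda>s. vector [s ^ p, s ^ q * (w s ^ q * v (\<psi> s))]) 0"
      proof (rule *)
        show "smooth_at (\<lambda>s. w s ^ q * v (\<psi> s)) 0"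
          using smooth_at_compose[of v \<psi> 0] \<psi>0 assms(3) by (intro smooth_intros \<psi>) simp
        show "w 0 ^ q * v (\<psi> 0) \<noteq> 0" using \<psi>(3) \<psi>0 u assms(4) by simp
      qed
      show "\<forall>\<^sub>F s in nhds 0. vector [\<psi> s ^ p * u (\<psi> s), \<psi> s ^ q * v (\<psi> s)]
          = (vector [s ^ p, s ^ q * (w s ^ q * v (\<psi> s))] :: real^2)"
        using \<psi>(4,5)
      proof eventually_elim
        case (elim s)
        have "\<psi> s ^ p * u (\<psi> s) = s ^ p * (w s ^ p * u (\<psi> s))"
          by (simp add: elim(1) power_mult_distrib)
        also have "\<dots> = s ^ p" by (simp only: elim(2) mult_1_right)
        finally have "\<psi> s ^ p * u (\<psi> s) = s ^ p" .
        moreover have "\<psi> s ^ q * v (\<psi> s) = s ^ q * (w s ^ q * v (\<psi> s))"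
          by (simp add: elim(1) power_mult_distrib)
        ultimately show ?case by (simp only:)
      qed
    qed
  qed
  show ?thesis
  proof (cases "u 0 > 0")
    case True
    then show ?thesis using pos assms(1) by blast
  next
    case False
    have "cusp_at p q (\<lambda>t. vector [t ^ p * (- u t), t ^ q * v t]) 0"
      by (rule pos) (use False assms(1,2) in \<open>auto intro: smooth_intros\<close>)
    then show ?thesis
      by (rule cusp_at_target_diffeo[where \<Xi> = "\<lambda>z. vector [- (z $ 1), z $ 2]", rotated 2])
         (use assms(5,6) in \<open>simp_all add: zero_power diffeo_germ_reflect\<close>)
  qed
qed

text \<open>Write x = s^2 and v = a(x) + s b(x). Then s^5 v = a(x) s^5 + x^3 b(x), which is affine
  in s^5 with coefficients smooth in x and a(0) nonzero. Solving for s^5 is the required change of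
  the second coordinate.\<close>

lemma cusp_at_2_5_normalized:
  fixes v :: "real \<Rightarrow> real"
  assumes "smooth_at v 0" "v 0 \<noteq> 0"
  shows "cusp_at 2 5 (\<lambda>s. vector [s ^ 2, s ^ 5 * v s]) 0"
proof -
  obtain a b where ab: "smooth_at a 0" "smooth_at b 0" "\<And>s. v s = a (s\<^sup>2) + s * b (s\<^sup>2)"
    by (rule smooth_decompose_2[OF assms(1)]) blast
  have a0: "a 0 \<noteq> 0" using ab(3)[of 0] assms(2) by simp
  define A where "A z = (z $ 2 - z $ 1 ^ 3 * b (z $ 1)) / a (z $ 1)" for z :: "real^2"
  define B where "B z = z $ 2 * a (z $ 1) + z $ 1 ^ 3 * b (z $ 1)" for z :: "real^2"
  have sa: "smooth_at (\<lambda>z::real^2. a (z $ 1)) 0" by (intro smooth_intros smooth_at_compose_nth ab)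
  have az: "\<forall>\<^sub>F z::real^2 in nhds 0. a (z $ 1) \<noteq> 0"
    by (rule eventually_nhds_neq[OF smooth_at_isCont[OF sa]]) (simp add: a0)
  have "diffeo_germ (\<lambda>z. vector [z $ 1, A z]) (0 :: real^2) 0"
  proof (rule diffeo_germ_triangular)
    show "smooth_at A 0" unfolding A_def[abs_def]
      by (intro smooth_intros smooth_at_compose_nth ab) (simp add: a0)
    show "smooth_at B 0" unfolding B_def[abs_def] by (intro smooth_intros smooth_at_compose_nth ab)
    show "\<forall>\<^sub>F z in nhds 0. A (vector [z $ 1, B z]) = z $ 2"
      using az by eventually_elim (simp add: A_def B_def)
    show "\<forall>\<^sub>F z in nhds 0. B (vector [z $ 1, A z]) = z $ 2"
      using az by eventually_elim (simp add: A_def B_def)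
  qed (simp_all add: A_def B_def)
  moreover have "\<forall>\<^sub>F s in nhds 0. a (s\<^sup>2) \<noteq> 0"
    using eventually_nhds_neq[OF smooth_at_isCont[OF smooth_at_compose[of a "\<lambda>s::real. s\<^sup>2" 0]], of 0]
      a0 ab(1) by (simp add: smooth_at_power smooth_at_ident)
  then have "\<forall>\<^sub>F s in nhds 0. vector [(vector [s\<^sup>2, s ^ 5 * v s] :: real^2) $ 1, A (vector [s\<^sup>2, s ^ 5 * v s])]
      = (vector [s ^ 2, s ^ 5] :: real^2)"
  proof eventually_elim
    case (elim s)
    have "s ^ 5 * v s = s ^ 5 * a (s\<^sup>2) + (s\<^sup>2) ^ 3 * b (s\<^sup>2)"
      by (simp add: ab(3) algebra_simps power_mult[symmetric] eval_nat_numeral)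
    then have "A (vector [s\<^sup>2, s ^ 5 * v s]) = s ^ 5"
      using elim by (simp add: A_def)
    then show ?case by simp
  qed
  ultimately show ?thesis
    by (intro cusp_at_target_diffeo[where \<Xi> = "\<lambda>z. vector [z $ 1, A z]", OF _ _ cusp_at_monomial]) auto
qed

text \<open>Put x = s^3 and y = s^5. The terms b s^6, s^8, s^9 and s^10 equal b x^2, x y, x^3 and
  y^2, so splitting h modulo 3 writes the second component exactly as P(x) y + Q(x) + R(x) y^2. This
  quadratic in y is solved near y = 0, where P is nonzero. The missing s^2 term in the bracket would
  have produced s^7, which has no such expression.\<close>

lemma cusp_at_3_5_jet_normalized:
  fixes h :: "real \<Rightarrow> real"
  assumes "smooth_at h 0" "a \<noteq> 0"
  shows "cusp_at 3 5 (\<lambda>s. vector [s ^ 3, s ^ 5 * (a + b * s + s ^ 3 * h s)]) 0"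
proof -
  obtain h0 h1 h2 where h: "smooth_at h0 0" "smooth_at h1 0" "smooth_at h2 0"
    "\<And>s. h s = h0 (s ^ 3) + s * h1 (s ^ 3) + s\<^sup>2 * h2 (s ^ 3)"
    by (rule smooth_decompose_3[OF assms(1)]) blast
  define P where "P z = a + z $ 1 * h0 (z $ 1)" for z :: "real^2"
  define Q where "Q z = z $ 1 ^ 2 * (b + z $ 1 * h1 (z $ 1))" for z :: "real^2"
  define R where "R z = h2 (z $ 1)" for z :: "real^2"
  have dep: "P (vector [z $ 1, y]) = P z" "Q (vector [z $ 1, y]) = Q z" "R (vector [z $ 1, y]) = R z"
    for z y by (simp_all add: P_def Q_def R_def)
  have sm: "smooth_at P 0" "smooth_at Q 0" "smooth_at R 0"
    unfolding P_def[abs_def] Q_def[abs_def] R_def[abs_def] by (intro smooth_intros smooth_at_compose_nth h)+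
  have at0: "P 0 = a" "Q 0 = 0" by (simp_all add: P_def Q_def)
  define W where "W z = (z $ 2 - Q z) / P z" for z :: "real^2"
  define D where "D z = 1 + 4 * (R z / P z) * W z" for z
  \<comment> \<open>\<open>A\<close> solves \<open>P * A + R * A\<^sup>2 = z $ 2 - Q\<close>; the rationalized quadratic formula also
     covers \<open>R = 0\<close>.\<close>
  define A where "A z = 2 * W z / (1 + sqrt (D z))" for z
  define B where "B z = P z * z $ 2 + Q z + R z * (z $ 2)\<^sup>2" for z :: "real^2"
  have sW: "smooth_at W 0" unfolding W_def[abs_def]
    by (intro smooth_intros sm) (simp add: at0 assms)
  have sD: "smooth_at D 0" unfolding D_def[abs_def]
    by (intro smooth_intros sm sW) (simp add: at0 assms)
  have D0: "D 0 = 1" by (simp add: D_def W_def at0)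
  have sA: "smooth_at A 0" unfolding A_def[abs_def]
    by (intro smooth_intros sm sW sD) (simp_all add: D0)
  have sB: "smooth_at B 0" unfolding B_def[abs_def] by (intro smooth_intros sm)
  have Pz: "\<forall>\<^sub>F z in nhds 0. P z \<noteq> 0"
    by (rule eventually_nhds_neq[OF smooth_at_isCont[OF sm(1)]]) (simp add: at0 assms)
  have Dz: "\<forall>\<^sub>F z in nhds 0. D z > 0"
    by (rule eventually_nhds_greater[OF smooth_at_isCont[OF sD]]) (simp add: D0)
  \<comment> \<open>After the substitution of \<open>B\<close>, the discriminant \<open>D\<close> is
    the square of this quantity. Its positivity decides which of the two square roots
    \<open>sqrt\<close> returns.\<close>
  have Rz: "\<forall>\<^sub>F z in nhds 0. 1 + 2 * (R z / P z) * z $ 2 > 0"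
    by (rule eventually_nhds_greater[OF smooth_at_isCont]) (auto intro!: smooth_intros sm simp: at0 assms)
  have AB: "A (vector [z $ 1, B z]) = z $ 2" if "P z \<noteq> 0" "1 + 2 * (R z / P z) * z $ 2 > 0" for z
  proof -
    define \<beta> where "\<beta> = R z / P z"
    have \<beta>: "1 + 2 * \<beta> * z $ 2 > 0" using that(2) by (simp add: \<beta>_def)
    have W: "W (vector [z $ 1, B z]) = z $ 2 + \<beta> * (z $ 2)\<^sup>2"
      using that(1) by (simp add: W_def dep B_def \<beta>_def add_divide_distrib)
    have "D (vector [z $ 1, B z]) = (1 + 2 * \<beta> * z $ 2)\<^sup>2"
      unfolding D_def W dep \<beta>_def[symmetric] by (simp add: power2_eq_square algebra_simps)
    then have "sqrt (D (vector [z $ 1, B z])) = 1 + 2 * \<beta> * z $ 2"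
      using \<beta> by simp
    then have "A (vector [z $ 1, B z]) = 2 * (z $ 2 + \<beta> * (z $ 2)\<^sup>2) / (1 + (1 + 2 * \<beta> * z $ 2))"
      unfolding A_def W by simp
    also have "\<dots> = z $ 2"
      using \<beta> by (subst nonzero_divide_eq_eq) (auto simp: power2_eq_square algebra_simps)
    finally show ?thesis .
  qed
  have BA: "B (vector [z $ 1, A z]) = z $ 2" if "P z \<noteq> 0" "D z > 0" for z
  proof -
    define \<beta> where "\<beta> = R z / P z"
    define r where "r = sqrt (D z)"
    have r: "r > 0" "r\<^sup>2 = D z" using that(2) by (simp_all add: r_def)
    have A: "A z * (1 + r) = 2 * W z" using r by (simp add: A_def r_def[symmetric])
    have D: "4 * \<beta> * W z = r\<^sup>2 - 1" by (simp add: r D_def \<beta>_def)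
    have "(A z + \<beta> * (A z)\<^sup>2) * (1 + r)\<^sup>2
        = (A z * (1 + r)) * (1 + r) + \<beta> * (A z * (1 + r))\<^sup>2"
      by (simp add: power2_eq_square algebra_simps)
    also have "\<dots> = 2 * W z * (1 + r) + (4 * \<beta> * W z) * W z"
      unfolding A by (simp add: power2_eq_square algebra_simps)
    also have "\<dots> = W z * (1 + r)\<^sup>2"
      unfolding D by (simp add: power2_eq_square algebra_simps)
    finally have "A z + \<beta> * (A z)\<^sup>2 = W z" using r(1) by simp
    then have "P z * (A z + \<beta> * (A z)\<^sup>2) = z $ 2 - Q z"
      using that(1) by (simp add: W_def)
    then show ?thesis using that(1) by (simp add: B_def dep \<beta>_def algebra_simps)
  qed
  have "diffeo_germ (\<lambda>z. vector [z $ 1, A z]) (0 :: real^2) 0"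
  proof (rule diffeo_germ_triangular[OF _ _ sA sB])
    show "\<forall>\<^sub>F z in nhds 0. A (vector [z $ 1, B z]) = z $ 2"
      using Pz Rz by eventually_elim (rule AB)
    show "\<forall>\<^sub>F z in nhds 0. B (vector [z $ 1, A z]) = z $ 2"
      using Pz Dz by eventually_elim (rule BA)
  qed (simp_all add: A_def B_def W_def at0)
  moreover have "\<forall>\<^sub>F s in nhds 0. vector [(vector [s ^ 3, s ^ 5 * (a + b * s + s ^ 3 * h s)] :: real^2) $ 1,
      A (vector [s ^ 3, s ^ 5 * (a + b * s + s ^ 3 * h s)])] = (vector [s ^ 3, s ^ 5] :: real^2)"
  proof -
    define c where "c s = (vector [s ^ 3, s ^ 5] :: real^2)" for s :: real
    have c: "isCont c 0" "c 0 = 0"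
      unfolding c_def[abs_def] by (auto intro!: smooth_at_isCont smooth_intros)
    have "\<forall>\<^sub>F s in nhds 0. P (c s) \<noteq> 0 \<and> 1 + 2 * (R (c s) / P (c s)) * c s $ 2 > 0"
      by (rule eventually_nhds_compose[OF c(1)]) (unfold c(2), rule eventually_conj[OF Pz Rz])
    then show ?thesis
    proof eventually_elim
      case (elim s)
      have "s ^ 5 * (a + b * s + s ^ 3 * h s) = B (c s)"
        by (simp add: h(4) B_def P_def Q_def R_def c_def algebra_simps power_mult[symmetric] eval_nat_numeral)
      then show ?case
        using AB[of "c s"] elim by (simp add: c_def)
    qed
  qed
  ultimately show ?thesis
    by (intro cusp_at_target_diffeo[where \<Xi> = "\<lambda>z. vector [z $ 1, A z]", OF _ _ cusp_at_monomial]) auto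
qed

text \<open>This is the expansion (1 + g s^2)^(-1/3) = 1 - (g/3) s^2 + ... for a w known only
  through its cube; factoring w^3 - 1 isolates w - 1.\<close>

lemma tendsto_cube_root_one_plus:
  fixes w g :: "real \<Rightarrow> real"
  assumes "\<forall>\<^sub>F s in at 0. w s ^ 3 * (1 + s\<^sup>2 * g s) = 1" "(w \<longlongrightarrow> 1) (at 0)" "(g \<longlongrightarrow> c) (at 0)"
  shows "((\<lambda>s. (w s - 1) / s\<^sup>2) \<longlongrightarrow> - c / 3) (at (0::real))"
proof -
  have "((\<lambda>s. - (w s ^ 3) * g s / ((w s)\<^sup>2 + w s + 1)) \<longlongrightarrow> - (1 ^ 3) * c / (1\<^sup>2 + 1 + 1)) (at 0)"
    by (intro tendsto_intros assms) simp
  moreover have "\<forall>\<^sub>F s in at 0. - (w s ^ 3) * g s / ((w s)\<^sup>2 + w s + 1) = (w s - 1) / s\<^sup>2"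
    using assms(1) order_tendstoD(1)[OF assms(2), of 0, simplified] eventually_neq_at_within[of "0::real"]
  proof eventually_elim
    case (elim s)
    have "(w s)\<^sup>2 + w s + 1 > 0" using elim(2) by (simp add: add_pos_pos)
    moreover have "- (w s ^ 3) * g s * s\<^sup>2 = (w s - 1) * ((w s)\<^sup>2 + w s + 1)"
      using elim(1) by (simp add: power2_eq_square power3_eq_cube algebra_simps)
    ultimately show ?case
      using elim(3) by (subst frac_eq_eq) auto
  qed
  ultimately show ?thesis
    using Lim_transform_eventually by fastforce
qed

lemma cusp_at_3_5_normalized:
  fixes v :: "real \<Rightarrow> real"
  assumes v: "smooth_at v 0" "v 0 \<noteq> 0"
  shows "cusp_at 3 5 (\<lambda>s. vector [s ^ 3, s ^ 5 * v s]) 0"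
proof -
  obtain g1 where g1: "smooth_at g1 0" "\<forall>\<^sub>F t in nhds 0. v t = v 0 + t * g1 t"
    using hadamard[OF v(1)] by blast
  obtain g2 where g2: "smooth_at g2 0" "\<forall>\<^sub>F t in nhds 0. g1 t = g1 0 + t * g2 t"
    using hadamard[OF g1(1)] by blast
  \<comment> \<open>Adding \<open>c\<close> times the second coordinate to the first one removes the \<open>s ^ 7\<close> term of the
     second coordinate, the only gap above 5 in the semigroup generated by 3 and 5.\<close>
  define c where "c = 3 * g2 0 / (5 * (v 0)\<^sup>2)"
  define u where "u s = 1 + s\<^sup>2 * (c * v s)" for s :: real
  have u: "smooth_at u 0" "u 0 = 1" unfolding u_def[abs_def]
    by (intro smooth_intros v) simp
  obtain \<psi> w where \<psi>: "diffeo_germ \<psi> 0 0" "smooth_at w 0" "w 0 = u 0 powr (- 1 / real 3)"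
    "\<forall>\<^sub>F s in nhds 0. \<psi> s = s * w s" "\<forall>\<^sub>F s in nhds 0. w s ^ 3 * u (\<psi> s) = 1"
    by (rule reparametrize_to_power[OF u(1), of 3]) (simp_all add: u)
  have w0: "w 0 = 1" using \<psi>(3) by (simp add: u)
  have \<psi>0: "\<psi> 0 = 0" "smooth_at \<psi> 0" using \<psi>(1) by (auto simp: diffeo_germ_def)
  have lim_comp: "((\<lambda>s. f (\<psi> s)) \<longlongrightarrow> f 0) (at 0)" if "smooth_at f 0" for f :: "real \<Rightarrow> real"
    using smooth_at_isCont[OF smooth_at_compose[of f \<psi> 0]] that \<psi>0 by (simp add: isCont_def)
  have lim_w: "(w \<longlongrightarrow> 1) (at 0)"
    using smooth_at_isCont[OF \<psi>(2)] by (simp add: isCont_def w0)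
  have w1: "((\<lambda>s. (w s - 1) / s\<^sup>2) \<longlongrightarrow> - (1\<^sup>2 * (c * v 0)) / 3) (at 0)"
  proof (rule tendsto_cube_root_one_plus[OF _ lim_w])
    show "((\<lambda>s. (w s)\<^sup>2 * (c * v (\<psi> s))) \<longlongrightarrow> 1\<^sup>2 * (c * v 0)) (at 0)"
      by (intro tendsto_intros lim_w lim_comp v)
    show "\<forall>\<^sub>F s in at 0. w s ^ 3 * (1 + s\<^sup>2 * ((w s)\<^sup>2 * (c * v (\<psi> s)))) = 1"
      using \<psi>(4,5)[THEN eventually_at_of_nhds]
      by eventually_elim (simp add: u_def power_mult_distrib mult.assoc)
  qed
  define V where "V s = w s ^ 5 * v (\<psi> s)" for s
  have V: "smooth_at V 0" "V 0 = v 0"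
    unfolding V_def[abs_def] using smooth_at_compose[of v \<psi> 0] \<psi>0 v(1) w0
    by (auto intro!: smooth_intros \<psi>)
  define E where "E s = V s - v 0 - g1 0 * s" for s
  have E: "smooth_at E 0" unfolding E_def[abs_def] by (intro smooth_intros V)
  \<comment> \<open>Since w = 1 - (c v(0) / 3) s^2 + ..., the factor w^5 contributes -(5/3) c v(0)^2
    to the coefficient of s^2 in \<open>V\<close>, and v contributes g2(0). The constant in
    \<open>c\<close> is the one for which these cancel. The linear coefficient is still g1(0),
    because \<psi>(s) = s + O(s^3).\<close>
  have "((\<lambda>s. E s / s ^ 2) \<longlongrightarrow> 0) (at 0)"
  proof -
    have "((\<lambda>s. (w s - 1) / s\<^sup>2 * (1 + w s + w s ^ 2 + w s ^ 3 + w s ^ 4) * v (\<psi> s)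
        + g1 0 * (s * ((w s - 1) / s\<^sup>2)) + (w s)\<^sup>2 * g2 (\<psi> s)) \<longlongrightarrow>
        - (1\<^sup>2 * (c * v 0)) / 3 * (1 + 1 + 1 ^ 2 + 1 ^ 3 + 1 ^ 4) * v 0 + g1 0 * (0 * (- (1\<^sup>2 * (c * v 0)) / 3)) + 1\<^sup>2 * g2 0)
        (at 0)"
      by (intro tendsto_intros w1 lim_w lim_comp v g2)
    also have "- (1\<^sup>2 * (c * v 0)) / 3 * (1 + 1 + 1 ^ 2 + 1 ^ 3 + 1 ^ 4) * v 0 + g1 0 * (0 * (- (1\<^sup>2 * (c * v 0)) / 3)) + 1\<^sup>2 * g2 0 = 0"
      using v(2) by (simp add: c_def power2_eq_square)
    finally have lim: "((\<lambda>s. (w s - 1) / s\<^sup>2 * (1 + w s + w s ^ 2 + w s ^ 3 + w s ^ 4) * v (\<psi> s)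
        + g1 0 * (s * ((w s - 1) / s\<^sup>2)) + (w s)\<^sup>2 * g2 (\<psi> s)) \<longlongrightarrow> 0) (at 0)" .
    have "\<forall>\<^sub>F t in nhds 0. v t = v 0 + t * (g1 0 + t * g2 t)"
      using g1(2) g2(2) by eventually_elim simp
    then have "\<forall>\<^sub>F s in nhds 0. v (\<psi> s) = v 0 + \<psi> s * (g1 0 + \<psi> s * g2 (\<psi> s))"
      using eventually_nhds_compose[of 0 \<psi> "\<lambda>t. v t = v 0 + t * (g1 0 + t * g2 t)"]
        smooth_at_isCont[OF \<psi>0(2)] \<psi>0(1) by (simp only:)
    from this[THEN eventually_at_of_nhds] \<psi>(4)[THEN eventually_at_of_nhds] eventually_neq_at_within[of "0::real"]
    have "\<forall>\<^sub>F s in at 0. (w s - 1) / s\<^sup>2 * (1 + w s + w s ^ 2 + w s ^ 3 + w s ^ 4) * v (\<psi> s)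
        + g1 0 * (s * ((w s - 1) / s\<^sup>2)) + (w s)\<^sup>2 * g2 (\<psi> s) = E s / s ^ 2"
    proof eventually_elim
      case (elim s)
      have "E s = (w s ^ 5 - 1) * v (\<psi> s) + (v (\<psi> s) - v 0 - g1 0 * s)"
        by (simp add: E_def V_def algebra_simps)
      also have "v (\<psi> s) - v 0 - g1 0 * s = g1 0 * (s * (w s - 1)) + s\<^sup>2 * ((w s)\<^sup>2 * g2 (\<psi> s))"
        unfolding elim(1) by (simp add: elim(2) power2_eq_square algebra_simps)
      also have "w s ^ 5 - 1 = (w s - 1) * (1 + w s + w s ^ 2 + w s ^ 3 + w s ^ 4)"
        by (simp add: eval_nat_numeral algebra_simps)
      finally show ?case
        using elim(3) by (simp add: add_divide_distrib)
    qed
    from Lim_transform_eventually[OF lim this] show ?thesis .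
  qed
  then obtain k where k: "smooth_at k 0" "k 0 = 0" "\<forall>\<^sub>F s in nhds 0. E s = s\<^sup>2 * k s"
    using smooth_factor_power[OF E] by blast
  obtain h where h: "smooth_at h 0" "\<forall>\<^sub>F s in nhds 0. k s = k 0 + s * h s"
    using hadamard[OF k(1)] by blast
  have V_jet: "\<forall>\<^sub>F s in nhds 0. V s = v 0 + g1 0 * s + s ^ 3 * h s"
    using k(3) h(2) by eventually_elim (simp add: E_def k(2) eval_nat_numeral)
  have "cusp_at 3 5 (\<lambda>s. vector [\<psi> s ^ 3 * u (\<psi> s), \<psi> s ^ 5 * v (\<psi> s)]) 0"
  proof (rule cusp_at_cong[OF cusp_at_3_5_jet_normalized[OF h(1) v(2)]])
    show "\<forall>\<^sub>F s in nhds 0. vector [\<psi> s ^ 3 * u (\<psi> s), \<psi> s ^ 5 * v (\<psi> s)]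
        = (vector [s ^ 3, s ^ 5 * (v 0 + g1 0 * s + s ^ 3 * h s)] :: real^2)"
      using \<psi>(4,5) V_jet
    proof eventually_elim
      case (elim s)
      have "\<psi> s ^ 3 * u (\<psi> s) = s ^ 3 * (w s ^ 3 * u (\<psi> s))"
        by (simp add: elim(1) power_mult_distrib)
      also have "\<dots> = s ^ 3" by (simp only: elim(2) mult_1_right)
      finally have "\<psi> s ^ 3 * u (\<psi> s) = s ^ 3" .
      moreover have "\<psi> s ^ 5 * v (\<psi> s) = s ^ 5 * V s"
        by (simp add: elim(1) power_mult_distrib V_def)
      ultimately show ?case by (simp only: elim(3))
    qed
  qed
  then have cusp: "cusp_at 3 5 (\<lambda>s. vector [s ^ 3 * u s, s ^ 5 * v s]) 0"
    by (rule cusp_at_source_diffeo[OF \<psi>(1)])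
  have diffeo: "diffeo_germ (\<lambda>z::real^2. vector [z $ 1 + c * z $ 2, z $ 2]) 0 0"
    by (rule diffeo_germI[where g = "\<lambda>z. vector [z $ 1 - c * z $ 2, z $ 2]"]) (auto intro!: smooth_intros)
  show ?thesis
  proof (rule cusp_at_target_diffeo[OF _ _ cusp])
    show "diffeo_germ (\<lambda>z::real^2. vector [z $ 1 + c * z $ 2, z $ 2])
        (vector [0 ^ 3, 0 ^ 5 * v 0]) (vector [0 ^ 3 * u 0, 0 ^ 5 * v 0])"
      using diffeo by simp
    show "\<forall>\<^sub>F s in nhds 0. vector [(vector [s ^ 3, s ^ 5 * v s] :: real^2) $ 1 + c * (vector [s ^ 3, s ^ 5 * v s] :: real^2) $ 2,
        (vector [s ^ 3, s ^ 5 * v s] :: real^2) $ 2] = (vector [s ^ 3 * u s, s ^ 5 * v s] :: real^2)"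
      by (rule always_eventually) (simp add: u_def algebra_simps eval_nat_numeral)
  qed
qed

text \<open>The recognition criterion for both Wigner caustics: nonzero leading coefficients
  suffice, since for these two pairs of exponents the higher terms can be normalized away.\<close>

lemma cusp_at_of_leading_terms:
  assumes "smooth_at X 0" "((\<lambda>t. X t / t ^ p) \<longlongrightarrow> a) (at 0)" "a \<noteq> 0"
    and "smooth_at Y 0" "((\<lambda>t. Y t / t ^ q) \<longlongrightarrow> b) (at 0)" "b \<noteq> 0"
    and "p = 2 \<and> q = 5 \<or> p = 3 \<and> q = 5"
  shows "cusp_at p q (\<lambda>t. vector [X t, Y t]) 0"
proof -
  obtain u where u: "smooth_at u 0" "u 0 = a" "\<forall>\<^sub>F t in nhds 0. X t = t ^ p * u t"
    using smooth_factor_power[OF assms(1,2)] by blast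
  obtain v where v: "smooth_at v 0" "v 0 = b" "\<forall>\<^sub>F t in nhds 0. Y t = t ^ q * v t"
    using smooth_factor_power[OF assms(4,5)] by blast
  have "cusp_at p q (\<lambda>t. vector [t ^ p * u t, t ^ q * v t]) 0"
    by (rule cusp_at_normalize_fst)
       (use u v assms(3,6,7) cusp_at_2_5_normalized cusp_at_3_5_normalized in auto)
  then show ?thesis
    by (rule cusp_at_cong) (use u(3) v(3) in eventually_elim, simp)
qed

section \<open>Coordinates in the orthonormal frame of the tangent\<close>

lemma inner_vector_2 [simp]: "(vector [a, b] :: real^2) \<bullet> vector [c, d] = a * c + b * d"
  by (simp add: inner_vec_def sum_2)

lemma tangent_inner_tangent: "tangent_vec a \<bullet> tangent_vec b = cos (a - b)"
  by (simp add: tangent_vec_def cos_diff)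

lemma tangent_inner_normal: "tangent_vec a \<bullet> normal_vec b = sin (a - b)"
  by (simp add: tangent_vec_def normal_vec_def sin_diff)

lemma normal_inner_normal: "normal_vec a \<bullet> normal_vec b = cos (a - b)"
  by (simp add: normal_vec_def cos_diff)

lemma frame_expansion: "(z \<bullet> tangent_vec a) *\<^sub>R tangent_vec a + (z \<bullet> normal_vec a) *\<^sub>R normal_vec a = z"
proof -
  have cs: "w * (cos a * cos a) + w * (sin a * sin a) = w" for w
    using sin_cos_squared_add3[of a] by (simp add: distrib_left[symmetric])
  have "z = vector [z $ 1, z $ 2]" by simp
  then obtain x y where z: "z = vector [x, y]" by blast
  show ?thesis
    by (simp add: z vec_eq_iff forall_2 tangent_vec_def normal_vec_def cs algebra_simps)
qed

lemma smooth_at_tangent_normal: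
  fixes \<theta> :: "real \<Rightarrow> real"
  assumes "smooth_at \<theta> p"
  shows "smooth_at (\<lambda>t. tangent_vec (\<theta> t)) p" "smooth_at (\<lambda>t. normal_vec (\<theta> t)) p"
  unfolding tangent_vec_def normal_vec_def
  by (intro smooth_intros smooth_at_compose[of sin \<theta>] smooth_at_compose[of cos \<theta>] smooth_at_sin_cos assms)+

text \<open>Frame coordinates followed by the shear (x, y) -> (x, y + c x^2) are a diffeomorphism
  with polynomial inverse. The shear straightens a parabolic second-order term; it is trivial for
  the 5/3-cusp and has c = 1 / \<rho>(\<theta>(0)) for the 5/2-cusp.\<close>

lemma cusp_at_frame:
  assumes "cusp_at p q (\<lambda>t. vector [(\<gamma> t - \<gamma> 0) \<bullet> tangent_vec a,
      (\<gamma> t - \<gamma> 0) \<bullet> normal_vec a + c * ((\<gamma> t - \<gamma> 0) \<bullet> tangent_vec a)\<^sup>2]) 0"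
  shows "cusp_at p q \<gamma> 0"
proof -
  define e where "e = tangent_vec a"
  define n where "n = normal_vec a"
  have frame: "e \<bullet> e = 1" "n \<bullet> n = 1" "e \<bullet> n = 0" "n \<bullet> e = 0" "(z \<bullet> e) *\<^sub>R e + (z \<bullet> n) *\<^sub>R n = z" for z
    by (simp_all add: e_def n_def tangent_inner_tangent tangent_inner_normal normal_inner_normal
        frame_expansion inner_commute[of "normal_vec a"])
  define \<Xi> :: "real^2 \<Rightarrow> real^2" where
    "\<Xi> z = vector [(z - \<gamma> 0) \<bullet> e, (z - \<gamma> 0) \<bullet> n + c * ((z - \<gamma> 0) \<bullet> e)\<^sup>2]" for z
  define G where "G z = \<gamma> 0 + (z $ 1) *\<^sub>R e + (z $ 2 - c * (z $ 1)\<^sup>2) *\<^sub>R n" for z :: "real^2"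
  have "diffeo_germ \<Xi> (\<gamma> 0) 0"
  proof (rule diffeo_germI[where g = G])
    show "smooth_at \<Xi> (\<gamma> 0)" unfolding \<Xi>_def[abs_def] by (intro smooth_intros)
    show "smooth_at G 0" unfolding G_def[abs_def] by (intro smooth_intros)
    show "\<forall>\<^sub>F z in nhds (\<gamma> 0). G (\<Xi> z) = z"
    proof (rule always_eventually, rule allI)
      fix z
      have "G (\<Xi> z) = \<gamma> 0 + (((z - \<gamma> 0) \<bullet> e) *\<^sub>R e + ((z - \<gamma> 0) \<bullet> n) *\<^sub>R n)"
        by (simp add: G_def \<Xi>_def)
      then show "G (\<Xi> z) = z" unfolding frame(5) by simp
    qed
    show "\<forall>\<^sub>F z in nhds 0. \<Xi> (G z) = z"
      by (rule always_eventually) (simp add: G_def \<Xi>_def inner_add_left frame)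
  qed (simp_all add: \<Xi>_def G_def)
  then show ?thesis
    by (intro cusp_at_target_diffeo[where \<Xi> = \<Xi>, OF _ _ assms]) (simp_all add: \<Xi>_def e_def n_def)
qed

section \<open>Leading terms forced by a 5/3-cusp\<close>

lemma monomial_curve_derivative:
  fixes \<Psi> :: "real^2 \<Rightarrow> 'a::real_normed_vector" and \<tau> :: "real \<Rightarrow> real"
  assumes "smooth_at \<Psi> 0" "smooth_at \<tau> 0" "\<tau> 0 = 0"
  shows "\<forall>\<^sub>F t in nhds 0. ((\<lambda>t. \<Psi> (vector [\<tau> t ^ 3, \<tau> t ^ 5])) has_vector_derivative
      (3 * \<tau> t ^ 2 * deriv \<tau> t) *\<^sub>R frechet_derivative \<Psi> (at (vector [\<tau> t ^ 3, \<tau> t ^ 5])) (axis 1 1) +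
      (5 * \<tau> t ^ 4 * deriv \<tau> t) *\<^sub>R frechet_derivative \<Psi> (at (vector [\<tau> t ^ 3, \<tau> t ^ 5])) (axis 2 1)) (at t)"
proof -
  define c where "c t = (vector [\<tau> t ^ 3, \<tau> t ^ 5] :: real^2)" for t
  have c_eq: "c t = (\<tau> t ^ 3) *\<^sub>R axis 1 1 + (\<tau> t ^ 5) *\<^sub>R axis 2 1" for t
    by (simp add: c_def vec_eq_iff forall_2 axis_def)
  have "isCont c 0" unfolding c_def[abs_def] by (intro smooth_at_isCont smooth_intros assms(2))
  then have "\<forall>\<^sub>F t in nhds 0. smooth_at \<Psi> (c t)"
    using eventually_nhds_compose[of 0 c "smooth_at \<Psi>"] eventually_smooth_at[OF assms(1)] assms(3)
    by (simp add: c_def)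
  with eventually_has_real_derivative[OF assms(2)]
  have "\<forall>\<^sub>F t in nhds 0. ((\<lambda>t. \<Psi> (c t)) has_vector_derivative
      (3 * \<tau> t ^ 2 * deriv \<tau> t) *\<^sub>R frechet_derivative \<Psi> (at (c t)) (axis 1 1) +
      (5 * \<tau> t ^ 4 * deriv \<tau> t) *\<^sub>R frechet_derivative \<Psi> (at (c t)) (axis 2 1)) (at t)"
  proof eventually_elim
    case (elim t)
    have D: "(\<Psi> has_derivative frechet_derivative \<Psi> (at (c t))) (at (c t))"
      by (rule smooth_at_has_derivative[OF elim(2)])
    then have lin: "linear (frechet_derivative \<Psi> (at (c t)))"
      by (rule has_derivative_linear)
    have "(c has_vector_derivative (3 * \<tau> t ^ 2 * deriv \<tau> t) *\<^sub>R axis 1 1 + (5 * \<tau> t ^ 4 * deriv \<tau> t) *\<^sub>R axis 2 1) (at t)"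
      unfolding c_eq[abs_def]
      by (auto intro!: derivative_eq_intros elim(1) simp: has_vector_derivative_def[symmetric] algebra_simps)
    then have "((\<lambda>t. \<Psi> (c t)) has_derivative (\<lambda>h. frechet_derivative \<Psi> (at (c t))
        (h *\<^sub>R ((3 * \<tau> t ^ 2 * deriv \<tau> t) *\<^sub>R axis 1 1 + (5 * \<tau> t ^ 4 * deriv \<tau> t) *\<^sub>R axis 2 1)))) (at t)"
      unfolding has_vector_derivative_def by (rule has_derivative_compose[where f = c, OF _ D])
    then show ?case
      unfolding has_vector_derivative_def
      by (simp only: linear_cmul[OF lin] linear_add[OF lin])
  qed
  then show ?thesis by (simp only: c_def)
qed

text \<open>As k is nonzero, \<eta> has no zeros in a punctured neighbourhood of 0, so the limit of
  sin x / x can be composed with it. Continuity with \<eta>(0) = 0 excludes the other zeros of the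
  sine.\<close>

lemma tendsto_of_sin:
  fixes \<eta> :: "real \<Rightarrow> real"
  assumes "isCont \<eta> 0" "\<eta> 0 = 0" "((\<lambda>t. sin (\<eta> t) / t\<^sup>2) \<longlongrightarrow> k) (at 0)" "k \<noteq> 0"
  shows "((\<lambda>t. \<eta> t / t\<^sup>2) \<longlongrightarrow> k) (at 0)"
proof -
  have lim: "(\<eta> \<longlongrightarrow> 0) (at 0)" using assms(1,2) by (simp add: isCont_def)
  have "\<forall>\<^sub>F t in at 0. sin (\<eta> t) / t\<^sup>2 \<noteq> 0"
    by (rule tendsto_imp_eventually_ne[OF assms(3,4)])
  then have ne: "\<forall>\<^sub>F t in at 0. sin (\<eta> t) \<noteq> 0 \<and> \<eta> t \<noteq> 0"
    by eventually_elim auto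
  then have "filterlim \<eta> (at 0) (at 0)"
    unfolding filterlim_at using lim by (auto elim: eventually_mono)
  moreover have "((\<lambda>x::real. sin x / x) \<longlongrightarrow> 1) (at 0)"
    using DERIV_sin[of "0::real"] by (simp add: has_field_derivative_iff)
  ultimately have "((\<lambda>t. sin (\<eta> t) / \<eta> t) \<longlongrightarrow> 1) (at 0)"
    by (rule filterlim_compose[rotated])
  then have "((\<lambda>t. (sin (\<eta> t) / t\<^sup>2) / (sin (\<eta> t) / \<eta> t)) \<longlongrightarrow> k / 1) (at 0)"
    by (intro tendsto_intros assms(3)) auto
  moreover have "\<forall>\<^sub>F t in at 0. (sin (\<eta> t) / t\<^sup>2) / (sin (\<eta> t) / \<eta> t) = \<eta> t / t\<^sup>2"
    using ne by eventually_elim simp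
  ultimately show ?thesis
    using Lim_transform_eventually by fastforce
qed

text \<open>Comparing the velocity of \<gamma> with that of \<Psi>(\<tau>^3, \<tau>^5) gives l e = 3
  \<tau>^2 \<tau>' P + 5 \<tau>^4 \<tau>' Q, where P and Q are the partial derivatives of \<Psi>
  along the curve. The product with e has order t^2 since P(0) is a nonzero tangent vector. The
  product with the moving normal \<nu>, divided by \<tau>^2 \<tau>', reads 3 P \<bullet> \<nu> + 5
  \<tau>^2 Q \<bullet> \<nu> = 0; up to o(t^2) the first product is -(P(0) \<bullet> e) sin(\<theta>
  - \<theta>(0)), and this determines k.\<close>

lemma leading_terms_of_3_5_cusp:
  assumes cusp: "cusp_at 3 5 \<gamma> 0" and l: "smooth_at l 0" and \<theta>: "smooth_at \<theta> 0"
    and deriv: "\<forall>\<^sub>F t in nhds 0. (\<gamma> has_vector_derivative l t *\<^sub>R tangent_vec (\<theta> t)) (at t)"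
  obtains L k where "((\<lambda>t. l t / t\<^sup>2) \<longlongrightarrow> L) (at 0)" "L \<noteq> 0"
    "((\<lambda>t. (\<theta> t - \<theta> 0) / t\<^sup>2) \<longlongrightarrow> k) (at 0)" "k \<noteq> 0"
proof -
  obtain \<phi> \<Phi> where \<phi>: "diffeo_germ \<phi> 0 0" "diffeo_germ \<Phi> (\<gamma> 0) 0"
    "\<forall>\<^sub>F s in nhds 0. \<Phi> (\<gamma> (\<phi> s)) = vector [s ^ 3, s ^ 5]"
    using cusp unfolding cusp_at_def by blast
  obtain \<tau> where \<tau>: "\<phi> 0 = 0" "smooth_at \<phi> 0" "\<tau> 0 = 0" "smooth_at \<tau> 0"
    "\<forall>\<^sub>F s in nhds 0. \<tau> (\<phi> s) = s" "\<forall>\<^sub>F t in nhds 0. \<phi> (\<tau> t) = t"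
    using \<phi>(1) by (rule diffeo_germE)
  obtain \<Psi> where \<Psi>: "\<Phi> (\<gamma> 0) = 0" "smooth_at \<Phi> (\<gamma> 0)" "\<Psi> 0 = \<gamma> 0" "smooth_at \<Psi> 0"
    "\<forall>\<^sub>F z in nhds (\<gamma> 0). \<Psi> (\<Phi> z) = z" "\<forall>\<^sub>F z in nhds 0. \<Phi> (\<Psi> z) = z"
    using \<phi>(2) by (rule diffeo_germE)
  define c where "c t = (vector [\<tau> t ^ 3, \<tau> t ^ 5] :: real^2)" for t
  define G where "G i z = frechet_derivative \<Psi> (at z) (axis i 1)" for i :: 2 and z
  have smooth_G: "smooth_at (G i) 0" for i
    unfolding G_def[abs_def] by (rule smooth_at_frechet[OF \<Psi>(4)])
  have smooth_c: "smooth_at c 0" and c0: "c 0 = 0"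
    unfolding c_def[abs_def] by (intro smooth_intros \<tau>) (simp add: \<tau>)
  define P where "P t = G 1 (c t)" for t
  define Q where "Q t = G 2 (c t)" for t
  have P: "smooth_at P 0" and Q: "smooth_at Q 0"
    unfolding P_def[abs_def] Q_def[abs_def]
    using smooth_at_compose[of "G _" c 0] smooth_G smooth_c c0 by simp_all

  have contact: "isCont \<gamma> 0"
    using eventually_nhds_x_imp_x[OF deriv] has_vector_derivative_continuous by blast
  have "\<forall>\<^sub>F t in nhds 0. \<Phi> (\<gamma> (\<phi> (\<tau> t))) = c t"
    using eventually_nhds_compose[of 0 \<tau> "\<lambda>s. \<Phi> (\<gamma> (\<phi> s)) = vector [s ^ 3, s ^ 5]"]
      smooth_at_isCont[OF \<tau>(4)] \<phi>(3) \<tau>(3) by (simp add: c_def)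
  moreover have "\<forall>\<^sub>F t in nhds 0. \<Psi> (\<Phi> (\<gamma> t)) = \<gamma> t"
    by (rule eventually_nhds_compose[OF contact \<Psi>(5)])
  ultimately have \<gamma>_eq: "\<forall>\<^sub>F t in nhds 0. \<Psi> (c t) = \<gamma> t"
    using \<tau>(6) by eventually_elim simp
  \<comment> \<open>Two derivatives at t can be compared only if the curves agree in a neighbourhood
    of t, not just at t; hence the use of \<open>eventually_eventually\<close>.\<close>
  have "\<forall>\<^sub>F t in nhds 0. l t *\<^sub>R tangent_vec (\<theta> t)
      = (3 * \<tau> t ^ 2 * deriv \<tau> t) *\<^sub>R P t + (5 * \<tau> t ^ 4 * deriv \<tau> t) *\<^sub>R Q t"
    using monomial_curve_derivative[OF \<Psi>(4) \<tau>(4,3)] deriv \<gamma>_eq[THEN eventually_eventually[THEN iffD2]]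
  proof eventually_elim
    case (elim t)
    let ?D = "(3 * \<tau> t ^ 2 * deriv \<tau> t) *\<^sub>R P t + (5 * \<tau> t ^ 4 * deriv \<tau> t) *\<^sub>R Q t"
    have "((\<lambda>t. \<Psi> (c t)) has_vector_derivative ?D) (at t) \<longleftrightarrow> (\<gamma> has_vector_derivative ?D) (at t)"
      by (rule has_vector_derivative_cong_ev)
         (use elim(3) eventually_nhds_x_imp_x[OF elim(3)] in \<open>auto elim: eventually_mono\<close>)
    then have "(\<gamma> has_vector_derivative ?D) (at t)"
      using elim(1) by (simp add: P_def Q_def G_def c_def)
    then show ?case using elim(2) vector_derivative_unique_at by blast
  qed
  note curve = this

  define e where "e = tangent_vec (\<theta> 0)"
  define n where "n = normal_vec (\<theta> 0)"
  define d where "d = deriv \<tau> 0"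
  obtain T where T: "smooth_at T 0" "\<forall>\<^sub>F t in nhds 0. \<tau> t = \<tau> 0 + t * T t"
    using hadamard[OF \<tau>(4)] by blast
  then have T_eq: "\<forall>\<^sub>F t in nhds 0. \<tau> t = t * T t" by (simp add: \<tau>(3))
  have T0: "T 0 = d"
    using deriv_cong_ev[OF T_eq refl] deriv_mult_ident_0[OF T(1)] by (simp add: d_def)
  have d: "d \<noteq> 0"
  proof -
    have "((\<lambda>s. \<tau> (\<phi> s)) has_real_derivative d * deriv \<phi> 0) (at 0)"
      using DERIV_chain2[where f = \<tau> and g = \<phi>, OF _ smooth_at_has_real_derivative[OF \<tau>(2)]]
        smooth_at_has_real_derivative[OF \<tau>(4)] \<tau>(1) by (simp add: d_def)
    then have "((\<lambda>s. s) has_real_derivative d * deriv \<phi> 0) (at 0)"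
      using DERIV_cong_ev[OF refl \<tau>(5) refl] by blast
    then have "d * deriv \<phi> 0 = 1"
      using DERIV_unique DERIV_ident by blast
    then show ?thesis by auto
  qed

  \<comment> \<open>The chain rule for the identity \<Phi>(\<Psi>(z)) = z near 0 provides a left
    inverse of the differential of \<Psi>.\<close>
  have inj: "v = 0" if "frechet_derivative \<Psi> (at 0) v = 0" for v
  proof -
    have "((\<lambda>z. \<Phi> (\<Psi> z)) has_derivative (\<lambda>v. frechet_derivative \<Phi> (at (\<gamma> 0)) (frechet_derivative \<Psi> (at 0) v))) (at 0)"
      by (rule has_derivative_compose[where g = \<Phi>, OF smooth_at_has_derivative[OF \<Psi>(4)]])
         (simp add: \<Psi>(3) smooth_at_has_derivative[OF \<Psi>(2)])
    moreover have "((\<lambda>z. \<Phi> (\<Psi> z)) has_derivative (\<lambda>v. v)) (at 0)"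
      by (rule has_derivative_transform_eventually[OF has_derivative_ident])
         (use \<Psi>(6)[THEN eventually_at_of_nhds] eventually_nhds_x_imp_x[OF \<Psi>(6)] in \<open>auto elim: eventually_mono\<close>)
    ultimately have "(\<lambda>v. frechet_derivative \<Phi> (at (\<gamma> 0)) (frechet_derivative \<Psi> (at 0) v)) = (\<lambda>v. v)"
      using has_derivative_unique by blast
    then have "v = frechet_derivative \<Phi> (at (\<gamma> 0)) 0" using that by metis
    also have "\<dots> = 0"
      using smooth_at_has_derivative[OF \<Psi>(2)] has_derivative_linear linear_0 by blast
    finally show ?thesis .
  qed
  have lin: "linear (frechet_derivative \<Psi> (at 0))"
    using smooth_at_has_derivative[OF \<Psi>(4)] by (rule has_derivative_linear)

  have lims: "(\<tau> \<longlongrightarrow> 0) (at 0)" "(deriv \<tau> \<longlongrightarrow> d) (at 0)" "(T \<longlongrightarrow> d) (at 0)"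
    "(P \<longlongrightarrow> P 0) (at 0)" "(Q \<longlongrightarrow> Q 0) (at 0)"
    "((\<lambda>t. tangent_vec (\<theta> t)) \<longlongrightarrow> e) (at 0)" "((\<lambda>t. normal_vec (\<theta> t)) \<longlongrightarrow> n) (at 0)"
    using \<tau>(4) T(1) P Q smooth_at_tangent_normal[OF \<theta>] smooth_at_deriv[OF \<tau>(4)]
    by (auto dest!: smooth_at_isCont simp: isCont_def \<tau>(3) T0 d_def e_def n_def)

  have near: "\<forall>\<^sub>F t in at 0. t \<noteq> 0 \<and> \<tau> t \<noteq> 0 \<and> deriv \<tau> t \<noteq> 0 \<and> \<tau> t = t * T t \<and>
      l t *\<^sub>R tangent_vec (\<theta> t) = (3 * \<tau> t ^ 2 * deriv \<tau> t) *\<^sub>R P t + (5 * \<tau> t ^ 4 * deriv \<tau> t) *\<^sub>R Q t"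
    using eventually_neq_at_within[of "0::real"] tendsto_imp_eventually_ne[OF lims(3) d]
      tendsto_imp_eventually_ne[OF lims(2) d] T_eq[THEN eventually_at_of_nhds] curve[THEN eventually_at_of_nhds]
    by eventually_elim simp
  then have normal: "\<forall>\<^sub>F t in at 0. 3 * (P t \<bullet> normal_vec (\<theta> t)) + 5 * \<tau> t ^ 2 * (Q t \<bullet> normal_vec (\<theta> t)) = 0"
  proof eventually_elim
    case (elim t)
    have "(l t *\<^sub>R tangent_vec (\<theta> t)) \<bullet> normal_vec (\<theta> t) = 0"
      by (simp add: tangent_inner_normal)
    then have "(\<tau> t ^ 2 * deriv \<tau> t) * (3 * (P t \<bullet> normal_vec (\<theta> t)) + 5 * \<tau> t ^ 2 * (Q t \<bullet> normal_vec (\<theta> t))) = 0"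
      using elim by (simp add: inner_add_left algebra_simps eval_nat_numeral)
    moreover have "\<tau> t \<noteq> 0" "deriv \<tau> t \<noteq> 0" using elim by blast+
    then have "\<tau> t ^ 2 * deriv \<tau> t \<noteq> 0" by simp
    ultimately show ?case by (simp only: mult_eq_0_iff) simp
  qed
  have P0n: "P 0 \<bullet> n = 0"
  proof -
    have "((\<lambda>t. 3 * (P t \<bullet> normal_vec (\<theta> t)) + 5 * \<tau> t ^ 2 * (Q t \<bullet> normal_vec (\<theta> t))) \<longlongrightarrow>
        3 * (P 0 \<bullet> n) + 5 * 0 ^ 2 * (Q 0 \<bullet> n)) (at 0)"
      by (intro tendsto_intros lims)
    moreover have "((\<lambda>t. 3 * (P t \<bullet> normal_vec (\<theta> t)) + 5 * \<tau> t ^ 2 * (Q t \<bullet> normal_vec (\<theta> t))) \<longlongrightarrow> 0) (at 0)"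
      by (rule tendsto_eventually[OF normal])
    ultimately show ?thesis using LIM_unique by fastforce
  qed
  have P0: "P 0 = (P 0 \<bullet> e) *\<^sub>R e"
    using frame_expansion[of "P 0" "\<theta> 0"] P0n by (simp add: e_def n_def)
  have P0e: "P 0 \<bullet> e \<noteq> 0"
  proof
    assume "P 0 \<bullet> e = 0"
    then have "frechet_derivative \<Psi> (at 0) (axis 1 1) = 0"
      using P0 by (simp add: P_def G_def c0)
    from inj[OF this] show False by (simp add: axis_eq_0_iff)
  qed
  \<comment> \<open>Otherwise P(0) and Q(0), the images of the coordinate axes, would be parallel;
    \<open>v\<close> below is the resulting kernel vector.\<close>
  have Q0n: "Q 0 \<bullet> n \<noteq> 0"
  proof
    assume "Q 0 \<bullet> n = 0"
    then have Q0: "Q 0 = (Q 0 \<bullet> e) *\<^sub>R e"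
      using frame_expansion[of "Q 0" "\<theta> 0"] by (simp add: e_def n_def)
    define v where "v = (Q 0 \<bullet> e) *\<^sub>R axis 1 1 - (P 0 \<bullet> e) *\<^sub>R (axis 2 1 :: real^2)"
    have "frechet_derivative \<Psi> (at 0) v = (Q 0 \<bullet> e) *\<^sub>R P 0 - (P 0 \<bullet> e) *\<^sub>R Q 0"
      unfolding v_def linear_diff[OF lin] linear_cmul[OF lin] by (simp add: P_def Q_def G_def c0)
    also have "\<dots> = 0"
      by (subst P0, subst (2) Q0) simp
    finally have "v = 0" by (rule inj)
    then have "v $ 2 = 0" by simp
    then show False using P0e by (simp add: v_def axis_def)
  qed

  \<comment> \<open>The value is 3 d^3 (P(0) \<bullet> e). The summand with the factor 0 is the
    limit of the \<tau>^4 part, kept in the shape that the limit rules produce.\<close>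
  define L where "L = 3 * d\<^sup>2 * d * (P 0 \<bullet> e) + 5 * 0\<^sup>2 * d ^ 4 * d * (Q 0 \<bullet> e)"
  have L: "((\<lambda>t. l t / t\<^sup>2) \<longlongrightarrow> L) (at 0)"
  proof (rule Lim_transform_eventually)
    show "((\<lambda>t. 3 * (T t)\<^sup>2 * deriv \<tau> t * (P t \<bullet> tangent_vec (\<theta> t))
        + 5 * t\<^sup>2 * T t ^ 4 * deriv \<tau> t * (Q t \<bullet> tangent_vec (\<theta> t))) \<longlongrightarrow> L) (at 0)"
      unfolding L_def by (intro tendsto_intros lims)
    show "\<forall>\<^sub>F t in at 0. 3 * (T t)\<^sup>2 * deriv \<tau> t * (P t \<bullet> tangent_vec (\<theta> t))
        + 5 * t\<^sup>2 * T t ^ 4 * deriv \<tau> t * (Q t \<bullet> tangent_vec (\<theta> t)) = l t / t\<^sup>2"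
      using near
    proof eventually_elim
      case (elim t)
      have "l t = (l t *\<^sub>R tangent_vec (\<theta> t)) \<bullet> tangent_vec (\<theta> t)"
        by (simp add: tangent_inner_tangent)
      also have "\<dots> = t\<^sup>2 * (3 * (T t)\<^sup>2 * deriv \<tau> t * (P t \<bullet> tangent_vec (\<theta> t))
        + 5 * t\<^sup>2 * T t ^ 4 * deriv \<tau> t * (Q t \<bullet> tangent_vec (\<theta> t)))"
        using elim by (simp add: inner_add_left algebra_simps eval_nat_numeral)
      finally show ?case using elim by simp
    qed
  qed

  \<comment> \<open>\<open>P\<close> depends on t through \<open>c t\<close>, which is of order t^3.
    Its increment is therefore negligible against the \<tau>^2 term of the normal relation.\<close>
  have P_flat: "((\<lambda>t. (P t - P 0) \<bullet> v / t\<^sup>2) \<longlongrightarrow> 0) (at 0)" for v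
  proof -
    define A where "A i t = frechet_derivative (G 1) (at (c t)) (axis i 1) \<bullet> v" for i :: 2 and t
    have A: "(A i \<longlongrightarrow> A i 0) (at 0)" for i
    proof -
      have "smooth_at (A i) 0"
        unfolding A_def[abs_def]
        using smooth_at_compose[of "\<lambda>z. frechet_derivative (G 1) (at z) (axis i 1)" c 0]
          smooth_at_frechet[OF smooth_G] smooth_c c0 by (intro smooth_intros) simp
      then show ?thesis using smooth_at_isCont isCont_def by blast
    qed
    have "((\<lambda>t. (P t - P 0) \<bullet> v / t ^ Suc 1) \<longlongrightarrow> 0 / real (Suc 1)) (at 0)"
    proof (rule tendsto_divide_power_antideriv)
      show "\<forall>\<^sub>F t in nhds 0. ((\<lambda>t. (P t - P 0) \<bullet> v) has_real_derivative
          3 * \<tau> t ^ 2 * deriv \<tau> t * A 1 t + 5 * \<tau> t ^ 4 * deriv \<tau> t * A 2 t) (at t)"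
        using monomial_curve_derivative[OF smooth_G[of 1] \<tau>(4,3)]
      proof eventually_elim
        case (elim t)
        have "((\<lambda>t. (P t - P 0) \<bullet> v) has_vector_derivative
            ((3 * \<tau> t ^ 2 * deriv \<tau> t) *\<^sub>R frechet_derivative (G 1) (at (c t)) (axis 1 1) +
             (5 * \<tau> t ^ 4 * deriv \<tau> t) *\<^sub>R frechet_derivative (G 1) (at (c t)) (axis 2 1) - 0) \<bullet> v) (at t)"
          unfolding P_def c_def
          by (intro bounded_linear.has_vector_derivative[OF bounded_linear_inner_left]
              has_vector_derivative_diff elim has_vector_derivative_const)
        then show ?case
          by (simp add: A_def inner_add_left has_real_derivative_iff_has_vector_derivative)
      qed
      have "((\<lambda>t. 3 * (t * (T t)\<^sup>2) * deriv \<tau> t * A 1 t + 5 * (t ^ 3 * T t ^ 4) * deriv \<tau> t * A 2 t) \<longlongrightarrow>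
          3 * (0 * d\<^sup>2) * d * A 1 0 + 5 * (0 ^ 3 * d ^ 4) * d * A 2 0) (at 0)"
        by (intro tendsto_intros lims A)
      moreover have "\<forall>\<^sub>F t in at 0. 3 * (t * (T t)\<^sup>2) * deriv \<tau> t * A 1 t + 5 * (t ^ 3 * T t ^ 4) * deriv \<tau> t * A 2 t
          = (3 * \<tau> t ^ 2 * deriv \<tau> t * A 1 t + 5 * \<tau> t ^ 4 * deriv \<tau> t * A 2 t) / t ^ 1"
        using near by eventually_elim (simp add: add_divide_distrib eval_nat_numeral)
      ultimately show "((\<lambda>t. (3 * \<tau> t ^ 2 * deriv \<tau> t * A 1 t + 5 * \<tau> t ^ 4 * deriv \<tau> t * A 2 t) / t ^ 1) \<longlongrightarrow> 0) (at 0)"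
        using Lim_transform_eventually by fastforce
    qed simp
    then show ?thesis by (simp add: power2_eq_square)
  qed

  \<comment> \<open>This solves 3 (P(0) \<bullet> e) k = 5 d^2 (Q(0) \<bullet> n), the normal
    relation at order t^2. The zero summands are the limits of the increments of
    \<open>P\<close>.\<close>
  define k where "k = (5 * d\<^sup>2 * (Q 0 \<bullet> n) + 3 * (0 * cos 0 + 0 * 0)) / (3 * (P 0 \<bullet> e))"
  have sin_lim: "((\<lambda>t. sin (\<theta> t - \<theta> 0) / t\<^sup>2) \<longlongrightarrow> k) (at 0)"
  proof (rule Lim_transform_eventually)
    have \<theta>_lim: "((\<lambda>t. \<theta> t - \<theta> 0) \<longlongrightarrow> 0) (at 0)"
      using smooth_at_isCont[OF \<theta>] by (simp add: isCont_def LIM_zero)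
    have cs: "((\<lambda>t. cos (\<theta> t - \<theta> 0)) \<longlongrightarrow> cos 0) (at 0)" "((\<lambda>t. - sin (\<theta> t - \<theta> 0)) \<longlongrightarrow> 0) (at 0)"
      using tendsto_cos[OF \<theta>_lim] tendsto_minus[OF tendsto_sin[OF \<theta>_lim]] by simp_all
    show "((\<lambda>t. (5 * (T t)\<^sup>2 * (Q t \<bullet> normal_vec (\<theta> t)) + 3 * ((P t - P 0) \<bullet> n / t\<^sup>2 * cos (\<theta> t - \<theta> 0)
        + (P t - P 0) \<bullet> e / t\<^sup>2 * - sin (\<theta> t - \<theta> 0))) / (3 * (P 0 \<bullet> e))) \<longlongrightarrow> k) (at 0)"
      unfolding k_def using P0e by (intro tendsto_intros lims P_flat cs) auto
    show "\<forall>\<^sub>F t in at 0. (5 * (T t)\<^sup>2 * (Q t \<bullet> normal_vec (\<theta> t)) + 3 * ((P t - P 0) \<bullet> n / t\<^sup>2 * cos (\<theta> t - \<theta> 0)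
        + (P t - P 0) \<bullet> e / t\<^sup>2 * - sin (\<theta> t - \<theta> 0))) / (3 * (P 0 \<bullet> e)) = sin (\<theta> t - \<theta> 0) / t\<^sup>2"
      using near normal
    proof eventually_elim
      case (elim t)
      define \<nu> where "\<nu> = normal_vec (\<theta> t)"
      define s where "s = sin (\<theta> t - \<theta> 0)"
      have \<nu>: "e \<bullet> \<nu> = - s" "n \<bullet> \<nu> = cos (\<theta> t - \<theta> 0)"
        using sin_minus[of "\<theta> t - \<theta> 0"] cos_minus[of "\<theta> t - \<theta> 0"]
        by (simp_all add: e_def n_def \<nu>_def s_def tangent_inner_normal normal_inner_normal)
      have split: "z \<bullet> \<nu> = (z \<bullet> e) * (e \<bullet> \<nu>) + (z \<bullet> n) * (n \<bullet> \<nu>)" for z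
        using frame_expansion[of z "\<theta> 0"] unfolding e_def n_def
        by (metis inner_add_left inner_scaleR_left)
      have "P t \<bullet> \<nu> = P 0 \<bullet> \<nu> + (P t - P 0) \<bullet> \<nu>" by (simp add: inner_diff_left)
      also have "\<dots> = - (P 0 \<bullet> e) * s + ((P t - P 0) \<bullet> e * - s + (P t - P 0) \<bullet> n * cos (\<theta> t - \<theta> 0))"
        unfolding split[of "P 0"] split[of "P t - P 0"] \<nu> P0n by simp
      finally have "3 * (P 0 \<bullet> e) * s = 5 * (t * T t)\<^sup>2 * (Q t \<bullet> \<nu>)
          + 3 * ((P t - P 0) \<bullet> n * cos (\<theta> t - \<theta> 0) + (P t - P 0) \<bullet> e * - s)"
        using elim by (simp add: \<nu>_def algebra_simps)
      also have "\<dots> = t\<^sup>2 * (5 * (T t)\<^sup>2 * (Q t \<bullet> \<nu>)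
          + 3 * ((P t - P 0) \<bullet> n / t\<^sup>2 * cos (\<theta> t - \<theta> 0) + (P t - P 0) \<bullet> e / t\<^sup>2 * - s))"
        using elim by (simp add: field_simps power_mult_distrib)
      finally show ?case
        using elim P0e unfolding \<nu>_def[symmetric] s_def[symmetric]
        by (subst frac_eq_eq) (auto simp: mult_ac)
    qed
  qed
  have k: "k \<noteq> 0" using d P0e Q0n by (simp add: k_def)
  have "isCont (\<lambda>t. \<theta> t - \<theta> 0) 0"
    by (intro smooth_at_isCont smooth_intros \<theta>)
  from tendsto_of_sin[OF this _ sin_lim k] have "((\<lambda>t. (\<theta> t - \<theta> 0) / t\<^sup>2) \<longlongrightarrow> k) (at 0)" by simp
  moreover have "L \<noteq> 0" using d P0e by (simp add: L_def)
  ultimately show ?thesis using that L k by blast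
qed

section \<open>Wigner caustic and centre symmetry set\<close>

lemma smooth_tendsto_at:
  fixes f :: "real \<Rightarrow> real"
  shows "smooth_at f 0 \<Longrightarrow> (f \<longlongrightarrow> f 0) (at 0)"
  using smooth_at_isCont isCont_def by blast

lemma deriv_deriv_of_tendsto:
  fixes f :: "real \<Rightarrow> real"
  assumes "smooth_at f 0" "((\<lambda>t. deriv f t / t) \<longlongrightarrow> c) (at 0)"
  shows "(deriv ^^ 2) f 0 = c"
proof -
  have "((\<lambda>t. deriv (deriv f) t / t ^ 0) \<longlongrightarrow> real (Suc 0) * c) (at 0)"
    by (rule tendsto_divide_power_deriv) (use assms in \<open>simp_all add: smooth_at_deriv\<close>)
  moreover have "(deriv (deriv f) \<longlongrightarrow> deriv (deriv f) 0) (at 0)"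
    by (rule smooth_tendsto_at) (intro smooth_intros assms)
  ultimately show ?thesis
    using LIM_unique[of "deriv (deriv f)"] by (simp add: numeral_2_eq_2)
qed

text \<open>The cusp hypothesis on \<open>\<gamma>p\<close> is used only through \<open>L\<close>
  and \<open>k\<close>, that is, through \<open>l\<close> and \<theta> - \<theta>(0) both having
  order exactly 2.\<close>

locale parallel_germs =
  fixes \<gamma>p \<gamma>m :: "real \<Rightarrow> real^2" and l \<theta> \<rho> :: "real \<Rightarrow> real" and L k :: real
  assumes smooth_\<gamma>p: "smooth_at \<gamma>p 0" and smooth_\<gamma>m: "smooth_at \<gamma>m (\<theta> 0)"
    and smooth_l: "smooth_at l 0" and smooth_\<theta>: "smooth_at \<theta> 0" and smooth_\<rho>: "smooth_at \<rho> (\<theta> 0)"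
    and \<gamma>p: "\<forall>\<^sub>F t in nhds 0. (\<gamma>p has_vector_derivative l t *\<^sub>R tangent_vec (\<theta> t)) (at t)"
    and \<gamma>m: "\<forall>\<^sub>F u in nhds (\<theta> 0). (\<gamma>m has_vector_derivative (- \<rho> u) *\<^sub>R tangent_vec u) (at u)"
    and L: "((\<lambda>t. l t / t\<^sup>2) \<longlongrightarrow> L) (at 0)" "L \<noteq> 0"
    and k: "((\<lambda>t. (\<theta> t - \<theta> 0) / t\<^sup>2) \<longlongrightarrow> k) (at 0)" "k \<noteq> 0"
begin

lemma smooth_\<eta>: "smooth_at (\<lambda>t. \<theta> t - \<theta> 0) 0"
  by (intro smooth_intros smooth_\<theta>)

lemma smooth_trig: "smooth_at (\<lambda>t. sin (\<theta> t - \<theta> 0)) 0" "smooth_at (\<lambda>t. cos (\<theta> t - \<theta> 0)) 0"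
  using smooth_at_compose[of sin "\<lambda>t. \<theta> t - \<theta> 0" 0] smooth_at_compose[of cos "\<lambda>t. \<theta> t - \<theta> 0" 0]
    smooth_\<eta> smooth_at_sin_cos by auto

lemma smooth_\<rho>\<theta>: "smooth_at (\<lambda>t. \<rho> (\<theta> t)) 0"
  using smooth_at_compose[of \<rho> \<theta> 0] smooth_\<rho> smooth_\<theta> by simp

lemma deriv_\<theta>: "((\<lambda>t. deriv \<theta> t / t) \<longlongrightarrow> 2 * k) (at 0)"
proof (rule Lim_transform_eventually)
  show "((\<lambda>t. deriv (\<lambda>t. \<theta> t - \<theta> 0) t / t ^ 1) \<longlongrightarrow> 2 * k) (at 0)"
    using tendsto_divide_power_deriv[OF smooth_\<eta>, of 1 k] k(1) by (simp add: numeral_2_eq_2)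
  show "\<forall>\<^sub>F t in at 0. deriv (\<lambda>t. \<theta> t - \<theta> 0) t / t ^ 1 = deriv \<theta> t / t"
    using eventually_has_real_derivative[OF smooth_\<theta>, THEN eventually_at_of_nhds]
  proof eventually_elim
    case (elim t)
    have "((\<lambda>t. \<theta> t - \<theta> 0) has_real_derivative deriv \<theta> t) (at t)"
      by (auto intro!: derivative_eq_intros elim)
    then show ?case by (simp add: DERIV_imp_deriv)
  qed
qed

lemma deriv_l: "((\<lambda>t. deriv l t / t) \<longlongrightarrow> 2 * L) (at 0)"
  using tendsto_divide_power_deriv[OF smooth_l, of 1 L] L(1) by (simp add: numeral_2_eq_2)

lemma second_derivatives: "(deriv ^^ 2) \<theta> 0 = 2 * k" "(deriv ^^ 2) l 0 = 2 * L"
  using deriv_deriv_of_tendsto smooth_\<theta> deriv_\<theta> smooth_l deriv_l by auto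

lemma sin_lim: "((\<lambda>t. sin (\<theta> t - \<theta> 0) / t\<^sup>2) \<longlongrightarrow> k) (at 0)"
proof -
  have "\<forall>\<^sub>F t in nhds 0. ((\<lambda>t. sin (\<theta> t - \<theta> 0)) has_real_derivative cos (\<theta> t - \<theta> 0) * deriv \<theta> t) (at t)"
    using eventually_has_real_derivative[OF smooth_\<theta>]
    by eventually_elim (auto intro!: derivative_eq_intros)
  moreover have "((\<lambda>t. cos (\<theta> t - \<theta> 0) * (deriv \<theta> t / t)) \<longlongrightarrow> cos (\<theta> 0 - \<theta> 0) * (2 * k)) (at 0)"
    by (intro tendsto_intros smooth_tendsto_at[OF smooth_trig(2)] deriv_\<theta>)
  ultimately show ?thesis
    using tendsto_divide_power_antideriv[of "\<lambda>t. sin (\<theta> t - \<theta> 0)" "\<lambda>t. cos (\<theta> t - \<theta> 0) * deriv \<theta> t" 1 "2 * k"]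
    by (simp add: power2_eq_square)
qed

section \<open>Derivative and leading terms of the Wigner caustic\<close>

abbreviation "W \<equiv> wigner_caustic \<gamma>p \<gamma>m \<theta>"

definition "m t = 1/2 * (l t - \<rho> (\<theta> t) * deriv \<theta> t)"

lemma \<gamma>m_\<theta>: "\<forall>\<^sub>F t in nhds 0. ((\<lambda>t. \<gamma>m (\<theta> t)) has_vector_derivative (- (\<rho> (\<theta> t) * deriv \<theta> t)) *\<^sub>R tangent_vec (\<theta> t)) (at t)"
  using eventually_has_real_derivative[OF smooth_\<theta>]
    eventually_nhds_compose[OF smooth_at_isCont[OF smooth_\<theta>] \<gamma>m]
proof eventually_elim
  case (elim t)
  have "((\<gamma>m \<circ> \<theta>) has_vector_derivative deriv \<theta> t *\<^sub>R ((- \<rho> (\<theta> t)) *\<^sub>R tangent_vec (\<theta> t))) (at t)"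
    using elim unfolding has_real_derivative_iff_has_vector_derivative by (rule vector_diff_chain_at)
  then show ?case by (simp add: o_def mult.commute)
qed

lemma wigner_derivative: "\<forall>\<^sub>F t in nhds 0. (W has_vector_derivative m t *\<^sub>R tangent_vec (\<theta> t)) (at t)"
  using \<gamma>p \<gamma>m_\<theta>
proof eventually_elim
  case (elim t)
  have "((\<lambda>t. (1/2) *\<^sub>R (\<gamma>p t + \<gamma>m (\<theta> t))) has_vector_derivative
      (1/2) *\<^sub>R (l t *\<^sub>R tangent_vec (\<theta> t) + (- (\<rho> (\<theta> t) * deriv \<theta> t)) *\<^sub>R tangent_vec (\<theta> t))) (at t)"
    by (intro bounded_linear.has_vector_derivative[OF bounded_linear_scaleR_right]
        has_vector_derivative_add elim)
  then show ?case
    by (simp add: wigner_caustic_def[abs_def] m_def scaleR_add_left[symmetric] del: scaleR_minus_left)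
qed

lemma smooth_W: "smooth_at W 0"
  unfolding wigner_caustic_def[abs_def]
  using smooth_at_compose[of \<gamma>m \<theta> 0] smooth_\<gamma>m smooth_\<theta> by (intro smooth_intros smooth_\<gamma>p) simp

definition "X t = (W t - W 0) \<bullet> tangent_vec (\<theta> 0)"
definition "Y t = (W t - W 0) \<bullet> normal_vec (\<theta> 0)"

lemma smooth_XY: "smooth_at X 0" "smooth_at Y 0"
  unfolding X_def[abs_def] Y_def[abs_def] by (intro smooth_intros smooth_W)+

lemma XY_derivative:
  "\<forall>\<^sub>F t in nhds 0. (X has_real_derivative m t * cos (\<theta> t - \<theta> 0)) (at t)"
  "\<forall>\<^sub>F t in nhds 0. (Y has_real_derivative m t * sin (\<theta> t - \<theta> 0)) (at t)"
proof -
  have *: "\<forall>\<^sub>F t in nhds 0. ((\<lambda>t. (W t - W 0) \<bullet> v) has_real_derivative m t * (tangent_vec (\<theta> t) \<bullet> v)) (at t)" for v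
    using wigner_derivative
  proof eventually_elim
    case (elim t)
    have "((\<lambda>t. (W t - W 0) \<bullet> v) has_vector_derivative (m t *\<^sub>R tangent_vec (\<theta> t) - 0) \<bullet> v) (at t)"
      by (intro bounded_linear.has_vector_derivative[OF bounded_linear_inner_left]
          has_vector_derivative_diff elim has_vector_derivative_const)
    then show ?case by (simp add: has_real_derivative_iff_has_vector_derivative)
  qed
  show "\<forall>\<^sub>F t in nhds 0. (X has_real_derivative m t * cos (\<theta> t - \<theta> 0)) (at t)"
    "\<forall>\<^sub>F t in nhds 0. (Y has_real_derivative m t * sin (\<theta> t - \<theta> 0)) (at t)"
    using *[of "tangent_vec (\<theta> 0)"] *[of "normal_vec (\<theta> 0)"]
    by (simp_all add: X_def[abs_def] Y_def[abs_def] tangent_inner_tangent tangent_inner_normal)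
qed

lemma trig_lims: "((\<lambda>t. sin (\<theta> t - \<theta> 0)) \<longlongrightarrow> 0) (at 0)" "((\<lambda>t. cos (\<theta> t - \<theta> 0)) \<longlongrightarrow> 1) (at 0)"
  using smooth_tendsto_at[OF smooth_trig(1)] smooth_tendsto_at[OF smooth_trig(2)] by simp_all

lemma wigner_cusp_3_5:
  assumes "\<rho> (\<theta> 0) = 0"
  shows "cusp_at 3 5 W 0"
proof (rule cusp_at_frame[where c = 0])
  have "smooth_at (\<lambda>u. \<theta> 0 + u) 0" by (intro smooth_intros)
  then have "smooth_at (\<lambda>u. \<rho> (\<theta> 0 + u)) 0"
    using smooth_at_compose[of \<rho> "\<lambda>u. \<theta> 0 + u" 0] smooth_\<rho> by simp
  then obtain h where h: "smooth_at h 0" "\<forall>\<^sub>F u in nhds 0. \<rho> (\<theta> 0 + u) = \<rho> (\<theta> 0 + 0) + u * h u"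
    by (rule hadamard)
  \<comment> \<open>Here \<rho>(\<theta>) is divisible by \<theta> - \<theta>(0), hence of order at
    least 2. With \<theta>' of order 1 the product is O(t^3), and only \<open>l\<close> contributes
    to \<open>m\<close> at order 2.\<close>
  have m: "((\<lambda>t. m t / t\<^sup>2) \<longlongrightarrow> L / 2) (at 0)"
  proof (rule Lim_transform_eventually)
    have h': "smooth_at (\<lambda>t. h (\<theta> t - \<theta> 0)) 0"
      using smooth_at_compose[of h "\<lambda>t. \<theta> t - \<theta> 0" 0] smooth_\<eta> h(1) by simp
    have "((\<lambda>t. 1/2 * (l t / t\<^sup>2 - ((\<theta> t - \<theta> 0) / t\<^sup>2 * h (\<theta> t - \<theta> 0)) * (deriv \<theta> t / t) * t)) \<longlongrightarrow>
        1/2 * (L - (k * h (\<theta> 0 - \<theta> 0)) * (2 * k) * 0)) (at 0)"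
      by (intro tendsto_intros L k deriv_\<theta> smooth_tendsto_at[OF h'])
    then show "((\<lambda>t. 1/2 * (l t / t\<^sup>2 - ((\<theta> t - \<theta> 0) / t\<^sup>2 * h (\<theta> t - \<theta> 0)) * (deriv \<theta> t / t) * t)) \<longlongrightarrow> L / 2) (at 0)"
      by simp
    have "\<forall>\<^sub>F t in nhds 0. \<rho> (\<theta> t) = (\<theta> t - \<theta> 0) * h (\<theta> t - \<theta> 0)"
      using eventually_nhds_compose[of 0 "\<lambda>t. \<theta> t - \<theta> 0" "\<lambda>u. \<rho> (\<theta> 0 + u) = \<rho> (\<theta> 0 + 0) + u * h u"]
        smooth_at_isCont[OF smooth_\<eta>] h(2) assms by simp
    from this[THEN eventually_at_of_nhds] eventually_neq_at_within[of "0::real"]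
    show "\<forall>\<^sub>F t in at 0. 1/2 * (l t / t\<^sup>2 - ((\<theta> t - \<theta> 0) / t\<^sup>2 * h (\<theta> t - \<theta> 0)) * (deriv \<theta> t / t) * t) = m t / t\<^sup>2"
    proof eventually_elim
      case (elim t)
      define a where "a = \<theta> t - \<theta> 0"
      show ?case
        using elim(2) unfolding m_def elim(1) a_def[symmetric] by (simp add: diff_divide_distrib)
    qed
  qed
  have "((\<lambda>t. X t / t ^ Suc 2) \<longlongrightarrow> (L / 2 * 1) / real (Suc 2)) (at 0)"
  proof (rule tendsto_divide_power_antideriv[OF XY_derivative(1)])
    have "((\<lambda>t. m t / t\<^sup>2 * cos (\<theta> t - \<theta> 0)) \<longlongrightarrow> L / 2 * 1) (at 0)"
      by (intro tendsto_intros m trig_lims)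
    then show "((\<lambda>t. m t * cos (\<theta> t - \<theta> 0) / t ^ 2) \<longlongrightarrow> L / 2 * 1) (at 0)" by simp
  qed (simp add: X_def)
  moreover have "((\<lambda>t. Y t / t ^ Suc 4) \<longlongrightarrow> (L / 2 * k) / real (Suc 4)) (at 0)"
  proof (rule tendsto_divide_power_antideriv[OF XY_derivative(2)])
    have "((\<lambda>t. (m t / t\<^sup>2) * (sin (\<theta> t - \<theta> 0) / t\<^sup>2)) \<longlongrightarrow> L / 2 * k) (at 0)"
      by (intro tendsto_intros m sin_lim)
    then show "((\<lambda>t. m t * sin (\<theta> t - \<theta> 0) / t ^ 4) \<longlongrightarrow> L / 2 * k) (at 0)"
      by (simp add: power_add[symmetric])
  qed (simp add: Y_def)
  ultimately have "cusp_at 3 5 (\<lambda>t. vector [X t, Y t]) 0"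
    using L(2) k(2) smooth_XY
    by (intro cusp_at_of_leading_terms[where a = "L / 2 * 1 / real (Suc 2)" and b = "L / 2 * k / real (Suc 4)"])
       simp_all
  then show "cusp_at 3 5 (\<lambda>t. vector [(W t - W 0) \<bullet> tangent_vec (\<theta> 0),
      (W t - W 0) \<bullet> normal_vec (\<theta> 0) + 0 * ((W t - W 0) \<bullet> tangent_vec (\<theta> 0))\<^sup>2]) 0"
    by (simp add: X_def Y_def)
qed

lemma wigner_cusp_2_5:
  assumes \<rho>0: "\<rho> (\<theta> 0) \<noteq> 0"
  shows "cusp_at 2 5 W 0"
proof -
  define c where "c = 1 / \<rho> (\<theta> 0)"
  \<comment> \<open>Now \<rho>(\<theta>) \<theta>' has order 1 with coefficient 2
    \<rho>(\<theta>(0)) k, and dominates \<open>l\<close>, which has order 2.\<close>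
  have m: "((\<lambda>t. m t / t) \<longlongrightarrow> - (\<rho> (\<theta> 0) * k)) (at 0)"
  proof (rule Lim_transform_eventually)
    have "((\<lambda>t. 1/2 * (l t / t\<^sup>2 * t - \<rho> (\<theta> t) * (deriv \<theta> t / t))) \<longlongrightarrow>
        1/2 * (L * 0 - \<rho> (\<theta> 0) * (2 * k))) (at 0)"
      by (intro tendsto_intros L deriv_\<theta> smooth_tendsto_at[OF smooth_\<rho>\<theta>])
    then show "((\<lambda>t. 1/2 * (l t / t\<^sup>2 * t - \<rho> (\<theta> t) * (deriv \<theta> t / t))) \<longlongrightarrow> - (\<rho> (\<theta> 0) * k)) (at 0)"
      by simp
    show "\<forall>\<^sub>F t in at 0. 1/2 * (l t / t\<^sup>2 * t - \<rho> (\<theta> t) * (deriv \<theta> t / t)) = m t / t"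
      using eventually_neq_at_within[of "0::real"]
      by eventually_elim (simp add: m_def field_simps power2_eq_square)
  qed
  have X: "((\<lambda>t. X t / t ^ Suc 1) \<longlongrightarrow> - (\<rho> (\<theta> 0) * k) * 1 / real (Suc 1)) (at 0)"
  proof (rule tendsto_divide_power_antideriv[OF XY_derivative(1)])
    have "((\<lambda>t. m t / t * cos (\<theta> t - \<theta> 0)) \<longlongrightarrow> - (\<rho> (\<theta> 0) * k) * 1) (at 0)"
      by (intro tendsto_intros m trig_lims)
    then show "((\<lambda>t. m t * cos (\<theta> t - \<theta> 0) / t ^ 1) \<longlongrightarrow> - (\<rho> (\<theta> 0) * k) * 1) (at 0)" by simp
  qed (simp add: X_def)
  \<comment> \<open>\<open>(Y + c * X\<^sup>2)' = m * V\<close>. The choice of \<open>c\<close> cancels the terms of order 2 in \<open>V\<close>.\<close>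
  define V where "V t = sin (\<theta> t - \<theta> 0) + 2 * c * X t * cos (\<theta> t - \<theta> 0)" for t
  \<comment> \<open>When \<open>V\<close> is differentiated with X' = m cos \<eta>, this is the
    factor that collects next to cos \<eta> times \<theta>'. By the choice of \<open>c\<close> it
    vanishes at 0; its derivative contains the factor \<theta>' and so tends to 0, which gives g =
    o(t).\<close>
  define g where "g t = 1 - c * \<rho> (\<theta> t) * cos (\<theta> t - \<theta> 0)" for t
  have g: "((\<lambda>t. g t / t) \<longlongrightarrow> 0) (at 0)"
  proof -
    have "((\<lambda>t. g t / t ^ Suc 0) \<longlongrightarrow> 0 / real (Suc 0)) (at 0)"
    proof (rule tendsto_divide_power_antideriv)
      from eventually_nhds_compose[OF smooth_at_isCont[OF smooth_\<theta>] eventually_has_real_derivative[OF smooth_\<rho>]]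
        eventually_has_real_derivative[OF smooth_\<theta>]
      show "\<forall>\<^sub>F t in nhds 0. (g has_real_derivative - c * (deriv \<rho> (\<theta> t) * deriv \<theta> t) * cos (\<theta> t - \<theta> 0)
          + c * \<rho> (\<theta> t) * sin (\<theta> t - \<theta> 0) * deriv \<theta> t) (at t)"
        unfolding g_def[abs_def]
      proof eventually_elim
        case (elim t)
        have "((\<lambda>t. \<rho> (\<theta> t)) has_real_derivative deriv \<rho> (\<theta> t) * deriv \<theta> t) (at t)"
          by (rule DERIV_chain2[where g = \<theta>, OF elim])
        then show ?case
          by (auto intro!: derivative_eq_intros elim simp: algebra_simps)
      qed
      have \<rho>': "smooth_at (\<lambda>t. deriv \<rho> (\<theta> t)) 0"
        using smooth_at_compose[of "deriv \<rho>" \<theta> 0] smooth_at_deriv[OF smooth_\<rho>] smooth_\<theta> by simp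
      have "((\<lambda>t. - c * (deriv \<rho> (\<theta> t) * (deriv \<theta> t / t * t)) * cos (\<theta> t - \<theta> 0)
          + c * \<rho> (\<theta> t) * sin (\<theta> t - \<theta> 0) * (deriv \<theta> t / t * t)) \<longlongrightarrow>
          - c * (deriv \<rho> (\<theta> 0) * (2 * k * 0)) * 1 + c * \<rho> (\<theta> 0) * 0 * (2 * k * 0)) (at 0)"
        by (intro tendsto_intros deriv_\<theta> trig_lims smooth_tendsto_at[OF \<rho>'] smooth_tendsto_at[OF smooth_\<rho>\<theta>])
      then have lim: "((\<lambda>t. - c * (deriv \<rho> (\<theta> t) * (deriv \<theta> t / t * t)) * cos (\<theta> t - \<theta> 0)
          + c * \<rho> (\<theta> t) * sin (\<theta> t - \<theta> 0) * (deriv \<theta> t / t * t)) \<longlongrightarrow> 0) (at 0)"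
        by simp
      show "((\<lambda>t. (- c * (deriv \<rho> (\<theta> t) * deriv \<theta> t) * cos (\<theta> t - \<theta> 0)
          + c * \<rho> (\<theta> t) * sin (\<theta> t - \<theta> 0) * deriv \<theta> t) / t ^ 0) \<longlongrightarrow> 0) (at 0)"
      proof (rule Lim_transform_eventually[OF lim])
        show "\<forall>\<^sub>F t in at 0. - c * (deriv \<rho> (\<theta> t) * (deriv \<theta> t / t * t)) * cos (\<theta> t - \<theta> 0)
            + c * \<rho> (\<theta> t) * sin (\<theta> t - \<theta> 0) * (deriv \<theta> t / t * t)
            = (- c * (deriv \<rho> (\<theta> t) * deriv \<theta> t) * cos (\<theta> t - \<theta> 0)
            + c * \<rho> (\<theta> t) * sin (\<theta> t - \<theta> 0) * deriv \<theta> t) / t ^ 0"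
          using eventually_neq_at_within[of "0::real"] by eventually_elim simp
      qed
    qed (simp add: g_def c_def \<rho>0)
    then show ?thesis by simp
  qed
  \<comment> \<open>At order t^2 only the term c l of V' survives: \<theta>' g is o(t^2), and X
    sin(\<eta>) \<theta>' is O(t^5).\<close>
  have V: "((\<lambda>t. V t / t ^ Suc 2) \<longlongrightarrow> (c * L) / real (Suc 2)) (at 0)"
  proof (rule tendsto_divide_power_antideriv)
    show "\<forall>\<^sub>F t in nhds 0. (V has_real_derivative cos (\<theta> t - \<theta> 0) * (deriv \<theta> t * g t + c * l t * cos (\<theta> t - \<theta> 0))
        - 2 * c * X t * sin (\<theta> t - \<theta> 0) * deriv \<theta> t) (at t)"
      using XY_derivative(1) eventually_has_real_derivative[OF smooth_\<theta>]
      unfolding V_def[abs_def]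
      by eventually_elim (auto intro!: derivative_eq_intros simp: g_def m_def algebra_simps)
    have "((\<lambda>t. cos (\<theta> t - \<theta> 0) * (deriv \<theta> t / t * (g t / t) + c * (l t / t\<^sup>2) * cos (\<theta> t - \<theta> 0))
        - 2 * c * (X t / t ^ Suc 1) * sin (\<theta> t - \<theta> 0) * (deriv \<theta> t / t * t)) \<longlongrightarrow>
        1 * (2 * k * 0 + c * L * 1) - 2 * c * (- (\<rho> (\<theta> 0) * k) * 1 / real (Suc 1)) * 0 * (2 * k * 0)) (at 0)"
      by (intro tendsto_intros trig_lims deriv_\<theta> g L X)
    then have lim: "((\<lambda>t. cos (\<theta> t - \<theta> 0) * (deriv \<theta> t / t * (g t / t) + c * (l t / t\<^sup>2) * cos (\<theta> t - \<theta> 0))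
        - 2 * c * (X t / t ^ Suc 1) * sin (\<theta> t - \<theta> 0) * (deriv \<theta> t / t * t)) \<longlongrightarrow> c * L) (at 0)"
      by simp
    show "((\<lambda>t. (cos (\<theta> t - \<theta> 0) * (deriv \<theta> t * g t + c * l t * cos (\<theta> t - \<theta> 0))
        - 2 * c * X t * sin (\<theta> t - \<theta> 0) * deriv \<theta> t) / t ^ 2) \<longlongrightarrow> c * L) (at 0)"
    proof (rule Lim_transform_eventually[OF lim])
      show "\<forall>\<^sub>F t in at 0. cos (\<theta> t - \<theta> 0) * (deriv \<theta> t / t * (g t / t) + c * (l t / t\<^sup>2) * cos (\<theta> t - \<theta> 0))
          - 2 * c * (X t / t ^ Suc 1) * sin (\<theta> t - \<theta> 0) * (deriv \<theta> t / t * t)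
          = (cos (\<theta> t - \<theta> 0) * (deriv \<theta> t * g t + c * l t * cos (\<theta> t - \<theta> 0))
          - 2 * c * X t * sin (\<theta> t - \<theta> 0) * deriv \<theta> t) / t ^ 2"
        using eventually_neq_at_within[of "0::real"]
        by eventually_elim (simp add: power2_eq_square field_simps)
    qed
  qed (simp add: V_def X_def)
  define Z where "Z t = Y t + c * (X t)\<^sup>2" for t
  \<comment> \<open>The limit equals -k L / 15. It is the sum of k L / 10, from
    \<open>\<gamma>p\<close> in \<open>Y\<close>, and -k L / 6, from the cross term of
    \<open>\<gamma>p\<close> and \<open>\<gamma>m\<close> in c X^2; \<open>\<gamma>m\<close> alone
    contributes only O(\<eta>^3) = O(t^6).\<close>
  have "((\<lambda>t. Z t / t ^ Suc 4) \<longlongrightarrow> (- (\<rho> (\<theta> 0) * k) * (c * L / real (Suc 2))) / real (Suc 4)) (at 0)"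
  proof (rule tendsto_divide_power_antideriv)
    show "\<forall>\<^sub>F t in nhds 0. (Z has_real_derivative m t * V t) (at t)"
      using XY_derivative unfolding Z_def[abs_def]
      by eventually_elim (auto intro!: derivative_eq_intros simp: V_def algebra_simps)
    have "((\<lambda>t. m t / t * (V t / t ^ Suc 2)) \<longlongrightarrow> - (\<rho> (\<theta> 0) * k) * (c * L / real (Suc 2))) (at 0)"
      by (intro tendsto_intros m V)
    then show "((\<lambda>t. m t * V t / t ^ 4) \<longlongrightarrow> - (\<rho> (\<theta> 0) * k) * (c * L / real (Suc 2))) (at 0)"
      by (simp add: eval_nat_numeral)
  qed (simp add: Z_def X_def Y_def)
  moreover have "smooth_at Z 0" unfolding Z_def[abs_def] by (intro smooth_intros smooth_XY)
  ultimately have "cusp_at 2 5 (\<lambda>t. vector [X t, Z t]) 0"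
    using X L(2) k(2) \<rho>0 smooth_XY(1)
    by (intro cusp_at_of_leading_terms[where a = "- (\<rho> (\<theta> 0) * k) * 1 / real (Suc 1)"
          and b = "(- (\<rho> (\<theta> 0) * k) * (c * L / real (Suc 2))) / real (Suc 4)"])
       (simp_all add: c_def numeral_2_eq_2[symmetric])
  then show ?thesis
    using cusp_at_frame[of 2 5 W "\<theta> 0" c] by (simp add: X_def Y_def Z_def)
qed

text \<open>With l = t^2 l2 and \<theta>' = t \<theta>1, numerator and denominator of the ratio
  share exactly one factor t. Cancelling it leaves 1 - t l2 / D with D(0) = 2 \<rho>(\<theta>(0)) k
  nonzero, from which the value 1 and the slope -l2(0) / D(0) are read off; \<open>L\<close> and
  \<open>k\<close> are half the second derivatives of \<open>l\<close> and
  \<open>\<theta>\<close>.\<close>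

lemma css_extension:
  assumes \<rho>0: "\<rho> (\<theta> 0) \<noteq> 0" and chord: "chord \<gamma>p \<gamma>m \<theta> 0 \<noteq> 0"
  obtains \<Lambda> S where
    "smooth_extension_at \<Lambda> (css_ratio l \<theta> \<rho>) (css_domain l \<theta> \<rho>) 0" "\<Lambda> 0 = 1"
    "deriv \<Lambda> 0 = - ((deriv ^^ 2) l 0) / (2 * \<rho> (\<theta> 0) * (deriv ^^ 2) \<theta> 0)" "deriv \<Lambda> 0 \<noteq> 0"
    "smooth_extension_at S (css \<gamma>p \<gamma>m l \<theta> \<rho>) (css_domain l \<theta> \<rho>) 0"
    "S 0 = \<gamma>p 0" "vector_derivative S (at 0) \<noteq> 0"
proof -
  obtain l2 where l2: "smooth_at l2 0" "l2 0 = L" "\<forall>\<^sub>F t in nhds 0. l t = t\<^sup>2 * l2 t"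
    using smooth_factor_power[OF smooth_l L(1)] .
  obtain \<theta>1 where \<theta>1: "smooth_at \<theta>1 0" "\<theta>1 0 = 2 * k" "\<forall>\<^sub>F t in nhds 0. deriv \<theta> t = t ^ 1 * \<theta>1 t"
    using smooth_factor_power[OF smooth_at_deriv[OF smooth_\<theta>], of 1 "2 * k"] deriv_\<theta> by auto
  define N where "N t = \<rho> (\<theta> t) * \<theta>1 t" for t
  define D where "D t = t * l2 t + N t" for t
  define \<Lambda> where "\<Lambda> t = 1 - t * (l2 t / D t)" for t
  have N: "smooth_at N 0" unfolding N_def[abs_def] by (intro smooth_intros smooth_\<rho>\<theta> \<theta>1)
  have D: "smooth_at D 0" unfolding D_def[abs_def] by (intro smooth_intros l2 N)
  have D0: "D 0 = 2 * \<rho> (\<theta> 0) * k" by (simp add: D_def N_def \<theta>1(2))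
  have D_nz: "D 0 \<noteq> 0" using D0 \<rho>0 k(2) by simp
  have quot: "smooth_at (\<lambda>t. l2 t / D t) 0" by (intro smooth_intros l2 D D_nz)
  have \<Lambda>: "smooth_at \<Lambda> 0" unfolding \<Lambda>_def[abs_def] by (intro smooth_intros quot)
  have \<Lambda>0: "\<Lambda> 0 = 1" by (simp add: \<Lambda>_def)
  have "(\<Lambda> has_real_derivative 0 - (1 * (l2 0 / D 0) + deriv (\<lambda>t. l2 t / D t) 0 * 0)) (at 0)"
    unfolding \<Lambda>_def[abs_def]
    by (intro DERIV_diff DERIV_const DERIV_mult DERIV_ident smooth_at_has_real_derivative[OF quot])
  then have \<Lambda>_deriv: "(\<Lambda> has_real_derivative - (L / (2 * \<rho> (\<theta> 0) * k))) (at 0)"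
    by (simp add: l2(2) D0)
  then have deriv_\<Lambda>: "deriv \<Lambda> 0 = - (L / (2 * \<rho> (\<theta> 0) * k))"
    by (rule DERIV_imp_deriv)
  have D_ev: "\<forall>\<^sub>F t in nhds 0. D t \<noteq> 0"
    by (rule eventually_nhds_neq[OF smooth_at_isCont[OF D] D_nz])
  have den: "\<forall>\<^sub>F t in nhds 0. l t + \<rho> (\<theta> t) * deriv \<theta> t = t * D t"
    using l2(3) \<theta>1(3) by eventually_elim (simp add: D_def N_def power2_eq_square algebra_simps)
  have dom: "\<forall>\<^sub>F t in at 0. t \<in> css_domain l \<theta> \<rho>"
    using den[THEN eventually_at_of_nhds] D_ev[THEN eventually_at_of_nhds] eventually_neq_at_within[of "0::real"]
    by eventually_elim (simp add: css_domain_def)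
  have ratio: "\<forall>\<^sub>F t in nhds 0. t \<in> css_domain l \<theta> \<rho> \<longrightarrow> \<Lambda> t = css_ratio l \<theta> \<rho> t"
    using den \<theta>1(3) D_ev
  proof eventually_elim
    case (elim t)
    show ?case
    proof
      assume "t \<in> css_domain l \<theta> \<rho>"
      \<comment> \<open>The denominator vanishes at t = 0, so membership in the domain excludes 0
        and permits cancelling t.\<close>
      then have t: "t \<noteq> 0" using elim(1) by (auto simp: css_domain_def)
      have "css_ratio l \<theta> \<rho> t = t * N t / (t * D t)"
        unfolding css_ratio_def elim(1) by (simp add: elim(2) N_def)
      also have "\<dots> = \<Lambda> t"
        using t elim(3) by (simp add: \<Lambda>_def field_simps) (simp add: D_def)
      finally show "\<Lambda> t = css_ratio l \<theta> \<rho> t" by simp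
    qed
  qed
  define S where "S t = \<gamma>m (\<theta> t) + \<Lambda> t *\<^sub>R chord \<gamma>p \<gamma>m \<theta> t" for t
  have \<gamma>m\<theta>: "smooth_at (\<lambda>t. \<gamma>m (\<theta> t)) 0"
    using smooth_at_compose[of \<gamma>m \<theta> 0] smooth_\<gamma>m smooth_\<theta> by simp
  have smooth_S: "smooth_at S 0"
    unfolding S_def[abs_def] chord_def[abs_def] by (intro smooth_intros \<gamma>m\<theta> \<Lambda> smooth_\<gamma>p)
  have S_ev: "\<forall>\<^sub>F t in nhds 0. t \<in> css_domain l \<theta> \<rho> \<longrightarrow> S t = css \<gamma>p \<gamma>m l \<theta> \<rho> t"
    using ratio by eventually_elim (simp add: S_def css_def)
  \<comment> \<open>Both ends of the chord are stationary at 0, so the derivative of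
    \<open>S\<close> there is \<Lambda>'(0) times the chord, and regularity follows from the chord
    being nonzero.\<close>
  have "l 0 = 0" "deriv \<theta> 0 = 0"
    using eventually_nhds_x_imp_x[OF l2(3)] eventually_nhds_x_imp_x[OF \<theta>1(3)] by simp_all
  then have "(\<gamma>p has_vector_derivative 0) (at 0)" "((\<lambda>t. \<gamma>m (\<theta> t)) has_vector_derivative 0) (at 0)"
    using eventually_nhds_x_imp_x[OF \<gamma>p] eventually_nhds_x_imp_x[OF \<gamma>m_\<theta>] by simp_all
  then have "(S has_vector_derivative 0 + (\<Lambda> 0 *\<^sub>R (0 - 0) + deriv \<Lambda> 0 *\<^sub>R chord \<gamma>p \<gamma>m \<theta> 0)) (at 0)"
    unfolding S_def[abs_def] chord_def
    by (intro has_vector_derivative_add has_vector_derivative_scaleR has_vector_derivative_diff)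
       (simp_all add: smooth_at_has_real_derivative[OF \<Lambda>])
  then have "vector_derivative S (at 0) = deriv \<Lambda> 0 *\<^sub>R chord \<gamma>p \<gamma>m \<theta> 0"
    by (simp add: vector_derivative_at)
  moreover have nz: "deriv \<Lambda> 0 \<noteq> 0" using L(2) k(2) \<rho>0 by (simp add: deriv_\<Lambda>)
  ultimately have "vector_derivative S (at 0) \<noteq> 0" using chord by simp
  moreover have "S 0 = \<gamma>p 0" by (simp add: S_def chord_def \<Lambda>0)
  moreover have "deriv \<Lambda> 0 = - ((deriv ^^ 2) l 0) / (2 * \<rho> (\<theta> 0) * (deriv ^^ 2) \<theta> 0)"
    unfolding second_derivatives deriv_\<Lambda> by simp
  ultimately show ?thesis
    using that[of \<Lambda> S] \<Lambda> \<Lambda>0 nz dom ratio smooth_S S_ev unfolding smooth_extension_at_def by blast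
qed

end

theorem theorem6p4:
  fixes \<gamma>p \<gamma>m np nm :: "real \<Rightarrow> real^2"
    and l \<theta> \<rho>m :: "real \<Rightarrow> real"
  assumes "cooriented_frontal_at \<gamma>p np 0"
    and "legendre_data_at \<gamma>p np l \<theta> 0"
    and "cooriented_frontal_at \<gamma>m nm (\<theta> 0)"
    and "angularly_regular_at \<gamma>m nm (\<theta> 0)"
    and "\<forall>\<^sub>F u in nhds (\<theta> 0). nm u = - normal_vec u"
    and "smooth_at \<rho>m (\<theta> 0)"
    and "\<forall>\<^sub>F u in nhds (\<theta> 0).
           (\<gamma>m has_vector_derivative (- \<rho>m u) *\<^sub>R tangent_vec u) (at u)"
    and "chord \<gamma>p \<gamma>m \<theta> 0 \<noteq> 0"
    and "det (vector [chord \<gamma>p \<gamma>m \<theta> 0, tangent_vec (\<theta> 0)] :: real^2^2) \<noteq> 0"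
    and "cusp_at 3 5 \<gamma>p 0"
  shows
    "(\<rho>m (\<theta> 0) \<noteq> 0 \<longrightarrow>
        cusp_at 2 5 (wigner_caustic \<gamma>p \<gamma>m \<theta>) 0 \<and>
        (\<exists>S. smooth_extension_at S (css \<gamma>p \<gamma>m l \<theta> \<rho>m) (css_domain l \<theta> \<rho>m) 0 \<and>
             S 0 = \<gamma>p 0 \<and> vector_derivative S (at 0) \<noteq> 0) \<and>
        (\<exists>\<Lambda>. smooth_extension_at \<Lambda> (css_ratio l \<theta> \<rho>m) (css_domain l \<theta> \<rho>m) 0 \<and>
             \<Lambda> 0 = 1 \<and>
             deriv \<Lambda> 0 = - ((deriv ^^ 2) l 0) / (2 * \<rho>m (\<theta> 0) * (deriv ^^ 2) \<theta> 0) \<and>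
             deriv \<Lambda> 0 \<noteq> 0)) \<and>
     (\<rho>m (\<theta> 0) = 0 \<longrightarrow> cusp_at 3 5 (wigner_caustic \<gamma>p \<gamma>m \<theta>) 0)"
proof -
  have smooth: "smooth_at \<gamma>p 0" "smooth_at \<gamma>m (\<theta> 0)" "smooth_at l 0" "smooth_at \<theta> 0"
    using assms(1-3) by (simp_all add: cooriented_frontal_at_def legendre_data_at_def)
  have \<gamma>p: "\<forall>\<^sub>F t in nhds 0. (\<gamma>p has_vector_derivative l t *\<^sub>R tangent_vec (\<theta> t)) (at t)"
    using assms(2) by (auto simp: legendre_data_at_def elim: eventually_mono)
  obtain L k where Lk: "((\<lambda>t. l t / t\<^sup>2) \<longlongrightarrow> L) (at 0)" "L \<noteq> 0"
    "((\<lambda>t. (\<theta> t - \<theta> 0) / t\<^sup>2) \<longlongrightarrow> k) (at 0)" "k \<noteq> 0"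
    by (rule leading_terms_of_3_5_cusp[OF assms(10) smooth(3,4) \<gamma>p])
  interpret parallel_germs \<gamma>p \<gamma>m l \<theta> \<rho>m L k
    by unfold_locales (use smooth assms(6,7) \<gamma>p Lk in auto)
  show ?thesis
  proof (intro conjI impI)
    assume \<rho>0: "\<rho>m (\<theta> 0) \<noteq> 0"
    show "cusp_at 2 5 (wigner_caustic \<gamma>p \<gamma>m \<theta>) 0" by (rule wigner_cusp_2_5[OF \<rho>0])
    obtain \<Lambda> S where
      "smooth_extension_at \<Lambda> (css_ratio l \<theta> \<rho>m) (css_domain l \<theta> \<rho>m) 0" "\<Lambda> 0 = 1"
      "deriv \<Lambda> 0 = - ((deriv ^^ 2) l 0) / (2 * \<rho>m (\<theta> 0) * (deriv ^^ 2) \<theta> 0)" "deriv \<Lambda> 0 \<noteq> 0"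
      "smooth_extension_at S (css \<gamma>p \<gamma>m l \<theta> \<rho>m) (css_domain l \<theta> \<rho>m) 0"
      "S 0 = \<gamma>p 0" "vector_derivative S (at 0) \<noteq> 0"
      by (rule css_extension[OF \<rho>0 assms(8)])
    then show "\<exists>S. smooth_extension_at S (css \<gamma>p \<gamma>m l \<theta> \<rho>m) (css_domain l \<theta> \<rho>m) 0 \<and>
        S 0 = \<gamma>p 0 \<and> vector_derivative S (at 0) \<noteq> 0"
      "\<exists>\<Lambda>. smooth_extension_at \<Lambda> (css_ratio l \<theta> \<rho>m) (css_domain l \<theta> \<rho>m) 0 \<and> \<Lambda> 0 = 1 \<and>
        deriv \<Lambda> 0 = - ((deriv ^^ 2) l 0) / (2 * \<rho>m (\<theta> 0) * (deriv ^^ 2) \<theta> 0) \<and> deriv \<Lambda> 0 \<noteq> 0"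
      by blast+
  next
    assume "\<rho>m (\<theta> 0) = 0"
    then show "cusp_at 3 5 (wigner_caustic \<gamma>p \<gamma>m \<theta>) 0" by (rule wigner_cusp_3_5)
  qed
qed

end
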